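(* Let $\mathbf{k}$ be a field and let $U$ be a $2$-dimensional $\mathbf{k}$-vector space. There are natural $\mathrm{SL}(U)$-equivariant isomorphisms $$\bigwedge^m(\mathrm{Sym}^n U) \cong \mathrm{Sym}^{n-m+1}(\mathrm{D}^m U)\qquad (m,n\ge 0,\ n\geq m-1),$$ $$\mathrm{D}^m(\mathrm{Sym}^{n-m} U) \cong \mathrm{Sym}^{n-m}(\mathrm{D}^m U)\qquad (n\geq m\geq 0).$$
   Context: $\mathrm{Sym}^m$, $\bigwedge^m$, $\mathrm{D}^m$ denote the $m$-th symmetric, exterior and divided power functors; $\mathrm{D}^m V\subset V^{\otimes m}$ is the subspace of symmetric (i.e. $\mathfrak{S}_m$-invariant) tensors. $\mathrm{SL}(U)\cong \mathrm{SL}_2(\mathbf{k})$ is the group of operators on $U$ of determinant $1$. The field $\mathbf{k}$ has arbitrary characteristic. *)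

theory Defs
  imports
    "Jordan_Normal_Form.VS_Connect"
    "HOL-Library.Poly_Mapping"
    "HOL-Combinatorics.Permutations"
    "HOL-Algebra.AbelCoset"
begin

text \<open>
  The base field is an arbitrary type of class \<open>field\<close>, viewed as the ring record
  \<open>class_ring\<close>; a vector space over it is a module record \<open>V\<close> with
  \<open>vectorspace class_ring V\<close>. The ring fields \<open>mult\<close> and \<open>one\<close> of a module record carry no
  meaning and are given dummy values below.
\<close>

section \<open>Free modules and quotient modules\<close>

definition free_module :: "'s set \<Rightarrow> ('k::field, 's \<Rightarrow>\<^sub>0 'k) module" where
  "free_module S =
     \<lparr>carrier = {p. Poly_Mapping.keys p \<subseteq> S},
      mult = (\<lambda>_ _. 0), one = 0, zero = 0, add = (+),
      smult = (\<lambda>c. Poly_Mapping.map ((*) c))\<rparr>"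

definition free_map :: "('s \<Rightarrow> 't) \<Rightarrow> ('s \<Rightarrow>\<^sub>0 'k::field) \<Rightarrow> ('t \<Rightarrow>\<^sub>0 'k)" where
  "free_map h p = (\<Sum>s\<in>Poly_Mapping.keys p. Poly_Mapping.single (h s) (Poly_Mapping.lookup p s))"

definition quot_module :: "('k, 'v) module \<Rightarrow> 'v set \<Rightarrow> ('k, 'v set) module" where
  "quot_module M N =
     \<lparr>carrier = a_rcosets\<^bsub>M\<^esub> N,
      mult = (\<lambda>_ _. N), one = N, zero = N, add = (<+>\<^bsub>M\<^esub>),
      smult = (\<lambda>c X. \<Union>x\<in>X. N +>\<^bsub>M\<^esub> (c \<odot>\<^bsub>M\<^esub> x))\<rparr>"

text \<open>The map induced by \<open>h\<close> from a quotient of its source into the quotient of \<open>M\<close> by \<open>N\<close>. It is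
  a map of cosets as soon as \<open>h\<close> sends the submodule divided out in the source into \<open>N\<close>, which is
  the case in all uses below.\<close>

definition quot_map :: "('k, 'w) module \<Rightarrow> 'w set \<Rightarrow> ('v \<Rightarrow> 'w) \<Rightarrow> 'v set \<Rightarrow> 'w set" where
  "quot_map M N h X = (\<Union>x\<in>X. N +>\<^bsub>M\<^esub> h x)"

abbreviation mspan :: "('k::field, 'v) module \<Rightarrow> 'v set \<Rightarrow> 'v set" where
  "mspan \<equiv> LinearCombinations.module.span class_ring"

section \<open>Tensor powers\<close>

definition tuples :: "nat \<Rightarrow> ('k, 'v) module \<Rightarrow> 'v list set" where
  "tuples m V = {xs. length xs = m \<and> set xs \<subseteq> carrier V}"

definition multilinear_rels :: "nat \<Rightarrow> ('k::field, 'v) module \<Rightarrow> ('v list \<Rightarrow>\<^sub>0 'k) set" where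
  "multilinear_rels m V =
     {Poly_Mapping.single (xs[i := x \<oplus>\<^bsub>V\<^esub> y]) 1
        - Poly_Mapping.single (xs[i := x]) 1 - Poly_Mapping.single (xs[i := y]) 1 | xs i x y.
        xs \<in> tuples m V \<and> i < m \<and> x \<in> carrier V \<and> y \<in> carrier V} \<union>
     {Poly_Mapping.single (xs[i := c \<odot>\<^bsub>V\<^esub> x]) 1 - Poly_Mapping.single (xs[i := x]) c | xs i c x.
        xs \<in> tuples m V \<and> i < m \<and> x \<in> carrier V}"

definition tensor_kernel :: "nat \<Rightarrow> ('k::field, 'v) module \<Rightarrow> ('v list \<Rightarrow>\<^sub>0 'k) set" where
  "tensor_kernel m V = mspan (free_module (tuples m V)) (multilinear_rels m V)"

definition tensor_power :: "nat \<Rightarrow> ('k::field, 'v) module \<Rightarrow> ('k, ('v list \<Rightarrow>\<^sub>0 'k) set) module" where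
  "tensor_power m V = quot_module (free_module (tuples m V)) (tensor_kernel m V)"

definition pure_tensor :: "nat \<Rightarrow> ('k::field, 'v) module \<Rightarrow> 'v list \<Rightarrow> ('v list \<Rightarrow>\<^sub>0 'k) set" where
  "pure_tensor m V xs = tensor_kernel m V +>\<^bsub>free_module (tuples m V)\<^esub> Poly_Mapping.single xs 1"

text \<open>The functors act on a linear map \<open>g\<close> with target \<open>W\<close>; the source need not be
  mentioned.\<close>

definition tensor_map ::
  "nat \<Rightarrow> ('k::field, 'w) module \<Rightarrow> ('v \<Rightarrow> 'w) \<Rightarrow> ('v list \<Rightarrow>\<^sub>0 'k) set \<Rightarrow> ('w list \<Rightarrow>\<^sub>0 'k) set" where
  "tensor_map m W g =
     quot_map (free_module (tuples m W)) (tensor_kernel m W) (free_map (map g))"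

definition tensor_permute ::
  "nat \<Rightarrow> ('k::field, 'v) module \<Rightarrow> (nat \<Rightarrow> nat) \<Rightarrow>
     ('v list \<Rightarrow>\<^sub>0 'k) set \<Rightarrow> ('v list \<Rightarrow>\<^sub>0 'k) set" where
  "tensor_permute m V \<sigma> =
     quot_map (free_module (tuples m V)) (tensor_kernel m V) (free_map (permute_list \<sigma>))"

section \<open>Symmetric, exterior and divided powers\<close>

definition sym_kernel :: "nat \<Rightarrow> ('k::field, 'v) module \<Rightarrow> ('v list \<Rightarrow>\<^sub>0 'k) set set" where
  "sym_kernel m V =
     mspan (tensor_power m V)
       {pure_tensor m V xs \<ominus>\<^bsub>tensor_power m V\<^esub> pure_tensor m V (permute_list \<sigma> xs) | xs \<sigma>.
          xs \<in> tuples m V \<and> \<sigma> permutes {..<m}}"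

definition Sym :: "nat \<Rightarrow> ('k::field, 'v) module \<Rightarrow> ('k, ('v list \<Rightarrow>\<^sub>0 'k) set set) module" where
  "Sym m V = quot_module (tensor_power m V) (sym_kernel m V)"

definition Sym_map ::
  "nat \<Rightarrow> ('k::field, 'w) module \<Rightarrow> ('v \<Rightarrow> 'w) \<Rightarrow>
     ('v list \<Rightarrow>\<^sub>0 'k) set set \<Rightarrow> ('w list \<Rightarrow>\<^sub>0 'k) set set" where
  "Sym_map m W g = quot_map (tensor_power m W) (sym_kernel m W) (tensor_map m W g)"

definition ext_kernel :: "nat \<Rightarrow> ('k::field, 'v) module \<Rightarrow> ('v list \<Rightarrow>\<^sub>0 'k) set set" where
  "ext_kernel m V =
     mspan (tensor_power m V) {pure_tensor m V xs | xs. xs \<in> tuples m V \<and> \<not> distinct xs}"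

definition Ext :: "nat \<Rightarrow> ('k::field, 'v) module \<Rightarrow> ('k, ('v list \<Rightarrow>\<^sub>0 'k) set set) module" where
  "Ext m V = quot_module (tensor_power m V) (ext_kernel m V)"

definition Ext_map ::
  "nat \<Rightarrow> ('k::field, 'w) module \<Rightarrow> ('v \<Rightarrow> 'w) \<Rightarrow>
     ('v list \<Rightarrow>\<^sub>0 'k) set set \<Rightarrow> ('w list \<Rightarrow>\<^sub>0 'k) set set" where
  "Ext_map m W g = quot_map (tensor_power m W) (ext_kernel m W) (tensor_map m W g)"

definition Div :: "nat \<Rightarrow> ('k::field, 'v) module \<Rightarrow> ('k, ('v list \<Rightarrow>\<^sub>0 'k) set) module" where
  "Div m V = (tensor_power m V)
     \<lparr>carrier := {t \<in> carrier (tensor_power m V).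
        \<forall>\<sigma>. \<sigma> permutes {..<m} \<longrightarrow> tensor_permute m V \<sigma> t = t}\<rparr>"

abbreviation Div_map ::
  "nat \<Rightarrow> ('k::field, 'w) module \<Rightarrow> ('v \<Rightarrow> 'w) \<Rightarrow> ('v list \<Rightarrow>\<^sub>0 'k) set \<Rightarrow> ('w list \<Rightarrow>\<^sub>0 'k) set" where
  "Div_map \<equiv> tensor_map"

section \<open>Natural equivariant isomorphisms\<close>

abbreviation lin_maps :: "('k::field, 'v) module \<Rightarrow> ('k, 'w) module \<Rightarrow> ('v \<Rightarrow> 'w) set" where
  "lin_maps \<equiv> LinearCombinations.module_hom class_ring"

definition lin_isos :: "('k::field, 'v) module \<Rightarrow> ('k, 'w) module \<Rightarrow> ('v \<Rightarrow> 'w) set" where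
  "lin_isos V W = {f \<in> lin_maps V W. bij_betw f (carrier V) (carrier W)}"

definition plane :: "('k::field, 'u) module \<Rightarrow> bool" where
  "plane U \<longleftrightarrow> vectorspace class_ring U \<and> vectorspace.fin_dim class_ring U
     \<and> vectorspace.dim class_ring U = 2"

text \<open>The determinant of an operator on a finite-dimensional space is the scalar by which it acts on
  the top exterior power, which is one-dimensional.\<close>

definition lin_det :: "('k::field, 'v) module \<Rightarrow> ('v \<Rightarrow> 'v) \<Rightarrow> 'k" where
  "lin_det V g = (let d = vectorspace.dim class_ring V in
     THE c. \<forall>w\<in>carrier (Ext d V). Ext_map d V g w = c \<odot>\<^bsub>Ext d V\<^esub> w)"

definition SL :: "('k::field, 'v) module \<Rightarrow> ('v \<Rightarrow> 'v) set" where
  "SL V = {g \<in> lin_maps V V. lin_det V g = 1}"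

text \<open>A volume element of a plane identifies its second exterior power with the base field. Operators
  of determinant 1 are those preserving it.\<close>

definition volumes :: "('k::field, 'u) module \<Rightarrow> ('u list \<Rightarrow>\<^sub>0 'k) set set set" where
  "volumes U = carrier (Ext 2 U) - {\<zero>\<^bsub>Ext 2 U\<^esub>}"

text \<open>\<open>F\<close> and \<open>G\<close> are functors given by their values on spaces and (as \<open>F_map\<close>, \<open>G_map\<close>) on linear
  maps, the target of the map being the first argument. The family \<open>\<Phi>\<close> consists of
  \<open>SL(U)\<close>-equivariant isomorphisms \<open>F U \<rightarrow> G U\<close>, one for each plane \<open>U\<close> with volume element \<open>\<omega>\<close>, and is
  natural in \<open>(U, \<omega>)\<close>, i.e. with respect to linear maps between planes that carry the chosen volume
  element to the chosen volume element. An isomorphism equivariant under \<open>SL(U)\<close> but not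
  under scalar operators depends on \<open>\<omega>\<close>.\<close>

definition natural_SL_isos ::
  "(('k::field, 'u) module \<Rightarrow> ('k, 'a) module) \<Rightarrow> (('k, 'u) module \<Rightarrow> ('u \<Rightarrow> 'u) \<Rightarrow> 'a \<Rightarrow> 'a) \<Rightarrow>
   (('k, 'u) module \<Rightarrow> ('k, 'b) module) \<Rightarrow> (('k, 'u) module \<Rightarrow> ('u \<Rightarrow> 'u) \<Rightarrow> 'b \<Rightarrow> 'b) \<Rightarrow>
   (('k, 'u) module \<Rightarrow> ('u list \<Rightarrow>\<^sub>0 'k) set set \<Rightarrow> 'a \<Rightarrow> 'b) \<Rightarrow> bool" where
  "natural_SL_isos F F_map G G_map \<Phi> \<longleftrightarrow>
     (\<forall>U \<omega>. plane U \<and> \<omega> \<in> volumes U \<longrightarrow>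
        \<Phi> U \<omega> \<in> lin_isos (F U) (G U) \<and>
        (\<forall>g\<in>SL U. \<forall>x\<in>carrier (F U). \<Phi> U \<omega> (F_map U g x) = G_map U g (\<Phi> U \<omega> x))) \<and>
     (\<forall>U \<omega> U' \<omega>' g. plane U \<and> \<omega> \<in> volumes U \<and> plane U' \<and> \<omega>' \<in> volumes U' \<and>
        g \<in> lin_maps U U' \<and> Ext_map 2 U' g \<omega> = \<omega>' \<longrightarrow>
        (\<forall>x\<in>carrier (F U). \<Phi> U' \<omega>' (F_map U' g x) = G_map U' g (\<Phi> U \<omega> x)))"

end

theory Submission
  imports Defs
begin

text \<open>
  Let \<open>L\<close> be the polynomial ring in one variable over the base field. A tuple \<open>\<phi>\<close> of \<open>m\<close> linear forms
  \<open>\<phi> i :: U \<rightarrow> L\<close> evaluates elements of \<open>Sym d (Div m U)\<close>, \<open>Div m (Sym d U)\<close> and \<open>Ext m (Sym n U)\<close> to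
  elements of \<open>L\<close>; on the last space the evaluation is a determinant. In a basis of \<open>U\<close> these are
  the values of polynomials in the elementary symmetric polynomials, of symmetric polynomials of degree
  at most \<open>d\<close> in each variable, and of alternating polynomials, respectively. Elements of two of the spaces
  are related by the isomorphism if they have the same evaluation at every \<open>\<phi>\<close>, where for the exterior
  power one side is multiplied by the Vandermonde product of the \<open>\<phi> i \<and> \<phi> j\<close>, evaluated at the volume
  element. As linear maps act on all sides by precomposition with \<open>\<phi>\<close>, this relation is natural.

  That it is a bijection is seen at a single point, where \<open>\<phi> i\<close> maps a basis to \<open>1\<close> and \<open>X ^ (N ^ i)\<close>
  with \<open>N\<close> large (Kronecker substitution). There the leading monomials of the polynomials above become
  degrees, namely numbers whose digits in base \<open>N\<close> are sorted, strictly sorted in the case of the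
  exterior power. The same degrees occur on both sides, and different basis elements have different degrees.
\<close>

text \<open>Values lie in a polynomial ring because over a finite field the forms with values in the
  base field are too few to separate polynomials. A single point then separates elements, provided
  \<open>N\<close> exceeds all exponents that occur, while quantifying over all points keeps the
  relation free of a basis.

  Inverting the comparison would call for two classical facts: alternating polynomials are divisible
  by the Vandermonde product, and symmetric polynomials are polynomials in the elementary symmetric
  ones. Neither is proved directly. Only the easy direction is built, from
  \<open>Sym d (Div m U)\<close> into the other space, by multiplying evaluations. That every
  element is reached follows by eliminating leading terms (\<open>echelon\<close>), since the
  degrees attained on both sides agree.

  All characteristics are covered at once: orbit sums in the divided power take each rearrangement
  once, and leading terms are multiplied in a domain, so no factorial is ever inverted.\<close>

abbreviation kmod :: "('k::field, 'v) module \<Rightarrow> bool" where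
  "kmod \<equiv> module class_ring"

section \<open>Calculation rules in vector spaces given as module records\<close>

lemma
  fixes M :: "('k::field, 'v) module" (structure)
  assumes "kmod M"
  shows kmod_zero [simp]: "\<zero> \<in> carrier M"
    and kmod_add_closed [simp]: "\<lbrakk>x \<in> carrier M; y \<in> carrier M\<rbrakk> \<Longrightarrow> x \<oplus> y \<in> carrier M"
    and kmod_minus_closed [simp]: "\<lbrakk>x \<in> carrier M; y \<in> carrier M\<rbrakk> \<Longrightarrow> x \<ominus> y \<in> carrier M"
    and kmod_smult_closed [simp]: "x \<in> carrier M \<Longrightarrow> c \<odot> x \<in> carrier M"
    and kmod_add_assoc: "\<lbrakk>x \<in> carrier M; y \<in> carrier M; z \<in> carrier M\<rbrakk> \<Longrightarrow>
      (x \<oplus> y) \<oplus> z = x \<oplus> (y \<oplus> z)"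
    and kmod_add_comm: "\<lbrakk>x \<in> carrier M; y \<in> carrier M\<rbrakk> \<Longrightarrow> x \<oplus> y = y \<oplus> x"
    and kmod_add_zero [simp]: "x \<in> carrier M \<Longrightarrow> x \<oplus> \<zero> = x"
    and kmod_zero_add [simp]: "x \<in> carrier M \<Longrightarrow> \<zero> \<oplus> x = x"
    and kmod_smult_zero [simp]: "c \<odot> \<zero> = \<zero>"
    and kmod_zero_smult [simp]: "x \<in> carrier M \<Longrightarrow> 0 \<odot> x = \<zero>"
    and kmod_one_smult [simp]: "x \<in> carrier M \<Longrightarrow> 1 \<odot> x = x"
    and kmod_smult_add: "\<lbrakk>x \<in> carrier M; y \<in> carrier M\<rbrakk> \<Longrightarrow>
      c \<odot> (x \<oplus> y) = c \<odot> x \<oplus> c \<odot> y"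
    and kmod_add_smult: "x \<in> carrier M \<Longrightarrow> (c + d) \<odot> x = c \<odot> x \<oplus> d \<odot> x"
    and kmod_smult_assoc: "x \<in> carrier M \<Longrightarrow> (c * d) \<odot> x = c \<odot> (d \<odot> x)"
    and kmod_minus_eq: "\<lbrakk>x \<in> carrier M; y \<in> carrier M\<rbrakk> \<Longrightarrow> x \<ominus> y = x \<oplus> (-1) \<odot> y"
    and kmod_minus_add: "\<lbrakk>x \<in> carrier M; y \<in> carrier M\<rbrakk> \<Longrightarrow> (x \<ominus> y) \<oplus> y = x"
    and kmod_minus_self [simp]: "x \<in> carrier M \<Longrightarrow> x \<ominus> x = \<zero>"
    and kmod_minus_eq_zero: "\<lbrakk>x \<in> carrier M; y \<in> carrier M\<rbrakk> \<Longrightarrow> x \<ominus> y = \<zero> \<longleftrightarrow> x = y"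
    and kmod_neg_eq: "x \<in> carrier M \<Longrightarrow> \<ominus> x = (-1) \<odot> x"
proof -
  interpret Module.module class_ring M by fact
  show "\<zero> \<in> carrier M" "c \<odot> \<zero> = \<zero>"
    by (simp_all add: smult_r_null)
  show "x \<oplus> y \<in> carrier M" "x \<ominus> y \<in> carrier M" "x \<oplus> y = y \<oplus> x"
    "c \<odot> (x \<oplus> y) = c \<odot> x \<oplus> c \<odot> y" if "x \<in> carrier M" "y \<in> carrier M"
    using that smult_r_distr[of c x y] by (simp_all add: M.a_comm)
  show "c \<odot> x \<in> carrier M" "(c + d) \<odot> x = c \<odot> x \<oplus> d \<odot> x"
    "(c * d) \<odot> x = c \<odot> (d \<odot> x)" "0 \<odot> x = \<zero>" "1 \<odot> x = x"
    if "x \<in> carrier M"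
    using that smult_l_distr[of c d x] smult_closed[of c x] smult_assoc1[of c d x]
      smult_l_null[of x] smult_one[of x] by simp_all
  show "x \<oplus> \<zero> = x" "\<zero> \<oplus> x = x" "x \<ominus> x = \<zero>" if "x \<in> carrier M"
    using that M.r_neg by (simp_all add: a_minus_def)
  show "(x \<oplus> y) \<oplus> z = x \<oplus> (y \<oplus> z)"
    if "x \<in> carrier M" "y \<in> carrier M" "z \<in> carrier M"
    using that by (simp add: M.a_assoc)
  show neg: "\<ominus> x = (-1) \<odot> x" if "x \<in> carrier M" for x
    using smult_minus_1[OF that] by (simp add: class_ring_simps)
  then show "x \<ominus> y = x \<oplus> (-1) \<odot> y" if "x \<in> carrier M" "y \<in> carrier M"
    using that by (simp add: a_minus_def)
  show "(x \<ominus> y) \<oplus> y = x" if "x \<in> carrier M" "y \<in> carrier M"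
    using that by (simp add: a_minus_def M.a_assoc M.l_neg)
  show "x \<ominus> y = \<zero> \<longleftrightarrow> x = y" if "x \<in> carrier M" "y \<in> carrier M"
    using that by simp
qed

lemma kmodI:
  fixes M :: "('k::field, 'v) module" (structure)
  assumes "\<And>x y. \<lbrakk>x \<in> carrier M; y \<in> carrier M\<rbrakk> \<Longrightarrow> x \<oplus> y \<in> carrier M"
    and "\<zero> \<in> carrier M"
    and smult: "\<And>c x. x \<in> carrier M \<Longrightarrow> c \<odot> x \<in> carrier M"
    and "\<And>x y z. \<lbrakk>x \<in> carrier M; y \<in> carrier M; z \<in> carrier M\<rbrakk> \<Longrightarrow>
      (x \<oplus> y) \<oplus> z = x \<oplus> (y \<oplus> z)"
    and "\<And>x y. \<lbrakk>x \<in> carrier M; y \<in> carrier M\<rbrakk> \<Longrightarrow> x \<oplus> y = y \<oplus> x"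
    and "\<And>x. x \<in> carrier M \<Longrightarrow> \<zero> \<oplus> x = x"
    and zero: "\<And>x. x \<in> carrier M \<Longrightarrow> 0 \<odot> x = \<zero>"
    and one: "\<And>x. x \<in> carrier M \<Longrightarrow> 1 \<odot> x = x"
    and "\<And>c x y. \<lbrakk>x \<in> carrier M; y \<in> carrier M\<rbrakk> \<Longrightarrow>
      c \<odot> (x \<oplus> y) = c \<odot> x \<oplus> c \<odot> y"
    and add_smult: "\<And>c d x. x \<in> carrier M \<Longrightarrow> (c + d) \<odot> x = c \<odot> x \<oplus> d \<odot> x"
    and "\<And>c d x. x \<in> carrier M \<Longrightarrow> (c * d) \<odot> x = c \<odot> (d \<odot> x)"
  shows "kmod M"
proof (rule moduleI)
  show "cring (class_ring :: 'k ring)"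
    by (rule class_cring.cring_axioms)
  show "abelian_group M"
  proof (rule abelian_groupI)
    fix x assume x: "x \<in> carrier M"
    have "(-1) \<odot> x \<oplus> x = \<zero>"
      using add_smult[OF x, of "-1" 1] zero[OF x] one[OF x] by simp
    then show "\<exists>y\<in>carrier M. y \<oplus> x = \<zero>"
      using smult[OF x] by blast
  qed (use assms in auto)
qed (use assms in auto)

subsection \<open>Submodules and generators\<close>

definition subsp :: "('k::field, 'v) module \<Rightarrow> 'v set \<Rightarrow> bool" where
  "subsp M N \<longleftrightarrow> N \<subseteq> carrier M \<and> \<zero>\<^bsub>M\<^esub> \<in> N \<and> (\<forall>x\<in>N. \<forall>y\<in>N. x \<oplus>\<^bsub>M\<^esub> y \<in> N) \<and>
     (\<forall>c. \<forall>x\<in>N. c \<odot>\<^bsub>M\<^esub> x \<in> N)"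

lemma subspI:
  assumes "N \<subseteq> carrier M" "\<zero>\<^bsub>M\<^esub> \<in> N" "\<And>x y. \<lbrakk>x \<in> N; y \<in> N\<rbrakk> \<Longrightarrow> x \<oplus>\<^bsub>M\<^esub> y \<in> N"
    "\<And>c x. x \<in> N \<Longrightarrow> c \<odot>\<^bsub>M\<^esub> x \<in> N"
  shows "subsp M N"
  using assms by (simp add: subsp_def)

lemma
  assumes "subsp M N"
  shows subsp_carrier: "x \<in> N \<Longrightarrow> x \<in> carrier M"
    and subsp_zero: "\<zero>\<^bsub>M\<^esub> \<in> N"
    and subsp_add: "\<lbrakk>x \<in> N; y \<in> N\<rbrakk> \<Longrightarrow> x \<oplus>\<^bsub>M\<^esub> y \<in> N"
    and subsp_smult: "x \<in> N \<Longrightarrow> c \<odot>\<^bsub>M\<^esub> x \<in> N"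
  using assms by (auto simp: subsp_def)

lemma subsp_iff_submodule: "kmod M \<Longrightarrow> subsp M N \<longleftrightarrow> LinearCombinations.submodule class_ring N M"
  by (auto simp: subsp_def LinearCombinations.submodule_def)

lemma
  assumes "kmod M" "G \<subseteq> carrier M"
  shows mspan_subsp: "subsp M (mspan M G)"
    and mspan_superset: "G \<subseteq> mspan M G"
    and mspan_least: "\<lbrakk>subsp M N; G \<subseteq> N\<rbrakk> \<Longrightarrow> mspan M G \<subseteq> N"
proof -
  interpret Module.module class_ring M by fact
  show "subsp M (mspan M G)"
    using span_is_submodule[OF assms(2)] by (simp add: subsp_iff_submodule assms)
  show "G \<subseteq> mspan M G"
    using in_own_span assms by auto
  show "mspan M G \<subseteq> N" if "subsp M N" "G \<subseteq> N"
    using span_is_subset that by (simp add: subsp_iff_submodule assms)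
qed

text \<open>Spanning is phrased through subspaces instead of linear combinations: it then passes to
  quotients by taking preimages, and it is itself an induction principle.\<close>

definition generates :: "('k::field, 'v) module \<Rightarrow> 'v set \<Rightarrow> bool" where
  "generates M G \<longleftrightarrow> G \<subseteq> carrier M \<and> (\<forall>N. subsp M N \<longrightarrow> G \<subseteq> N \<longrightarrow> carrier M \<subseteq> N)"

lemma generates_induct:
  assumes "generates M G" "x \<in> carrier M"
    and "\<And>g. g \<in> G \<Longrightarrow> P g" and "P \<zero>\<^bsub>M\<^esub>" and M: "kmod M"
    and "\<And>x y. \<lbrakk>x \<in> carrier M; y \<in> carrier M; P x; P y\<rbrakk> \<Longrightarrow> P (x \<oplus>\<^bsub>M\<^esub> y)"
    and "\<And>c x. \<lbrakk>x \<in> carrier M; P x\<rbrakk> \<Longrightarrow> P (c \<odot>\<^bsub>M\<^esub> x)"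
  shows "P x"
proof -
  have "subsp M {x \<in> carrier M. P x}"
    using assms by (intro subspI) auto
  then have "carrier M \<subseteq> {x \<in> carrier M. P x}"
    using assms(1,3) by (auto simp: generates_def)
  then show ?thesis
    using assms(2) by blast
qed

lemma generates_trans:
  assumes "generates M G" "G' \<subseteq> carrier M" "\<And>N. \<lbrakk>subsp M N; G' \<subseteq> N\<rbrakk> \<Longrightarrow> G \<subseteq> N"
  shows "generates M G'"
  using assms unfolding generates_def by blast

subsection \<open>Linear maps and linear forms\<close>

lemma lin_mapsI:
  assumes "\<And>x. x \<in> carrier M \<Longrightarrow> f x \<in> carrier N"
    "\<And>x y. \<lbrakk>x \<in> carrier M; y \<in> carrier M\<rbrakk> \<Longrightarrow> f (x \<oplus>\<^bsub>M\<^esub> y) = f x \<oplus>\<^bsub>N\<^esub> f y"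
    "\<And>c x. x \<in> carrier M \<Longrightarrow> f (c \<odot>\<^bsub>M\<^esub> x) = c \<odot>\<^bsub>N\<^esub> f x"
  shows "f \<in> lin_maps M N"
  using assms by (auto simp: LinearCombinations.module_hom_def)

lemma
  assumes "f \<in> lin_maps M N"
  shows lin_maps_closed: "x \<in> carrier M \<Longrightarrow> f x \<in> carrier N"
    and lin_maps_add: "\<lbrakk>x \<in> carrier M; y \<in> carrier M\<rbrakk> \<Longrightarrow> f (x \<oplus>\<^bsub>M\<^esub> y) = f x \<oplus>\<^bsub>N\<^esub> f y"
    and lin_maps_smult: "x \<in> carrier M \<Longrightarrow> f (c \<odot>\<^bsub>M\<^esub> x) = c \<odot>\<^bsub>N\<^esub> f x"
  using assms by (auto simp: LinearCombinations.module_hom_def)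

lemma lin_maps_zero: "\<lbrakk>f \<in> lin_maps M N; kmod M; kmod N\<rbrakk> \<Longrightarrow> f \<zero>\<^bsub>M\<^esub> = \<zero>\<^bsub>N\<^esub>"
  by (metis kmod_zero kmod_zero_smult lin_maps_closed lin_maps_smult)

lemma lin_maps_minus:
  "\<lbrakk>f \<in> lin_maps M N; kmod M; kmod N; x \<in> carrier M; y \<in> carrier M\<rbrakk> \<Longrightarrow>
    f (x \<ominus>\<^bsub>M\<^esub> y) = f x \<ominus>\<^bsub>N\<^esub> f y"
  by (simp add: kmod_minus_eq lin_maps_add lin_maps_smult lin_maps_closed)

lemma subsp_vimage:
  "\<lbrakk>f \<in> lin_maps M N; kmod M; kmod N; subsp N K\<rbrakk> \<Longrightarrow> subsp M {x \<in> carrier M. f x \<in> K}"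
  by (auto intro!: subspI simp: lin_maps_zero lin_maps_add lin_maps_smult subsp_zero subsp_add subsp_smult)

text \<open>The target \<open>'k poly\<close> is a vector space through its type and not through a
  module record, hence a notion separate from \<open>lin_maps\<close>.\<close>

definition lin_form :: "('k::field, 'v) module \<Rightarrow> ('v \<Rightarrow> 'k poly) \<Rightarrow> bool" where
  "lin_form M f \<longleftrightarrow> (\<forall>x\<in>carrier M. \<forall>y\<in>carrier M. f (x \<oplus>\<^bsub>M\<^esub> y) = f x + f y) \<and>
     (\<forall>c. \<forall>x\<in>carrier M. f (c \<odot>\<^bsub>M\<^esub> x) = Polynomial.smult c (f x))"

lemma lin_formI:
  assumes "\<And>x y. \<lbrakk>x \<in> carrier M; y \<in> carrier M\<rbrakk> \<Longrightarrow> f (x \<oplus>\<^bsub>M\<^esub> y) = f x + f y"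
    "\<And>c x. x \<in> carrier M \<Longrightarrow> f (c \<odot>\<^bsub>M\<^esub> x) = Polynomial.smult c (f x)"
  shows "lin_form M f"
  using assms by (auto simp: lin_form_def)

lemma
  assumes "lin_form M f"
  shows lin_form_add: "\<lbrakk>x \<in> carrier M; y \<in> carrier M\<rbrakk> \<Longrightarrow> f (x \<oplus>\<^bsub>M\<^esub> y) = f x + f y"
    and lin_form_smult: "x \<in> carrier M \<Longrightarrow> f (c \<odot>\<^bsub>M\<^esub> x) = Polynomial.smult c (f x)"
  using assms by (auto simp: lin_form_def)

lemma lin_form_zero: "\<lbrakk>lin_form M f; kmod M\<rbrakk> \<Longrightarrow> f \<zero>\<^bsub>M\<^esub> = 0"
  by (metis kmod_zero kmod_zero_smult lin_form_smult smult_0_left)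

lemma lin_form_minus: "\<lbrakk>lin_form M f; kmod M; x \<in> carrier M; y \<in> carrier M\<rbrakk> \<Longrightarrow> f (x \<ominus>\<^bsub>M\<^esub> y) = f x - f y"
  by (simp add: kmod_minus_eq lin_form_add lin_form_smult)

lemma lin_form_comp: "\<lbrakk>lin_form N f; g \<in> lin_maps M N\<rbrakk> \<Longrightarrow> lin_form M (\<lambda>x. f (g x))"
  by (auto intro!: lin_formI simp: lin_maps_add lin_maps_smult lin_maps_closed lin_form_add lin_form_smult)

lemma subsp_zeros: "\<lbrakk>lin_form M f; kmod M\<rbrakk> \<Longrightarrow> subsp M {x \<in> carrier M. f x = 0}"
  by (auto intro!: subspI simp: lin_form_zero lin_form_add lin_form_smult)

lemma lin_form_eqI:
  assumes "lin_form M f" "lin_form M g" "generates M G" "kmod M"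
    and "\<And>x. x \<in> G \<Longrightarrow> f x = g x" "x \<in> carrier M"
  shows "f x = g x"
  using assms(3,6,5)
  by (rule generates_induct)
    (use assms in \<open>auto simp: lin_form_zero lin_form_add lin_form_smult\<close>)

subsection \<open>Free modules\<close>

lemma free_module_sel [simp]:
  "carrier (free_module S) = {p. Poly_Mapping.keys p \<subseteq> S}"
  "zero (free_module S) = 0"
  "add (free_module S) = (+)"
  "smult (free_module S) = (\<lambda>c. Poly_Mapping.map ((*) c))"
  by (simp_all add: free_module_def)

lemma lookup_map_mult [simp]:
  "Poly_Mapping.lookup (Poly_Mapping.map ((*) c) p) s = (c :: 'k::field) * Poly_Mapping.lookup p s"
  by transfer (simp add: when_def)

lemma keys_map_mult: "Poly_Mapping.keys (Poly_Mapping.map ((*) (c::'k::field)) p) \<subseteq> Poly_Mapping.keys p"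
  by (auto simp: in_keys_iff)

lemma kmod_free [simp]: "kmod (free_module S :: ('k::field, 's \<Rightarrow>\<^sub>0 'k) module)"
proof (rule kmodI)
  show "x \<oplus>\<^bsub>free_module S\<^esub> y \<in> carrier (free_module S)"
    if "x \<in> carrier (free_module S)" "y \<in> carrier (free_module S)"
    for x y :: "'s \<Rightarrow>\<^sub>0 'k"
    using that keys_add[of x y] by auto
  show "c \<odot>\<^bsub>free_module S\<^esub> x \<in> carrier (free_module S)"
    if "x \<in> carrier (free_module S)" for c and x :: "'s \<Rightarrow>\<^sub>0 'k"
    using that keys_map_mult[of c x] by auto
qed (auto simp: algebra_simps lookup_add intro!: poly_mapping_eqI)

lemma poly_mapping_sum_single:
  "(p :: 's \<Rightarrow>\<^sub>0 'k::field) = (\<Sum>s\<in>Poly_Mapping.keys p. Poly_Mapping.single s (Poly_Mapping.lookup p s))"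
  by (rule poly_mapping_eqI) (simp add: lookup_sum lookup_single when_def in_keys_iff)

lemma generates_free:
  "generates (free_module S :: ('k::field, 's \<Rightarrow>\<^sub>0 'k) module) ((\<lambda>s. Poly_Mapping.single s 1) ` S)"
  unfolding generates_def
proof (intro conjI allI impI subsetI)
  fix N :: "('s \<Rightarrow>\<^sub>0 'k) set" and p :: "'s \<Rightarrow>\<^sub>0 'k"
  assume N: "subsp (free_module S) N" "(\<lambda>s. Poly_Mapping.single s 1) ` S \<subseteq> N"
    and p: "p \<in> carrier (free_module S)"
  have single: "Poly_Mapping.single s c \<in> N" if "s \<in> S" for s c
    using subsp_smult[OF N(1), of "Poly_Mapping.single s 1" c] N(2) that by auto
  have "(\<Sum>s\<in>A. Poly_Mapping.single s (Poly_Mapping.lookup p s)) \<in> N" if "finite A" "A \<subseteq> S" for A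
    using that
    by induction (use subsp_zero[OF N(1)] subsp_add[OF N(1)] single in auto)
  then show "p \<in> N"
    using p by (subst poly_mapping_sum_single) auto
qed auto

text \<open>The map that the universal property of the free module assigns to a function on its
  basis, for the target \<open>'k poly\<close>.\<close>

definition lin_ext :: "('s \<Rightarrow> 'k::field poly) \<Rightarrow> ('s \<Rightarrow>\<^sub>0 'k) \<Rightarrow> 'k poly" where
  "lin_ext h p = (\<Sum>s\<in>Poly_Mapping.keys p. Polynomial.smult (Poly_Mapping.lookup p s) (h s))"

lemma lin_ext_superset:
  "\<lbrakk>finite A; Poly_Mapping.keys p \<subseteq> A\<rbrakk> \<Longrightarrow>
    lin_ext h p = (\<Sum>s\<in>A. Polynomial.smult (Poly_Mapping.lookup p s) (h s))"
  unfolding lin_ext_def by (rule sum.mono_neutral_left) (auto simp: in_keys_iff)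

lemma lin_ext_add [simp]: "lin_ext h (p + q) = lin_ext h p + lin_ext h q"
proof -
  let ?A = "Poly_Mapping.keys p \<union> Poly_Mapping.keys q"
  have "lin_ext h r = (\<Sum>s\<in>?A. Polynomial.smult (Poly_Mapping.lookup r s) (h s))" if "r \<in> {p, q, p + q}" for r
    using that keys_add[of p q] by (intro lin_ext_superset) auto
  then show ?thesis
    by (simp add: lookup_add smult_add_left sum.distrib)
qed

lemma smult_sum_right: "Polynomial.smult c (\<Sum>i\<in>A. f i) = (\<Sum>i\<in>A. Polynomial.smult c (f i))"
  by (induction A rule: infinite_finite_induct) (auto simp: smult_add_right)

lemma lin_ext_map_mult [simp]: "lin_ext h (Poly_Mapping.map ((*) c) p) = Polynomial.smult c (lin_ext h p)"
proof -
  have "lin_ext h (Poly_Mapping.map ((*) c) p) =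
    (\<Sum>s\<in>Poly_Mapping.keys p. Polynomial.smult (Poly_Mapping.lookup (Poly_Mapping.map ((*) c) p) s) (h s))"
    by (intro lin_ext_superset keys_map_mult) auto
  then show ?thesis
    by (simp add: lin_ext_def smult_sum_right)
qed

lemma lin_ext_single [simp]: "lin_ext h (Poly_Mapping.single s c) = Polynomial.smult c (h s)"
  by (simp add: lin_ext_def)

lemma lin_form_lin_ext [simp]: "lin_form (free_module S) (lin_ext h)"
  by (auto intro!: lin_formI)

lemma lin_ext_minus [simp]: "lin_ext h (p - q) = lin_ext h p - lin_ext h q"
proof -
  have "lin_ext h (p - q) + lin_ext h q = lin_ext h p"
    by (simp flip: lin_ext_add)
  then show ?thesis
    by (simp add: algebra_simps)
qed

lemma free_map_superset:
  "\<lbrakk>finite A; Poly_Mapping.keys p \<subseteq> A\<rbrakk> \<Longrightarrow>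
    free_map h p = (\<Sum>s\<in>A. Poly_Mapping.single (h s) (Poly_Mapping.lookup p s))"
  unfolding free_map_def by (rule sum.mono_neutral_left) (auto simp: in_keys_iff)

lemma free_map_add [simp]: "free_map h (p + q) = free_map h p + free_map h q"
proof -
  let ?A = "Poly_Mapping.keys p \<union> Poly_Mapping.keys q"
  have "free_map h r = (\<Sum>s\<in>?A. Poly_Mapping.single (h s) (Poly_Mapping.lookup r s))" if "r \<in> {p, q, p + q}" for r
    using that keys_add[of p q] by (intro free_map_superset) auto
  then show ?thesis
    by (simp add: lookup_add single_add sum.distrib)
qed

lemma free_map_single [simp]: "free_map h (Poly_Mapping.single s c) = Poly_Mapping.single (h s) c"
  by (simp add: free_map_def)

lemma free_map_minus [simp]: "free_map h (p - q) = free_map h p - free_map h q"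
proof -
  have "free_map h (p - q) + free_map h q = free_map h p"
    by (simp flip: free_map_add)
  then show ?thesis
    by (simp add: algebra_simps)
qed

lemma map_mult_add:
  "Poly_Mapping.map ((*) (c::'k::field)) (p + q) = Poly_Mapping.map ((*) c) p + Poly_Mapping.map ((*) c) q"
  by (rule poly_mapping_eqI) (simp add: lookup_add algebra_simps)

lemma map_mult_sum:
  "Poly_Mapping.map ((*) (c::'k::field)) (\<Sum>s\<in>A. f s) = (\<Sum>s\<in>A. Poly_Mapping.map ((*) c) (f s))"
proof (induction A rule: infinite_finite_induct)
  case (insert s A)
  then show ?case
    by (simp add: map_mult_add)
qed (auto intro!: poly_mapping_eqI)

lemma free_map_map_mult [simp]:
  "free_map h (Poly_Mapping.map ((*) (c::'k::field)) p) = Poly_Mapping.map ((*) c) (free_map h p)"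
proof -
  have "free_map h (Poly_Mapping.map ((*) c) p) = (\<Sum>s\<in>Poly_Mapping.keys p.
      Poly_Mapping.single (h s) (Poly_Mapping.lookup (Poly_Mapping.map ((*) c) p) s))"
    by (intro free_map_superset keys_map_mult) auto
  then show ?thesis
    by (simp add: free_map_def map_mult_sum)
qed

lemma free_map_lin_maps: "(\<And>s. s \<in> S \<Longrightarrow> h s \<in> T) \<Longrightarrow> free_map h \<in> lin_maps (free_module S) (free_module T)"
proof (rule lin_mapsI)
  fix p :: "'a \<Rightarrow>\<^sub>0 'c"
  assume "\<And>s. s \<in> S \<Longrightarrow> h s \<in> T" and "p \<in> carrier (free_module S)"
  then have "\<forall>s\<in>Poly_Mapping.keys p. Poly_Mapping.keys (Poly_Mapping.single (h s) (Poly_Mapping.lookup p s)) \<subseteq> T"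
    by (auto simp: subset_iff)
  moreover have "Poly_Mapping.keys (\<Sum>s\<in>A. f s) \<subseteq> T"
    if "finite A" "\<forall>s\<in>A. Poly_Mapping.keys (f s) \<subseteq> T" for A :: "'a set" and f :: "'a \<Rightarrow> 'b \<Rightarrow>\<^sub>0 'c"
    using that
  proof induction
    case (insert s A)
    then show ?case
      using keys_add[of "f s" "sum f A"] by auto
  qed simp
  ultimately show "free_map h p \<in> carrier (free_module T)"
    unfolding free_map_def by simp
qed auto

subsection \<open>Quotient modules\<close>

lemma a_r_coset_eq: "N +>\<^bsub>M\<^esub> x = {n \<oplus>\<^bsub>M\<^esub> x | n. n \<in> N}"
  by (auto simp: a_r_coset_def')

lemma quot_module_sel [simp]:
  "zero (quot_module M N) = N"
  "add (quot_module M N) = (<+>\<^bsub>M\<^esub>)"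
  "smult (quot_module M N) = (\<lambda>c X. \<Union>x\<in>X. N +>\<^bsub>M\<^esub> (c \<odot>\<^bsub>M\<^esub> x))"
  by (simp_all add: quot_module_def)

lemma quot_carrier: "carrier (quot_module M N) = (\<lambda>x. N +>\<^bsub>M\<^esub> x) ` carrier M"
  by (auto simp: quot_module_def A_RCOSETS_def' a_r_coset_def')

context
  fixes M :: "('k::field, 'v) module" (structure) and N :: "'v set"
  assumes M: "kmod M" and N: "subsp M N"
begin

lemma abelian_subgroup_subsp: "abelian_subgroup N M"
proof (rule abelian_subgroupI3)
  interpret Module.module class_ring M by (rule M)
  show "abelian_group M" ..
  show "additive_subgroup N M"
  proof (rule additive_subgroupI, rule M.add.subgroupI)
    show "\<ominus> a \<in> N" if "a \<in> N" for a
      using subsp_smult[OF N that, of "-1"] kmod_neg_eq[OF M subsp_carrier[OF N that]]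
      by simp
  qed (use N in \<open>auto simp: subsp_def\<close>)
qed

lemma mem_coset_iff:
  assumes "x \<in> carrier M" "y \<in> carrier M"
  shows "y \<in> N +> x \<longleftrightarrow> y \<ominus> x \<in> N"
  using abelian_subgroup.a_rcos_module[OF abelian_subgroup_subsp assms] by (simp add: a_minus_def)

lemma coset_subset: "\<lbrakk>x \<in> carrier M; y \<in> N +> x\<rbrakk> \<Longrightarrow> y \<in> carrier M"
  by (rule abelian_subgroup.a_elemrcos_carrier[OF abelian_subgroup_subsp])

lemma coset_self [simp]: "x \<in> carrier M \<Longrightarrow> x \<in> N +> x"
  by (rule abelian_subgroup.a_rcos_self[OF abelian_subgroup_subsp])

lemma coset_eq_iff:
  assumes "x \<in> carrier M" "y \<in> carrier M"
  shows "N +> x = N +> y \<longleftrightarrow> x \<ominus> y \<in> N"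
proof -
  interpret abelian_subgroup N M by (rule abelian_subgroup_subsp)
  have "x \<ominus> y \<in> N \<longleftrightarrow> x \<in> N +> y"
    using mem_coset_iff assms by simp
  then show ?thesis
    using a_repr_independenceD a_repr_independence' assms a_rcos_self by metis
qed

lemma coset_zero: "N +> \<zero> = N"
  using subsp_carrier[OF N] M by (force simp: a_r_coset_eq)

lemma coset_eq_self_iff: "x \<in> carrier M \<Longrightarrow> N +> x = N \<longleftrightarrow> x \<in> N"
  using coset_eq_iff[of x "\<zero>"] M by (simp add: coset_zero kmod_minus_eq)

lemma coset_add:
  "\<lbrakk>x \<in> carrier M; y \<in> carrier M\<rbrakk> \<Longrightarrow>
    (N +> x) \<oplus>\<^bsub>quot_module M N\<^esub> (N +> y) = N +> (x \<oplus> y)"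
  using abelian_subgroup.a_rcos_sum[OF abelian_subgroup_subsp] by simp

text \<open>Scalar multiples in a quotient and maps induced on it are defined as unions over the
  members of a coset. All sets in such a union agree, so it collapses to the one of any
  representative.\<close>

lemma UN_coset:
  assumes "x \<in> carrier M" and "\<And>y. y \<in> N +> x \<Longrightarrow> F y = F x"
  shows "(\<Union>y\<in>N +> x. F y) = F x"
  using assms coset_self by blast

lemma coset_smult:
  assumes x: "x \<in> carrier M"
  shows "c \<odot>\<^bsub>quot_module M N\<^esub> (N +> x) = N +> (c \<odot> x)"
proof -
  have "N +> (c \<odot> y) = N +> (c \<odot> x)" if "y \<in> N +> x" for y
  proof -
    have y: "y \<in> carrier M" "y \<ominus> x \<in> N"
      using that coset_subset[OF x that] mem_coset_iff[OF x] by auto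
    have "c \<odot> y \<ominus> c \<odot> x = c \<odot> (y \<ominus> x)"
      using x y M kmod_smult_assoc[OF M x, of "-1" c] kmod_smult_assoc[OF M x, of c "-1"]
      by (simp add: kmod_minus_eq kmod_smult_add)
    then show ?thesis
      using subsp_smult[OF N y(2), of c] x y M by (simp add: coset_eq_iff)
  qed
  then show ?thesis
    using UN_coset[OF x, of "\<lambda>y. N +> (c \<odot> y)"] by simp
qed

lemma kmod_quot: "kmod (quot_module M N)"
proof (rule kmodI)
  let ?Q = "quot_module M N"
  note [simp] = coset_add coset_smult M and [simp del] = quot_module_sel(2,3)
  have coset: "N +> x \<in> carrier ?Q" if "x \<in> carrier M" for x
    using that by (simp add: quot_carrier)
  show zero: "\<zero>\<^bsub>?Q\<^esub> \<in> carrier ?Q"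
    using coset[of "\<zero>"] by (simp add: coset_zero)
  fix X assume "X \<in> carrier ?Q"
  then obtain x where x: "x \<in> carrier M" "X = N +> x"
    by (auto simp: quot_carrier)
  show "\<zero>\<^bsub>?Q\<^esub> \<oplus>\<^bsub>?Q\<^esub> X = X"
    using coset_add[of "\<zero>" x] x by (simp add: coset_zero)
  show "0 \<odot>\<^bsub>?Q\<^esub> X = \<zero>\<^bsub>?Q\<^esub>" "1 \<odot>\<^bsub>?Q\<^esub> X = X"
    using x by (simp_all add: coset_zero)
  show "c \<odot>\<^bsub>?Q\<^esub> X \<in> carrier ?Q" "(c + d) \<odot>\<^bsub>?Q\<^esub> X = c \<odot>\<^bsub>?Q\<^esub> X \<oplus>\<^bsub>?Q\<^esub> d \<odot>\<^bsub>?Q\<^esub> X"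
    "(c * d) \<odot>\<^bsub>?Q\<^esub> X = c \<odot>\<^bsub>?Q\<^esub> (d \<odot>\<^bsub>?Q\<^esub> X)" for c d
    using x by (simp_all add: coset kmod_add_smult kmod_smult_assoc)
  fix Y assume "Y \<in> carrier ?Q"
  then obtain y where y: "y \<in> carrier M" "Y = N +> y"
    by (auto simp: quot_carrier)
  show "X \<oplus>\<^bsub>?Q\<^esub> Y \<in> carrier ?Q" "X \<oplus>\<^bsub>?Q\<^esub> Y = Y \<oplus>\<^bsub>?Q\<^esub> X"
    using x y by (simp_all add: coset kmod_add_comm[OF M x(1) y(1)])
  show "c \<odot>\<^bsub>?Q\<^esub> (X \<oplus>\<^bsub>?Q\<^esub> Y) = c \<odot>\<^bsub>?Q\<^esub> X \<oplus>\<^bsub>?Q\<^esub> c \<odot>\<^bsub>?Q\<^esub> Y" for c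
    using x y by (simp add: kmod_smult_add)
  fix Z assume "Z \<in> carrier ?Q"
  then obtain z where z: "z \<in> carrier M" "Z = N +> z"
    by (auto simp: quot_carrier)
  show "X \<oplus>\<^bsub>?Q\<^esub> Y \<oplus>\<^bsub>?Q\<^esub> Z = X \<oplus>\<^bsub>?Q\<^esub> (Y \<oplus>\<^bsub>?Q\<^esub> Z)"
    using x y z by (simp add: kmod_add_assoc)
qed

lemma coset_lin_maps: "(\<lambda>x. N +> x) \<in> lin_maps M (quot_module M N)"
  by (rule lin_mapsI) (auto simp: quot_carrier coset_add coset_smult simp del: quot_module_sel(2,3))

lemma generates_quot:
  assumes "generates M G"
  shows "generates (quot_module M N) ((\<lambda>x. N +> x) ` G)"
  unfolding generates_def
proof (intro conjI allI impI)
  show "(\<lambda>x. N +> x) ` G \<subseteq> carrier (quot_module M N)"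
    using assms by (auto simp: quot_carrier generates_def)
  fix K assume "subsp (quot_module M N) K" and G: "(\<lambda>x. N +> x) ` G \<subseteq> K"
  then have "subsp M {x \<in> carrier M. N +> x \<in> K}"
    using subsp_vimage[OF coset_lin_maps M kmod_quot] by simp
  moreover have "G \<subseteq> {x \<in> carrier M. N +> x \<in> K}"
    using assms G by (auto simp: generates_def)
  ultimately have "carrier M \<subseteq> {x \<in> carrier M. N +> x \<in> K}"
    using assms unfolding generates_def by blast
  then show "carrier (quot_module M N) \<subseteq> K"
    unfolding quot_carrier by blast
qed

end

lemma quot_map_coset:
  assumes M: "kmod M" "subsp M N" and M': "kmod M'" "subsp M' N'" and h: "h \<in> lin_maps M M'" "\<And>x. x \<in> N \<Longrightarrow> h x \<in> N'"
    and x: "x \<in> carrier M"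
  shows "quot_map M' N' h (N +>\<^bsub>M\<^esub> x) = N' +>\<^bsub>M'\<^esub> h x"
proof -
  have "N' +>\<^bsub>M'\<^esub> h y = N' +>\<^bsub>M'\<^esub> h x" if "y \<in> N +>\<^bsub>M\<^esub> x" for y
  proof -
    have y: "y \<in> carrier M" "y \<ominus>\<^bsub>M\<^esub> x \<in> N"
      using that coset_subset[OF M x that] mem_coset_iff[OF M x] by auto
    have "h y \<ominus>\<^bsub>M'\<^esub> h x \<in> N'"
      using h(2)[OF y(2)] x y M M' h by (simp add: lin_maps_minus)
    then show ?thesis
      using coset_eq_iff[OF M'] x y h(1) by (simp add: lin_maps_closed)
  qed
  then show ?thesis
    using UN_coset[OF M x, of "\<lambda>y. N' +>\<^bsub>M'\<^esub> h y"] by (simp add: quot_map_def)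
qed

lemma quot_map_lin_maps:
  assumes M: "kmod M" "subsp M N" and M': "kmod M'" "subsp M' N'"
    and h: "h \<in> lin_maps M M'" "\<And>x. x \<in> N \<Longrightarrow> h x \<in> N'"
  shows "quot_map M' N' h \<in> lin_maps (quot_module M N) (quot_module M' N')"
proof -
  note [simp] = quot_map_coset[OF M M' h(1)] h(2) coset_add[OF M] coset_smult[OF M]
    coset_add[OF M'] coset_smult[OF M'] quot_carrier M M'
  show ?thesis
    by (rule lin_mapsI)
      (use h(1) in \<open>auto simp: lin_maps_closed lin_maps_add lin_maps_smult simp del: quot_module_sel(2,3)\<close>)
qed

text \<open>Meaningful if \<open>f\<close> is constant on the coset \<open>X\<close>.\<close>

definition lift_form :: "('v \<Rightarrow> 'k poly) \<Rightarrow> 'v set \<Rightarrow> 'k::field poly" where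
  "lift_form f X = f (SOME x. x \<in> X)"

context
  fixes M :: "('k::field, 'v) module" and N :: "'v set" and f :: "'v \<Rightarrow> 'k poly"
  assumes M: "kmod M" and N: "subsp M N" and f: "lin_form M f" "\<And>x. x \<in> N \<Longrightarrow> f x = 0"
begin

lemma lift_form_coset:
  assumes x: "x \<in> carrier M"
  shows "lift_form f (N +>\<^bsub>M\<^esub> x) = f x"
proof -
  let ?y = "SOME y. y \<in> N +>\<^bsub>M\<^esub> x"
  have "?y \<in> N +>\<^bsub>M\<^esub> x"
    using coset_self[OF M N x] by (rule someI)
  then have "?y \<in> carrier M" "?y \<ominus>\<^bsub>M\<^esub> x \<in> N"
    using mem_coset_iff[OF M N x] coset_subset[OF M N x] by blast+
  then have "f ?y - f x = 0"
    using f M x lin_form_minus by metis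
  then show ?thesis
    by (simp add: lift_form_def)
qed

lemma lin_form_lift: "lin_form (quot_module M N) (lift_form f)"
  by (rule lin_formI)
    (use f(1) M in \<open>auto simp: quot_carrier coset_add[OF M N] coset_smult[OF M N] lift_form_coset
      lin_form_add lin_form_smult simp del: quot_module_sel(2,3)\<close>)

end

lemma mspan_lin_maps:
  assumes "kmod M" "kmod M'" "G \<subseteq> carrier M" "subsp M' N'" "h \<in> lin_maps M M'" "\<And>x. x \<in> G \<Longrightarrow> h x \<in> N'"
    and x: "x \<in> mspan M G"
  shows "h x \<in> N'"
proof -
  have "mspan M G \<subseteq> {x \<in> carrier M. h x \<in> N'}"
    using assms by (intro mspan_least subsp_vimage) auto
  then show ?thesis
    using x by blast
qed

lemma mspan_lin_form:
  assumes "kmod M" "G \<subseteq> carrier M" "lin_form M f" "\<And>x. x \<in> G \<Longrightarrow> f x = 0"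
    and x: "x \<in> mspan M G"
  shows "f x = 0"
proof -
  have "mspan M G \<subseteq> {x \<in> carrier M. f x = 0}"
    using assms by (intro mspan_least subsp_zeros) auto
  then show ?thesis
    using x by blast
qed

lemma lin_maps_eqI:
  assumes "f \<in> lin_maps M N" "g \<in> lin_maps M N" "kmod M" "kmod N" "generates M G"
    and "\<And>x. x \<in> G \<Longrightarrow> f x = g x" "x \<in> carrier M"
  shows "f x = g x"
  using assms(5,7,6)
  by (rule generates_induct) (use assms in \<open>auto simp: lin_maps_zero lin_maps_add lin_maps_smult\<close>)

lemma lin_maps_comp: "\<lbrakk>f \<in> lin_maps A B; g \<in> lin_maps B C\<rbrakk> \<Longrightarrow> (\<lambda>x. g (f x)) \<in> lin_maps A C"
  by (rule lin_mapsI) (simp_all add: lin_maps_closed lin_maps_add lin_maps_smult)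

subsection \<open>Tensor powers\<close>

lemma tuples_iff: "xs \<in> tuples m V \<longleftrightarrow> length xs = m \<and> set xs \<subseteq> carrier V"
  by (simp add: tuples_def)

lemma tuples_length: "xs \<in> tuples m V \<Longrightarrow> length xs = m"
  by (simp add: tuples_def)

lemma tuples_nth: "\<lbrakk>xs \<in> tuples m V; i < m\<rbrakk> \<Longrightarrow> xs ! i \<in> carrier V"
  by (auto simp: tuples_def)

lemma tuples_update: "\<lbrakk>xs \<in> tuples m V; x \<in> carrier V\<rbrakk> \<Longrightarrow> xs[i := x] \<in> tuples m V"
  using set_update_subset_insert[of xs i x] by (auto simp: tuples_def)

lemma tuples_map: "\<lbrakk>xs \<in> tuples m V; g \<in> lin_maps V W\<rbrakk> \<Longrightarrow> map g xs \<in> tuples m W"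
  by (auto simp: tuples_def intro: lin_maps_closed)

lemma tuples_permute: "\<lbrakk>xs \<in> tuples m V; \<sigma> permutes {..<m}\<rbrakk> \<Longrightarrow> permute_list \<sigma> xs \<in> tuples m V"
  by (simp add: tuples_def)

text \<open>Since \<open>permute_list \<sigma> xs ! j = xs ! \<sigma> j\<close>, the entry at
  \<open>i\<close> moves to the position that \<open>\<sigma>\<close> sends to \<open>i\<close>,
  whence the inverse.\<close>

lemma permute_list_update:
  assumes "\<sigma> permutes {..<length xs}" "i < length xs"
  shows "permute_list \<sigma> (xs[i := x]) = (permute_list \<sigma> xs)[inv_into UNIV \<sigma> i := x]"
proof (rule nth_equalityI)
  fix j assume "j < length (permute_list \<sigma> (xs[i := x]))"
  then have j: "j < length xs"
    by simp
  have "\<sigma> j < length xs"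
    using permutes_in_image[OF assms(1)] j by auto
  moreover have "\<sigma> j = i \<longleftrightarrow> inv_into UNIV \<sigma> i = j"
    using permutes_inverses[OF assms(1)] by metis
  ultimately show "permute_list \<sigma> (xs[i := x]) ! j = (permute_list \<sigma> xs)[inv_into UNIV \<sigma> i := x] ! j"
    using j assms by (auto simp: permute_list_nth nth_list_update)
qed simp

text \<open>Multilinearity is stated through list updates to mirror \<open>multilinear_rels\<close>,
  so that the linear extension of \<open>h\<close> kills exactly these relations by
  inspection.\<close>

definition multilin :: "nat \<Rightarrow> ('k::field, 'v) module \<Rightarrow> ('v list \<Rightarrow> 'k poly) \<Rightarrow> bool" where
  "multilin m V h \<longleftrightarrow> (\<forall>xs\<in>tuples m V. \<forall>i<m.
     (\<forall>x\<in>carrier V. \<forall>y\<in>carrier V. h (xs[i := x \<oplus>\<^bsub>V\<^esub> y]) = h (xs[i := x]) + h (xs[i := y])) \<and>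
     (\<forall>c. \<forall>x\<in>carrier V. h (xs[i := c \<odot>\<^bsub>V\<^esub> x]) = Polynomial.smult c (h (xs[i := x]))))"

lemma multilinI:
  assumes "\<And>xs i x y. \<lbrakk>xs \<in> tuples m V; i < m; x \<in> carrier V; y \<in> carrier V\<rbrakk> \<Longrightarrow>
      h (xs[i := x \<oplus>\<^bsub>V\<^esub> y]) = h (xs[i := x]) + h (xs[i := y])"
    and "\<And>xs i c x. \<lbrakk>xs \<in> tuples m V; i < m; x \<in> carrier V\<rbrakk> \<Longrightarrow>
      h (xs[i := c \<odot>\<^bsub>V\<^esub> x]) = Polynomial.smult c (h (xs[i := x]))"
  shows "multilin m V h"
  using assms by (simp add: multilin_def)

definition tens_form :: "('v list \<Rightarrow> 'k::field poly) \<Rightarrow> ('v list \<Rightarrow>\<^sub>0 'k) set \<Rightarrow> 'k poly" where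
  "tens_form h = lift_form (lin_ext h)"

context
  fixes V :: "('k::field, 'v) module" and m :: nat
  assumes V: "kmod V"
begin

lemma multilinear_rels_subset: "multilinear_rels m V \<subseteq> carrier (free_module (tuples m V))"
proof -
  have closed: "Poly_Mapping.single xs c \<in> carrier (free_module (tuples m V))"
    if "xs \<in> tuples m V" for xs and c :: 'k
    using that by auto
  have minus: "p - q \<in> carrier (free_module (tuples m V))"
    if "p \<in> carrier (free_module (tuples m V))" "q \<in> carrier (free_module (tuples m V))"
    for p q :: "'v list \<Rightarrow>\<^sub>0 'k"
    using that keys_diff[of p q] by auto
  show ?thesis
    unfolding multilinear_rels_def
    by (intro Un_least subsetI; elim CollectE exE conjE; hypsubst; intro minus closed tuples_update)
      (simp_all add: V)
qed

lemma subsp_tensor_kernel: "subsp (free_module (tuples m V)) (tensor_kernel m V)"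
  unfolding tensor_kernel_def by (intro mspan_subsp multilinear_rels_subset kmod_free)

lemma multilinear_rels_kernel: "multilinear_rels m V \<subseteq> tensor_kernel m V"
  unfolding tensor_kernel_def by (intro mspan_superset multilinear_rels_subset kmod_free)

lemma kmod_tensor: "kmod (tensor_power m V)"
  unfolding tensor_power_def by (intro kmod_quot kmod_free subsp_tensor_kernel)

lemma pure_closed: "xs \<in> tuples m V \<Longrightarrow> pure_tensor m V xs \<in> carrier (tensor_power m V)"
  unfolding pure_tensor_def tensor_power_def quot_carrier by (intro imageI) simp

lemma generates_pure: "generates (tensor_power m V) (pure_tensor m V ` tuples m V)"
proof -
  have "pure_tensor m V ` tuples m V = (\<lambda>x. tensor_kernel m V +>\<^bsub>free_module (tuples m V)\<^esub> x) `
      (\<lambda>xs. Poly_Mapping.single xs 1) ` tuples m V"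
    by (auto simp: pure_tensor_def)
  then show ?thesis
    unfolding tensor_power_def
    using generates_quot[OF kmod_free subsp_tensor_kernel generates_free] by simp
qed

lemma pure_add:
  assumes xs: "xs \<in> tuples m V" "i < m" "x \<in> carrier V" "y \<in> carrier V"
  shows "pure_tensor m V (xs[i := x \<oplus>\<^bsub>V\<^esub> y]) =
    pure_tensor m V (xs[i := x]) \<oplus>\<^bsub>tensor_power m V\<^esub> pure_tensor m V (xs[i := y])"
proof -
  let ?F = "free_module (tuples m V) :: ('k, 'v list \<Rightarrow>\<^sub>0 'k) module"
  let ?s = "\<lambda>z. Poly_Mapping.single (xs[i := z]) (1::'k)"
  have s: "?s z \<in> carrier ?F" if "z \<in> carrier V" for z
    using that xs by (simp add: tuples_update)
  have "?s (x \<oplus>\<^bsub>V\<^esub> y) - ?s x - ?s y \<in> tensor_kernel m V"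
    using multilinear_rels_kernel xs unfolding multilinear_rels_def by blast
  moreover have "?s (x \<oplus>\<^bsub>V\<^esub> y) \<ominus>\<^bsub>?F\<^esub> (?s x \<oplus>\<^bsub>?F\<^esub> ?s y) = ?s (x \<oplus>\<^bsub>V\<^esub> y) - ?s x - ?s y"
    using kmod_minus_add[of ?F "?s (x \<oplus>\<^bsub>V\<^esub> y)" "?s x \<oplus>\<^bsub>?F\<^esub> ?s y"] s xs V
      kmod_add_closed[of ?F "?s x" "?s y"] kmod_add_closed[of V x y]
    by (simp add: algebra_simps del: add_diff_eq)
  ultimately show ?thesis
    unfolding pure_tensor_def tensor_power_def
    using s xs V kmod_add_closed[of ?F "?s x" "?s y"]
    by (subst coset_add[OF kmod_free subsp_tensor_kernel]; (subst coset_eq_iff[OF kmod_free subsp_tensor_kernel])?)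
      simp_all
qed

lemma pure_smult:
  assumes xs: "xs \<in> tuples m V" "i < m" "x \<in> carrier V"
  shows "pure_tensor m V (xs[i := c \<odot>\<^bsub>V\<^esub> x]) = c \<odot>\<^bsub>tensor_power m V\<^esub> pure_tensor m V (xs[i := x])"
proof -
  let ?F = "free_module (tuples m V) :: ('k, 'v list \<Rightarrow>\<^sub>0 'k) module"
  let ?s = "\<lambda>z. Poly_Mapping.single (xs[i := z]) (1::'k)"
  have s: "?s z \<in> carrier ?F" if "z \<in> carrier V" for z
    using that xs by (simp add: tuples_update)
  have "?s (c \<odot>\<^bsub>V\<^esub> x) - Poly_Mapping.single (xs[i := x]) c \<in> tensor_kernel m V"
    using multilinear_rels_kernel xs unfolding multilinear_rels_def by blast
  moreover have "?s (c \<odot>\<^bsub>V\<^esub> x) \<ominus>\<^bsub>?F\<^esub> (c \<odot>\<^bsub>?F\<^esub> ?s x) = ?s (c \<odot>\<^bsub>V\<^esub> x) - Poly_Mapping.single (xs[i := x]) c"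
    using kmod_minus_add[of ?F "?s (c \<odot>\<^bsub>V\<^esub> x)" "c \<odot>\<^bsub>?F\<^esub> ?s x"] s xs V
      kmod_smult_closed[of ?F "?s x" c] kmod_smult_closed[of V x c]
    by (simp add: algebra_simps)
  ultimately show ?thesis
    unfolding pure_tensor_def tensor_power_def
    using s xs V kmod_smult_closed[of ?F "?s x" c]
    by (subst coset_smult[OF kmod_free subsp_tensor_kernel]; (subst coset_eq_iff[OF kmod_free subsp_tensor_kernel])?)
      simp_all
qed

lemma generates_pure_generators:
  assumes G: "generates V G"
  shows "generates (tensor_power m V) (pure_tensor m V ` {xs. length xs = m \<and> set xs \<subseteq> G})"
proof (rule generates_trans[OF generates_pure])
  have GV: "G \<subseteq> carrier V"
    using G by (simp add: generates_def)
  then show "pure_tensor m V ` {xs. length xs = m \<and> set xs \<subseteq> G} \<subseteq> carrier (tensor_power m V)"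
    by (auto intro!: pure_closed simp: tuples_iff)
  fix N
  assume N: "subsp (tensor_power m V) N" "pure_tensor m V ` {xs. length xs = m \<and> set xs \<subseteq> G} \<subseteq> N"
  \<comment> \<open>Induction on the number \<open>k\<close> of leading entries that may be
    arbitrary vectors while the others lie in \<open>G\<close>. A step frees the entry at
    \<open>k\<close>, using linearity of the tensor in this entry.\<close>
  have "pure_tensor m V xs \<in> N" if "xs \<in> tuples m V" "\<forall>i. k \<le> i \<and> i < m \<longrightarrow> xs ! i \<in> G" "k \<le> m" for k xs
    using that
  proof (induction k arbitrary: xs)
    case 0
    then have "set xs \<subseteq> G"
      by (auto simp: tuples_iff in_set_conv_nth)
    then show ?case
      using N(2) 0 by (auto simp: tuples_iff)
  next
    case (Suc k)
    have "pure_tensor m V (xs[k := x]) \<in> N" if "x \<in> carrier V" for x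
      using G that
    proof (rule generates_induct)
      fix g assume "g \<in> G"
      then show "pure_tensor m V (xs[k := g]) \<in> N"
        using Suc.prems GV by (intro Suc.IH) (auto simp: nth_list_update tuples_length intro!: tuples_update)
    next
      \<comment> \<open>The zero vector is written as a multiple by 0 so that homogeneity makes the
        whole tensor vanish.\<close>
      have "\<zero>\<^bsub>V\<^esub> = 0 \<odot>\<^bsub>V\<^esub> \<zero>\<^bsub>V\<^esub>"
        using V by simp
      then have "pure_tensor m V (xs[k := \<zero>\<^bsub>V\<^esub>]) =
          0 \<odot>\<^bsub>tensor_power m V\<^esub> pure_tensor m V (xs[k := \<zero>\<^bsub>V\<^esub>])"
        using pure_smult[of xs k "\<zero>\<^bsub>V\<^esub>" 0] Suc.prems V by simp
      also have "\<dots> = \<zero>\<^bsub>tensor_power m V\<^esub>"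
        using kmod_tensor Suc.prems V by (intro kmod_zero_smult pure_closed tuples_update) auto
      finally show "pure_tensor m V (xs[k := \<zero>\<^bsub>V\<^esub>]) \<in> N"
        using subsp_zero[OF N(1)] by simp
    next
      fix x y assume "x \<in> carrier V" "y \<in> carrier V"
        "pure_tensor m V (xs[k := x]) \<in> N" "pure_tensor m V (xs[k := y]) \<in> N"
      then show "pure_tensor m V (xs[k := x \<oplus>\<^bsub>V\<^esub> y]) \<in> N"
        using Suc.prems subsp_add[OF N(1)] by (subst pure_add) auto
    next
      fix c x assume "x \<in> carrier V" "pure_tensor m V (xs[k := x]) \<in> N"
      then show "pure_tensor m V (xs[k := c \<odot>\<^bsub>V\<^esub> x]) \<in> N"
        using Suc.prems subsp_smult[OF N(1)] by (subst pure_smult) auto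
    qed (rule V)
    from this[of "xs ! k"] show ?case
      using Suc.prems by (simp add: tuples_nth)
  qed
  then show "pure_tensor m V ` tuples m V \<subseteq> N"
    using leD by blast
qed

lemma lin_ext_multilin_zero:
  assumes h: "multilin m V h" and p: "p \<in> tensor_kernel m V"
  shows "lin_ext h p = 0"
proof (rule mspan_lin_form[OF kmod_free multilinear_rels_subset lin_form_lin_ext])
  show "p \<in> mspan (free_module (tuples m V)) (multilinear_rels m V)"
    using p by (simp add: tensor_kernel_def)
  show "lin_ext h p = 0" if "p \<in> multilinear_rels m V" for p
    using that h unfolding multilinear_rels_def multilin_def by auto
qed

lemma
  assumes h: "multilin m V h"
  shows lin_form_tens: "lin_form (tensor_power m V) (tens_form h)"
    and tens_form_pure: "xs \<in> tuples m V \<Longrightarrow> tens_form h (pure_tensor m V xs) = h xs"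
proof -
  note * = kmod_free subsp_tensor_kernel lin_form_lin_ext[of "tuples m V" h] lin_ext_multilin_zero[OF h]
  show "lin_form (tensor_power m V) (tens_form h)"
    unfolding tens_form_def tensor_power_def using * by (rule lin_form_lift)
  show "tens_form h (pure_tensor m V xs) = h xs" if "xs \<in> tuples m V"
    unfolding tens_form_def pure_tensor_def using that by (subst lift_form_coset[OF *]) auto
qed

end

text \<open>A function on tuples that respects the defining relations descends to tensors. Both the
  functorial action of a linear map and the action of a permutation are instances.\<close>

lemma
  fixes h :: "'v list \<Rightarrow> 'w list"
  assumes V: "kmod V" and W: "kmod W" and h: "\<And>xs. xs \<in> tuples m V \<Longrightarrow> h xs \<in> tuples m W"
    and rels: "\<And>p. p \<in> multilinear_rels m V \<Longrightarrow> free_map h p \<in> multilinear_rels m W"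
  defines "H \<equiv> quot_map (free_module (tuples m W)) (tensor_kernel m W) (free_map h)"
  shows tensor_quot_map_lin_maps: "H \<in> lin_maps (tensor_power m V) (tensor_power m W)"
    and tensor_quot_map_pure: "xs \<in> tuples m V \<Longrightarrow> H (pure_tensor m V xs) = pure_tensor m W (h xs)"
proof -
  have lin: "free_map h \<in> lin_maps (free_module (tuples m V)) (free_module (tuples m W))"
    using h by (rule free_map_lin_maps)
  have rels': "free_map h p \<in> tensor_kernel m W" if "p \<in> multilinear_rels m V" for p
    using rels[OF that] multilinear_rels_kernel[OF W] by blast
  have ker: "free_map h p \<in> tensor_kernel m W" if "p \<in> tensor_kernel m V" for p
    using mspan_lin_maps[OF kmod_free kmod_free multilinear_rels_subset[OF V] subsp_tensor_kernel[OF W] lin rels']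
      that unfolding tensor_kernel_def[of m V] by blast
  note * = kmod_free subsp_tensor_kernel[OF V] kmod_free subsp_tensor_kernel[OF W] lin ker
  show "H \<in> lin_maps (tensor_power m V) (tensor_power m W)"
    unfolding H_def tensor_power_def using * by (rule quot_map_lin_maps)
  show "H (pure_tensor m V xs) = pure_tensor m W (h xs)" if "xs \<in> tuples m V"
    unfolding H_def pure_tensor_def using that by (subst quot_map_coset[OF *]) auto
qed

lemma
  assumes V: "kmod V" and W: "kmod W" and g: "g \<in> lin_maps V W"
  shows tensor_map_lin_maps: "tensor_map m W g \<in> lin_maps (tensor_power m V) (tensor_power m W)"
    and tensor_map_pure: "xs \<in> tuples m V \<Longrightarrow> tensor_map m W g (pure_tensor m V xs) = pure_tensor m W (map g xs)"
proof -
  have rels: "free_map (map g) p \<in> multilinear_rels m W" if "p \<in> multilinear_rels m V" for p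
    using that unfolding multilinear_rels_def Un_iff
  proof (elim disjE CollectE exE conjE, goal_cases)
    case (1 xs i x y)
    then show ?case
      using g by (intro disjI1 CollectI exI[of _ "map g xs"] exI[of _ i] exI[of _ "g x"] exI[of _ "g y"])
        (simp_all add: map_update lin_maps_add[OF g] lin_maps_closed[OF g] tuples_map)
  next
    case (2 xs i c x)
    then show ?case
      using g by (intro disjI2 CollectI exI[of _ "map g xs"] exI[of _ i] exI[of _ c] exI[of _ "g x"])
        (simp_all add: map_update lin_maps_smult[OF g] lin_maps_closed[OF g] tuples_map)
  qed
  note * = V W tuples_map[OF _ g] rels
  show "tensor_map m W g \<in> lin_maps (tensor_power m V) (tensor_power m W)"
    unfolding tensor_map_def using * by (rule tensor_quot_map_lin_maps)
  show "tensor_map m W g (pure_tensor m V xs) = pure_tensor m W (map g xs)" if "xs \<in> tuples m V"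
    unfolding tensor_map_def using * that by (rule tensor_quot_map_pure)
qed

lemma
  assumes V: "kmod V" and \<sigma>: "\<sigma> permutes {..<m}"
  shows tensor_permute_lin_maps: "tensor_permute m V \<sigma> \<in> lin_maps (tensor_power m V) (tensor_power m V)"
    and tensor_permute_pure:
      "xs \<in> tuples m V \<Longrightarrow> tensor_permute m V \<sigma> (pure_tensor m V xs) = pure_tensor m V (permute_list \<sigma> xs)"
proof -
  have inv: "inv_into UNIV \<sigma> i < m" if "i < m" for i
    using permutes_in_image[OF permutes_inv[OF \<sigma>]] that by auto
  have rels: "free_map (permute_list \<sigma>) p \<in> multilinear_rels m V" if "p \<in> multilinear_rels m V" for p
    using that unfolding multilinear_rels_def Un_iff
  proof (elim disjE CollectE exE conjE, goal_cases)
    case (1 xs i x y)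
    then show ?case
      using \<sigma> by (intro disjI1 CollectI exI[of _ "permute_list \<sigma> xs"] exI[of _ "inv_into UNIV \<sigma> i"] exI[of _ x] exI[of _ y])
        (simp_all add: tuples_length tuples_permute permute_list_update inv)
  next
    case (2 xs i c x)
    then show ?case
      using \<sigma> by (intro disjI2 CollectI exI[of _ "permute_list \<sigma> xs"] exI[of _ "inv_into UNIV \<sigma> i"] exI[of _ c] exI[of _ x])
        (simp_all add: tuples_length tuples_permute permute_list_update inv)
  qed
  note * = V V tuples_permute[OF _ \<sigma>] rels
  show "tensor_permute m V \<sigma> \<in> lin_maps (tensor_power m V) (tensor_power m V)"
    unfolding tensor_permute_def using * by (rule tensor_quot_map_lin_maps)
  show "tensor_permute m V \<sigma> (pure_tensor m V xs) = pure_tensor m V (permute_list \<sigma> xs)" if "xs \<in> tuples m V"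
    unfolding tensor_permute_def using * that by (rule tensor_quot_map_pure)
qed

lemma tens_form_tensor_map:
  assumes "kmod V" "kmod W" "g \<in> lin_maps V W" "multilin m W h" "multilin m V h'"
    and "t \<in> carrier (tensor_power m V)" and "\<And>xs. xs \<in> tuples m V \<Longrightarrow> h (map g xs) = h' xs"
  shows "tens_form h (tensor_map m W g t) = tens_form h' t"
proof (rule lin_form_eqI[OF lin_form_comp[OF lin_form_tens[OF assms(2,4)] tensor_map_lin_maps[OF assms(1-3)]]
      lin_form_tens[OF assms(1,5)] generates_pure[OF assms(1)] kmod_tensor[OF assms(1)] _ assms(6)])
  show "tens_form h (tensor_map m W g t) = tens_form h' t"
    if "t \<in> pure_tensor m V ` tuples m V" for t
    using that assms by (auto simp: tens_form_pure tensor_map_pure[OF assms(1-3)] tuples_map)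
qed

lemma tens_form_tensor_permute:
  assumes "kmod V" "\<sigma> permutes {..<m}" "multilin m V h" "multilin m V h'"
    and "t \<in> carrier (tensor_power m V)" and "\<And>xs. xs \<in> tuples m V \<Longrightarrow> h (permute_list \<sigma> xs) = h' xs"
  shows "tens_form h (tensor_permute m V \<sigma> t) = tens_form h' t"
proof (rule lin_form_eqI[OF lin_form_comp[OF lin_form_tens[OF assms(1,3)] tensor_permute_lin_maps[OF assms(1,2)]]
      lin_form_tens[OF assms(1,4)] generates_pure[OF assms(1)] kmod_tensor[OF assms(1)] _ assms(5)])
  show "tens_form h (tensor_permute m V \<sigma> t) = tens_form h' t"
    if "t \<in> pure_tensor m V ` tuples m V" for t
    using that assms by (auto simp: tens_form_pure tensor_permute_pure[OF assms(1,2)] tuples_permute)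
qed

subsection \<open>Divided powers\<close>

lemma Div_carrier: "t \<in> carrier (Div m V) \<longleftrightarrow>
    t \<in> carrier (tensor_power m V) \<and> (\<forall>\<sigma>. \<sigma> permutes {..<m} \<longrightarrow> tensor_permute m V \<sigma> t = t)"
  by (auto simp: Div_def)

lemma Div_sel [simp]:
  "add (Div m V) = add (tensor_power m V)"
  "zero (Div m V) = zero (tensor_power m V)"
  "smult (Div m V) = smult (tensor_power m V)"
  by (simp_all add: Div_def)

lemma subsp_Div:
  assumes V: "kmod V"
  shows "subsp (tensor_power m V) (carrier (Div m V))"
proof (rule subspI)
  note T = kmod_tensor[OF V, of m] and lin = tensor_permute_lin_maps[OF V, of _ m]
  show "\<zero>\<^bsub>tensor_power m V\<^esub> \<in> carrier (Div m V)"
    using T by (simp add: Div_carrier lin_maps_zero[OF lin T T])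
  show "x \<oplus>\<^bsub>tensor_power m V\<^esub> y \<in> carrier (Div m V)"
    if "x \<in> carrier (Div m V)" "y \<in> carrier (Div m V)" for x y
    using that T by (simp add: Div_carrier lin_maps_add[OF lin])
  show "c \<odot>\<^bsub>tensor_power m V\<^esub> x \<in> carrier (Div m V)" if "x \<in> carrier (Div m V)" for c x
    using that T by (simp add: Div_carrier lin_maps_smult[OF lin])
qed (simp add: Div_carrier subset_iff)

lemma kmod_Div:
  assumes "kmod V"
  shows "kmod (Div m V)"
proof (rule kmodI)
  note T = kmod_tensor[OF assms, of m] and D = subsp_Div[OF assms, of m]
  note [simp] = subsp_carrier[OF D] T
  show "x \<oplus>\<^bsub>Div m V\<^esub> y = y \<oplus>\<^bsub>Div m V\<^esub> x" if "x \<in> carrier (Div m V)" "y \<in> carrier (Div m V)" for x y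
    using that kmod_add_comm[OF T] by simp
qed (use kmod_tensor[OF assms, of m] subsp_Div[OF assms, of m] in
      \<open>auto simp: subsp_carrier subsp_zero subsp_add subsp_smult kmod_add_assoc kmod_smult_add kmod_add_smult kmod_smult_assoc\<close>)

lemma lin_form_Div: "\<lbrakk>lin_form (tensor_power m V) f; kmod V\<rbrakk> \<Longrightarrow> lin_form (Div m V) f"
  by (rule lin_formI) (auto simp: lin_form_add lin_form_smult Div_carrier)

text \<open>Applying \<open>g\<close> in every position commutes with permuting the positions, so
  invariance survives. It suffices to check this on pure tensors.\<close>

lemma Div_map_lin_maps:
  assumes V: "kmod V" and W: "kmod W" and g: "g \<in> lin_maps V W"
  shows "Div_map m W g \<in> lin_maps (Div m V) (Div m W)"
proof (rule lin_mapsI)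
  note lin = tensor_map_lin_maps[OF V W g, of m]
  fix t assume t: "t \<in> carrier (Div m V)"
  have "tensor_permute m W \<sigma> (tensor_map m W g t) = tensor_map m W g (tensor_permute m V \<sigma> t)"
    if \<sigma>: "\<sigma> permutes {..<m}" for \<sigma>
  proof (rule lin_maps_eqI[where f = "\<lambda>t. tensor_permute m W \<sigma> (tensor_map m W g t)"
        and g = "\<lambda>t. tensor_map m W g (tensor_permute m V \<sigma> t)",
        OF _ _ kmod_tensor[OF V] kmod_tensor[OF W] generates_pure[OF V]])
    show "(\<lambda>t. tensor_permute m W \<sigma> (tensor_map m W g t)) \<in> lin_maps (tensor_power m V) (tensor_power m W)"
      using lin tensor_permute_lin_maps[OF W \<sigma>] by (rule lin_maps_comp)
    show "(\<lambda>t. tensor_map m W g (tensor_permute m V \<sigma> t)) \<in> lin_maps (tensor_power m V) (tensor_power m W)"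
      using tensor_permute_lin_maps[OF V \<sigma>] lin by (rule lin_maps_comp)
    show "tensor_permute m W \<sigma> (tensor_map m W g t) = tensor_map m W g (tensor_permute m V \<sigma> t)"
      if "t \<in> pure_tensor m V ` tuples m V" for t
      using that V W g \<sigma>
      by (auto simp: tensor_map_pure tensor_permute_pure tuples_permute tuples_map permute_list_map tuples_length)
    show "t \<in> carrier (tensor_power m V)"
      using t by (simp add: Div_carrier)
  qed
  then show "tensor_map m W g t \<in> carrier (Div m W)"
    using t lin by (auto simp: Div_carrier lin_maps_closed)
qed (use tensor_map_lin_maps[OF V W g, of m] in \<open>auto simp: Div_carrier lin_maps_add lin_maps_smult\<close>)

subsection \<open>Symmetric and exterior powers\<close>

definition sym_prod :: "nat \<Rightarrow> ('k::field, 'v) module \<Rightarrow> 'v list \<Rightarrow> ('v list \<Rightarrow>\<^sub>0 'k) set set" where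
  "sym_prod m V xs = sym_kernel m V +>\<^bsub>tensor_power m V\<^esub> pure_tensor m V xs"

definition ext_prod :: "nat \<Rightarrow> ('k::field, 'v) module \<Rightarrow> 'v list \<Rightarrow> ('v list \<Rightarrow>\<^sub>0 'k) set set" where
  "ext_prod m V xs = ext_kernel m V +>\<^bsub>tensor_power m V\<^esub> pure_tensor m V xs"

definition quot_form :: "('v list \<Rightarrow> 'k::field poly) \<Rightarrow> ('v list \<Rightarrow>\<^sub>0 'k) set set \<Rightarrow> 'k poly" where
  "quot_form h = lift_form (tens_form h)"

definition symmetric :: "nat \<Rightarrow> ('k::field, 'v) module \<Rightarrow> ('v list \<Rightarrow> 'k poly) \<Rightarrow> bool" where
  "symmetric m V h \<longleftrightarrow> (\<forall>xs\<in>tuples m V. \<forall>\<sigma>. \<sigma> permutes {..<m} \<longrightarrow> h (permute_list \<sigma> xs) = h xs)"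

definition alternating :: "nat \<Rightarrow> ('k::field, 'v) module \<Rightarrow> ('v list \<Rightarrow> 'k poly) \<Rightarrow> bool" where
  "alternating m V h \<longleftrightarrow> (\<forall>xs\<in>tuples m V. \<not> distinct xs \<longrightarrow> h xs = 0)"

context
  fixes V :: "('k::field, 'v) module" and m :: nat
  assumes V: "kmod V"
begin

lemma sym_gens_subset:
  "{pure_tensor m V xs \<ominus>\<^bsub>tensor_power m V\<^esub> pure_tensor m V (permute_list \<sigma> xs) | xs \<sigma>.
      xs \<in> tuples m V \<and> \<sigma> permutes {..<m}} \<subseteq> carrier (tensor_power m V)"
  using kmod_tensor[OF V, of m] by (auto simp: pure_closed[OF V] tuples_permute)

lemma ext_gens_subset:
  "{pure_tensor m V xs | xs. xs \<in> tuples m V \<and> \<not> distinct xs} \<subseteq> carrier (tensor_power m V)"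
  by (auto simp: pure_closed[OF V])

lemma subsp_sym_kernel: "subsp (tensor_power m V) (sym_kernel m V)"
  unfolding sym_kernel_def by (intro mspan_subsp sym_gens_subset kmod_tensor V)

lemma subsp_ext_kernel: "subsp (tensor_power m V) (ext_kernel m V)"
  unfolding ext_kernel_def by (intro mspan_subsp ext_gens_subset kmod_tensor V)

lemma kmod_Sym: "kmod (Sym m V)"
  unfolding Sym_def by (intro kmod_quot kmod_tensor subsp_sym_kernel V)

lemma kmod_Ext: "kmod (Ext m V)"
  unfolding Ext_def by (intro kmod_quot kmod_tensor subsp_ext_kernel V)

lemma sym_prod_closed: "xs \<in> tuples m V \<Longrightarrow> sym_prod m V xs \<in> carrier (Sym m V)"
  unfolding sym_prod_def Sym_def quot_carrier by (intro imageI pure_closed V)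

lemma ext_prod_closed: "xs \<in> tuples m V \<Longrightarrow> ext_prod m V xs \<in> carrier (Ext m V)"
  unfolding ext_prod_def Ext_def quot_carrier by (intro imageI pure_closed V)

lemma sym_prod_permute:
  assumes "xs \<in> tuples m V" "\<sigma> permutes {..<m}"
  shows "sym_prod m V (permute_list \<sigma> xs) = sym_prod m V xs"
proof -
  have "pure_tensor m V xs \<ominus>\<^bsub>tensor_power m V\<^esub> pure_tensor m V (permute_list \<sigma> xs) \<in> sym_kernel m V"
    using mspan_superset[OF kmod_tensor[OF V] sym_gens_subset] assms unfolding sym_kernel_def by blast
  then show ?thesis
    unfolding sym_prod_def
    using coset_eq_iff[OF kmod_tensor[OF V] subsp_sym_kernel, of "pure_tensor m V xs" "pure_tensor m V (permute_list \<sigma> xs)"]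
      assms by (simp add: pure_closed[OF V] tuples_permute)
qed

lemma ext_prod_not_distinct:
  assumes "xs \<in> tuples m V" "\<not> distinct xs"
  shows "ext_prod m V xs = \<zero>\<^bsub>Ext m V\<^esub>"
proof -
  have "pure_tensor m V xs \<in> ext_kernel m V"
    using mspan_superset[OF kmod_tensor[OF V] ext_gens_subset] assms unfolding ext_kernel_def by blast
  then show ?thesis
    unfolding ext_prod_def Ext_def
    using coset_eq_self_iff[OF kmod_tensor[OF V] subsp_ext_kernel] assms by (simp add: pure_closed[OF V])
qed

lemma ext_prod_add:
  assumes xs: "xs \<in> tuples m V" "i < m" "x \<in> carrier V" "y \<in> carrier V"
  shows "ext_prod m V (xs[i := x \<oplus>\<^bsub>V\<^esub> y]) =
    ext_prod m V (xs[i := x]) \<oplus>\<^bsub>Ext m V\<^esub> ext_prod m V (xs[i := y])"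
  unfolding ext_prod_def Ext_def pure_add[OF V assms]
  using assms by (intro coset_add[OF kmod_tensor[OF V] subsp_ext_kernel, symmetric] pure_closed[OF V] tuples_update)

lemma ext_prod_smult:
  assumes xs: "xs \<in> tuples m V" "i < m" "x \<in> carrier V"
  shows "ext_prod m V (xs[i := c \<odot>\<^bsub>V\<^esub> x]) = c \<odot>\<^bsub>Ext m V\<^esub> ext_prod m V (xs[i := x])"
  unfolding ext_prod_def Ext_def pure_smult[OF V assms]
  using assms by (intro coset_smult[OF kmod_tensor[OF V] subsp_ext_kernel, symmetric] pure_closed[OF V] tuples_update)

lemma generates_sym_prod:
  assumes "generates V G"
  shows "generates (Sym m V) (sym_prod m V ` {xs. length xs = m \<and> set xs \<subseteq> G})"
  using generates_quot[OF kmod_tensor[OF V] subsp_sym_kernel generates_pure_generators[OF V assms]]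
  by (simp add: Sym_def image_image flip: sym_prod_def)

lemma generates_ext_prod:
  assumes "generates V G"
  shows "generates (Ext m V) (ext_prod m V ` {xs. length xs = m \<and> set xs \<subseteq> G})"
  using generates_quot[OF kmod_tensor[OF V] subsp_ext_kernel generates_pure_generators[OF V assms]]
  by (simp add: Ext_def image_image flip: ext_prod_def)

lemma generates_carrier: "generates V (carrier V)"
  by (simp add: generates_def)

lemma generates_sym_prod_tuples: "generates (Sym m V) (sym_prod m V ` tuples m V)"
  using generates_sym_prod[OF generates_carrier] by (simp add: tuples_def)

lemma generates_ext_prod_tuples: "generates (Ext m V) (ext_prod m V ` tuples m V)"
  using generates_ext_prod[OF generates_carrier] by (simp add: tuples_def)

text \<open>Common to symmetric and exterior powers: both are quotients of the tensor power by a
  span, and a form descends once it vanishes on the spanning set.\<close>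

lemma
  assumes h: "multilin m V h" and S: "S \<subseteq> carrier (tensor_power m V)" "\<And>t. t \<in> S \<Longrightarrow> tens_form h t = 0"
  defines "K \<equiv> mspan (tensor_power m V) S"
  shows lin_form_quot: "lin_form (quot_module (tensor_power m V) K) (quot_form h)"
    and quot_form_coset: "xs \<in> tuples m V \<Longrightarrow> quot_form h (K +>\<^bsub>tensor_power m V\<^esub> pure_tensor m V xs) = h xs"
proof -
  note T = kmod_tensor[OF V, of m] and ev = lin_form_tens[OF V h]
  have "tens_form h t = 0" if "t \<in> K" for t
    using mspan_lin_form[OF T S(1) ev S(2)] that unfolding K_def by blast
  note * = T mspan_subsp[OF T S(1), folded K_def] ev this
  show "lin_form (quot_module (tensor_power m V) K) (quot_form h)"
    unfolding quot_form_def using * by (rule lin_form_lift)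
  show "quot_form h (K +>\<^bsub>tensor_power m V\<^esub> pure_tensor m V xs) = h xs" if "xs \<in> tuples m V"
    unfolding quot_form_def using that by (simp add: lift_form_coset[OF *] pure_closed[OF V] tens_form_pure[OF V h])
qed

lemma
  assumes h: "multilin m V h" "symmetric m V h"
  shows lin_form_sym: "lin_form (Sym m V) (quot_form h)"
    and quot_form_prod: "xs \<in> tuples m V \<Longrightarrow> quot_form h (sym_prod m V xs) = h xs"
proof -
  have "tens_form h t = 0" if "t \<in> {pure_tensor m V xs \<ominus>\<^bsub>tensor_power m V\<^esub> pure_tensor m V (permute_list \<sigma> xs) | xs \<sigma>.
      xs \<in> tuples m V \<and> \<sigma> permutes {..<m}}" for t
    using that h
    by (auto simp: lin_form_minus[OF lin_form_tens[OF V h(1)] kmod_tensor[OF V]] pure_closed[OF V]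
        tuples_permute tens_form_pure[OF V h(1)] symmetric_def)
  note * = h(1) sym_gens_subset this
  show "lin_form (Sym m V) (quot_form h)"
    unfolding Sym_def sym_kernel_def using * by (rule lin_form_quot)
  show "quot_form h (sym_prod m V xs) = h xs" if "xs \<in> tuples m V"
    unfolding sym_prod_def sym_kernel_def using * that by (rule quot_form_coset)
qed

lemma
  assumes h: "multilin m V h" "alternating m V h"
  shows lin_form_ext: "lin_form (Ext m V) (quot_form h)"
    and ext_form_prod: "xs \<in> tuples m V \<Longrightarrow> quot_form h (ext_prod m V xs) = h xs"
proof -
  have "tens_form h t = 0" if "t \<in> {pure_tensor m V xs | xs. xs \<in> tuples m V \<and> \<not> distinct xs}" for t
    using that h by (auto simp: tens_form_pure[OF V h(1)] alternating_def)
  note * = h(1) ext_gens_subset this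
  show "lin_form (Ext m V) (quot_form h)"
    unfolding Ext_def ext_kernel_def using * by (rule lin_form_quot)
  show "quot_form h (ext_prod m V xs) = h xs" if "xs \<in> tuples m V"
    unfolding ext_prod_def ext_kernel_def using * that by (rule quot_form_coset)
qed

end

lemma
  assumes V: "kmod V" and W: "kmod W" and g: "g \<in> lin_maps V W"
    and S: "S \<subseteq> carrier (tensor_power m V)" "S' \<subseteq> carrier (tensor_power m W)"
    and SS': "\<And>t. t \<in> S \<Longrightarrow> tensor_map m W g t \<in> S'"
  defines "K \<equiv> mspan (tensor_power m V) S" and "K' \<equiv> mspan (tensor_power m W) S'"
  defines "H \<equiv> quot_map (tensor_power m W) K' (tensor_map m W g)"
  shows quot_tensor_map_lin_maps: "H \<in> lin_maps (quot_module (tensor_power m V) K) (quot_module (tensor_power m W) K')"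
    and quot_tensor_map_pure: "xs \<in> tuples m V \<Longrightarrow> H (K +>\<^bsub>tensor_power m V\<^esub> pure_tensor m V xs) =
      K' +>\<^bsub>tensor_power m W\<^esub> pure_tensor m W (map g xs)"
proof -
  note T = kmod_tensor[OF V, of m] and T' = kmod_tensor[OF W, of m] and lin = tensor_map_lin_maps[OF V W g, of m]
  have K': "subsp (tensor_power m W) K'" "S' \<subseteq> K'"
    unfolding K'_def using T' S(2) by (rule mspan_subsp, rule mspan_superset)
  have "tensor_map m W g t \<in> K'" if "t \<in> S" for t
    using SS'[OF that] K'(2) by blast
  from mspan_lin_maps[OF T T' S(1) K'(1) lin this]
  have ker: "tensor_map m W g t \<in> K'" if "t \<in> K" for t
    using that unfolding K_def by blast
  note * = T mspan_subsp[OF T S(1), folded K_def] T' K'(1) lin ker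
  show "H \<in> lin_maps (quot_module (tensor_power m V) K) (quot_module (tensor_power m W) K')"
    unfolding H_def using * by (rule quot_map_lin_maps)
  show "H (K +>\<^bsub>tensor_power m V\<^esub> pure_tensor m V xs) = K' +>\<^bsub>tensor_power m W\<^esub> pure_tensor m W (map g xs)"
    if "xs \<in> tuples m V"
    unfolding H_def using that by (simp add: quot_map_coset[OF *] pure_closed[OF V] tensor_map_pure[OF V W g])
qed

lemma
  assumes V: "kmod V" and W: "kmod W" and g: "g \<in> lin_maps V W"
  shows Sym_map_lin_maps: "Sym_map m W g \<in> lin_maps (Sym m V) (Sym m W)"
    and Sym_map_prod: "xs \<in> tuples m V \<Longrightarrow> Sym_map m W g (sym_prod m V xs) = sym_prod m W (map g xs)"
proof -
  have "tensor_map m W g t \<in> {pure_tensor m W xs \<ominus>\<^bsub>tensor_power m W\<^esub> pure_tensor m W (permute_list \<sigma> xs) | xs \<sigma>.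
      xs \<in> tuples m W \<and> \<sigma> permutes {..<m}}"
    if t: "t \<in> {pure_tensor m V xs \<ominus>\<^bsub>tensor_power m V\<^esub> pure_tensor m V (permute_list \<sigma> xs) | xs \<sigma>.
      xs \<in> tuples m V \<and> \<sigma> permutes {..<m}}" for t
  proof -
    obtain xs \<sigma> where xs: "xs \<in> tuples m V" "\<sigma> permutes {..<m}"
      "t = pure_tensor m V xs \<ominus>\<^bsub>tensor_power m V\<^esub> pure_tensor m V (permute_list \<sigma> xs)"
      using t by blast
    have "tensor_map m W g t = pure_tensor m W (map g xs) \<ominus>\<^bsub>tensor_power m W\<^esub>
        pure_tensor m W (permute_list \<sigma> (map g xs))"
      using xs by (simp add: lin_maps_minus[OF tensor_map_lin_maps[OF V W g] kmod_tensor[OF V] kmod_tensor[OF W]]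
          pure_closed[OF V] tensor_map_pure[OF V W g] tuples_permute permute_list_map tuples_length)
    then show ?thesis
      using xs(2) tuples_map[OF xs(1) g] by blast
  qed
  note * = V W g sym_gens_subset[OF V] sym_gens_subset[OF W] this
  show "Sym_map m W g \<in> lin_maps (Sym m V) (Sym m W)"
    unfolding Sym_map_def Sym_def sym_kernel_def using * by (rule quot_tensor_map_lin_maps)
  show "Sym_map m W g (sym_prod m V xs) = sym_prod m W (map g xs)" if "xs \<in> tuples m V"
    unfolding Sym_map_def sym_prod_def sym_kernel_def using * that by (rule quot_tensor_map_pure)
qed

lemma
  assumes V: "kmod V" and W: "kmod W" and g: "g \<in> lin_maps V W"
  shows Ext_map_lin_maps: "Ext_map m W g \<in> lin_maps (Ext m V) (Ext m W)"
    and Ext_map_prod: "xs \<in> tuples m V \<Longrightarrow> Ext_map m W g (ext_prod m V xs) = ext_prod m W (map g xs)"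
proof -
  have "tensor_map m W g t \<in> {pure_tensor m W xs | xs. xs \<in> tuples m W \<and> \<not> distinct xs}"
    if t: "t \<in> {pure_tensor m V xs | xs. xs \<in> tuples m V \<and> \<not> distinct xs}" for t
  proof -
    obtain xs where xs: "xs \<in> tuples m V" "\<not> distinct xs" "t = pure_tensor m V xs"
      using t by blast
    then have "tensor_map m W g t = pure_tensor m W (map g xs)" "\<not> distinct (map g xs)"
      by (simp_all add: tensor_map_pure[OF V W g] distinct_map)
    then show ?thesis
      using tuples_map[OF xs(1) g] by blast
  qed
  note * = V W g ext_gens_subset[OF V] ext_gens_subset[OF W] this
  show "Ext_map m W g \<in> lin_maps (Ext m V) (Ext m W)"
    unfolding Ext_map_def Ext_def ext_kernel_def using * by (rule quot_tensor_map_lin_maps)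
  show "Ext_map m W g (ext_prod m V xs) = ext_prod m W (map g xs)" if "xs \<in> tuples m V"
    unfolding Ext_map_def ext_prod_def ext_kernel_def using * that by (rule quot_tensor_map_pure)
qed

lemma quot_form_Sym_map:
  assumes V: "kmod V" and W: "kmod W" and g: "g \<in> lin_maps V W"
    and h: "multilin m W h" "symmetric m W h" and h': "multilin m V h'" "symmetric m V h'"
    and eq: "\<And>xs. xs \<in> tuples m V \<Longrightarrow> h (map g xs) = h' xs" and y: "y \<in> carrier (Sym m V)"
  shows "quot_form h (Sym_map m W g y) = quot_form h' y"
proof (rule lin_form_eqI[OF lin_form_comp[OF lin_form_sym[OF W h] Sym_map_lin_maps[OF V W g]]
      lin_form_sym[OF V h'] generates_sym_prod_tuples[OF V] kmod_Sym[OF V] _ y])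
  show "quot_form h (Sym_map m W g y) = quot_form h' y" if "y \<in> sym_prod m V ` tuples m V" for y
    using that g eq
    by (auto simp: quot_form_prod[OF V h'] quot_form_prod[OF W h] Sym_map_prod[OF V W g] tuples_map)
qed

lemma quot_form_Ext_map:
  assumes V: "kmod V" and W: "kmod W" and g: "g \<in> lin_maps V W"
    and h: "multilin m W h" "alternating m W h" and h': "multilin m V h'" "alternating m V h'"
    and eq: "\<And>xs. xs \<in> tuples m V \<Longrightarrow> h (map g xs) = h' xs" and y: "y \<in> carrier (Ext m V)"
  shows "quot_form h (Ext_map m W g y) = quot_form h' y"
proof (rule lin_form_eqI[OF lin_form_comp[OF lin_form_ext[OF W h] Ext_map_lin_maps[OF V W g]]
      lin_form_ext[OF V h'] generates_ext_prod_tuples[OF V] kmod_Ext[OF V] _ y])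
  show "quot_form h (Ext_map m W g y) = quot_form h' y" if "y \<in> ext_prod m V ` tuples m V" for y
    using that g eq
    by (auto simp: ext_form_prod[OF V h'] ext_form_prod[OF W h] Ext_map_prod[OF V W g] tuples_map)
qed

subsection \<open>Digit sums\<close>

text \<open>The number with base \<open>N\<close> digits \<open>as\<close>, lowest digit first. It
  is the exponent of the monomial with exponent list \<open>as\<close> after the \<open>i\<close>-th
  variable is replaced by \<open>X ^ (N ^ i)\<close>.\<close>

definition digits :: "nat \<Rightarrow> nat list \<Rightarrow> nat" where
  "digits N as = (\<Sum>i<length as. as ! i * N ^ i)"

lemma digits_Nil [simp]: "digits N [] = 0"
  by (simp add: digits_def)

lemma digits_Cons [simp]: "digits N (a # as) = a + N * digits N as"
  by (simp add: digits_def sum.lessThan_Suc_shift sum_distrib_left ac_simps del: sum.lessThan_Suc)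

lemma digits_inj:
  "\<lbrakk>length as = length bs; set as \<subseteq> {..<N}; set bs \<subseteq> {..<N}; digits N as = digits N bs\<rbrakk> \<Longrightarrow> as = bs"
proof (induction as bs rule: list_induct2)
  case (Cons a as b bs)
  then have lt: "a < N" "b < N" and eq: "a + N * digits N as = b + N * digits N bs"
    by auto
  have "a = b"
    using arg_cong[OF eq, of "\<lambda>k. k mod N"] lt by simp
  then show ?case
    using Cons lt eq by auto
qed simp

lemma digits_permute:
  assumes "\<sigma> permutes {..<length as}"
  shows "digits N (permute_list \<sigma> as) = (\<Sum>i<length as. as ! i * N ^ (inv_into UNIV \<sigma> i))"
proof -
  have "digits N (permute_list \<sigma> as) = (\<Sum>i<length as. as ! \<sigma> i * N ^ i)"
    using assms by (simp add: digits_def permute_list_nth)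
  also have "\<dots> = (\<Sum>i<length as. as ! \<sigma> (inv_into UNIV \<sigma> i) * N ^ (inv_into UNIV \<sigma> i))"
    using sum.permute[OF permutes_inv[OF assms], of "\<lambda>i. as ! \<sigma> i * N ^ i"] by simp
  finally show ?thesis
    using permutes_inverses[OF assms] by simp
qed

lemma swap_mult_less:
  assumes "a < b" "c < (d::nat)"
  shows "a * d + b * c < a * c + b * d"
proof -
  obtain k l where "b = a + k" "0 < k" "d = c + l" "0 < l"
    using assms less_imp_add_positive by metis
  then show ?thesis
    by (simp add: algebra_simps)
qed

text \<open>The two-term rearrangement inequality: moving the larger digit to the larger weight
  increases the sum. The bound \<open>2 \<le> N\<close> makes the weights strictly
  increasing.\<close>

lemma digits_swap_less:
  assumes ij: "i < j" "j < length as" "as ! j < as ! i" and N: "2 \<le> N"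
  shows "digits N as < digits N (permute_list (Transposition.transpose i j) as)"
proof -
  let ?t = "Transposition.transpose i j" and ?R = "{..<length as} - {i} - {j}"
  have t: "?t permutes {..<length as}"
    using ij by (intro permutes_swap_id) auto
  have split: "(\<Sum>k<length as. f k) = f i + (f j + (\<Sum>k\<in>?R. f k))" for f :: "nat \<Rightarrow> nat"
    using ij by (simp add: sum.remove[of _ i] sum.remove[of _ j])
  have "N ^ i < N ^ j"
    using ij N by (intro power_strict_increasing) auto
  then have "as ! i * N ^ i + as ! j * N ^ j < as ! i * N ^ j + as ! j * N ^ i"
    using swap_mult_less[OF ij(3)] by (simp add: add.commute)
  then show ?thesis
    unfolding digits_permute[OF t] unfolding digits_def split by simp
qed

lemma not_sorted_swap:
  assumes "\<not> sorted (as :: nat list)" "2 \<le> N"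
  obtains i j where "i < j" "j < length as" "as ! j < as ! i"
    "digits N as < digits N (permute_list (Transposition.transpose i j) as)"
  using assms digits_swap_less unfolding sorted_iff_nth_mono_less by (meson not_le)

text \<open>A rearrangement with the largest value has no inversion, as swapping one would increase
  the value. Hence it is sorted, and there is only one sorted rearrangement.\<close>

lemma digits_le_sorted:
  assumes "sorted as" "mset bs = mset as" "2 \<le> N"
  shows "digits N bs \<le> digits N as"
proof -
  let ?S = "{cs. mset cs = mset as}"
  have fin: "finite (digits N ` ?S)"
    by (intro finite_imageI finite_subset[OF _ finite_lists_length_eq[OF finite_set[of as], of "length as"]])
      (auto dest: mset_eq_setD mset_eq_length)
  moreover have "digits N ` ?S \<noteq> {}"
    by auto
  ultimately have "Max (digits N ` ?S) \<in> digits N ` ?S"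
    by (rule Max_in)
  then obtain c where c: "mset c = mset as" "digits N c = Max (digits N ` ?S)"
    by auto
  have max: "digits N d \<le> digits N c" if "mset d = mset as" for d
    unfolding c(2) using fin that by (intro Max_ge) auto
  have "sorted c"
  proof (rule ccontr)
    assume "\<not> sorted c"
    then obtain i j where ij: "i < j" "j < length c"
      "digits N c < digits N (permute_list (Transposition.transpose i j) c)"
      using assms(3) by (rule not_sorted_swap)
    have "mset (permute_list (Transposition.transpose i j) c) = mset as"
      using c(1) ij by (subst mset_permute_list) (auto intro: permutes_swap_id)
    then show False
      using max ij(3) by (meson leD)
  qed
  then have "c = as"
    using assms(1) c(1) by (metis properties_for_sort)
  then show ?thesis
    using max assms(2) by simp
qed

text \<open>With distinct entries a nontrivial permutation changes the list, and by uniqueness of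
  base \<open>N\<close> digits also the number, so the inequality for sorted lists becomes
  strict.\<close>

lemma digits_permute_less:
  assumes as: "sorted as" "distinct as" "set as \<subseteq> {..<N}" "2 \<le> N"
    and \<sigma>: "\<sigma> permutes {..<length as}" "\<sigma> \<noteq> id"
  shows "digits N (permute_list \<sigma> as) < digits N as"
proof -
  have "permute_list \<sigma> as \<noteq> as"
  proof
    assume eq: "permute_list \<sigma> as = as"
    have "\<sigma> i = i" for i
    proof (cases "i < length as")
      case True
      then have "as ! \<sigma> i = as ! i" "\<sigma> i < length as"
        using eq permute_list_nth[OF \<sigma>(1) True] permutes_in_image[OF \<sigma>(1), of i] by auto
      then show ?thesis
        using as(2) True by (simp add: nth_eq_iff_index_eq)
    qed (use \<sigma>(1) in \<open>simp add: permutes_def\<close>)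
    then show False
      using \<sigma>(2) by auto
  qed
  then have "digits N (permute_list \<sigma> as) \<noteq> digits N as"
    using digits_inj[of "permute_list \<sigma> as" as N] as \<sigma>(1) by auto
  moreover have "digits N (permute_list \<sigma> as) \<le> digits N as"
    using as \<sigma>(1) by (intro digits_le_sorted) auto
  ultimately show ?thesis
    by simp
qed

subsection \<open>The homogeneous Vandermonde determinant\<close>

text \<open>Each term of the Leibniz expansion takes one entry from every column and so picks up
  every factor \<open>c j\<close> once.\<close>

lemma det_scale_columns:
  fixes f :: "nat \<Rightarrow> nat \<Rightarrow> 'a::comm_ring_1"
  shows "det (mat n n (\<lambda>(i, j). f i j * c j)) = det (mat n n (\<lambda>(i, j). f i j)) * (\<Prod>j<n. c j)"
proof -
  have "(\<Prod>i = 0..<n. mat n n (\<lambda>(i, j). f i j * c j) $$ (i, p i)) =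
      (\<Prod>i = 0..<n. mat n n (\<lambda>(i, j). f i j) $$ (i, p i)) * (\<Prod>j<n. c j)" if p: "p permutes {0..<n}" for p
  proof -
    have "p i < n" if "i < n" for i
      using permutes_in_image[OF p, of i] that by auto
    then have "(\<Prod>i = 0..<n. mat n n (\<lambda>(i, j). f i j * c j) $$ (i, p i)) =
        (\<Prod>i = 0..<n. mat n n (\<lambda>(i, j). f i j) $$ (i, p i)) * (\<Prod>i = 0..<n. c (p i))"
      by (simp add: prod.distrib)
    also have "(\<Prod>i = 0..<n. c (p i)) = (\<Prod>j<n. c j)"
      using prod.permute[OF p, of c] by (simp add: atLeast0LessThan comp_def)
    finally show ?thesis .
  qed
  then show ?thesis
    by (simp add: det_def'[of _ n] sum_distrib_right mult.assoc)
qed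

text \<open>The homogeneous form, with pairs \<open>x j\<close>, \<open>y j\<close> in place of
  quotients, is needed because a linear form may vanish on a basis vector. The induction clears the
  last column.\<close>

lemma det_vandermonde:
  fixes x y :: "nat \<Rightarrow> 'a::idom"
  shows "det (mat m m (\<lambda>(i, j). x j ^ (m - 1 - i) * y j ^ i)) = (\<Prod>j<m. \<Prod>i<j. x i * y j - x j * y i)"
proof (induction m)
  case 0
  then show ?case
    by (simp add: det_dim_zero)
next
  case (Suc m)
  define V where "V = mat (Suc m) (Suc m) (\<lambda>(i, j). x j ^ (m - i) * y j ^ i)"
  define v where "v = (\<lambda>i j. x j ^ (m - 1 - i) * y j ^ i)"
  have V: "V \<in> carrier_mat (Suc m) (Suc m)"
    by (simp add: V_def)
  have IH: "det (mat m m (\<lambda>(i, j). v i j)) = (\<Prod>j<m. \<Prod>i<j. x i * y j - x j * y i)"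
    using Suc.IH by (simp add: v_def)
  have pow: "x j ^ (m - i) = x j ^ (m - 1 - i) * x j" if "i < m" for i j
  proof -
    have "m - i = Suc (m - 1 - i)"
      using that by simp
    then show ?thesis
      by (simp only: power_Suc2)
  qed
  have "det V = (\<Prod>i<m. x i * y m - x m * y i) * det (mat m m (\<lambda>(i, j). v i j))"
  proof (cases "y m = 0")
    case True
    \<comment> \<open>Only the top entry \<open>x m ^ m\<close> of the last column is left. The sign
      of its cofactor turns it into \<open>(- x m) ^ m\<close>, one sign for each remaining factor
      \<open>- x m * y i\<close>.\<close>
    have "det V = (\<Sum>i<Suc m. V $$ (i, m) * cofactor V i m)"
      using V by (intro laplace_expansion_column) auto
    also have "\<dots> = (\<Sum>i\<in>{0}. V $$ (i, m) * cofactor V i m)"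
      by (rule sum.mono_neutral_right) (auto simp: V_def True)
    also have "\<dots> = x m ^ m * (-1) ^ m * det (mat_delete V 0 m)"
      by (simp add: V_def True cofactor_def)
    also have "mat_delete V 0 m = mat m m (\<lambda>(i, j). v i j * y j)"
      by (rule eq_matI) (auto simp: mat_delete_def V_def v_def)
    also have "det \<dots> = det (mat m m (\<lambda>(i, j). v i j)) * (\<Prod>j<m. y j)"
      by (rule det_scale_columns)
    finally have "det V = (- x m) ^ m * (\<Prod>j<m. y j) * det (mat m m (\<lambda>(i, j). v i j))"
      by (simp add: power_minus[of "x m"] mult_ac)
    also have "(- x m) ^ m * (\<Prod>j<m. y j) = (\<Prod>j<m. - x m * y j)"
      by (simp add: prod.distrib del: mult_minus_left)
    finally show ?thesis
      by (simp add: True)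
  next
    case False
    \<comment> \<open>\<open>T * V\<close> combines neighbouring rows so that only the last entry of the last column survives.\<close>
    define T where "T = mat (Suc m) (Suc m)
      (\<lambda>(i, j). if j = i then (if i < m then y m else 1) else if j = Suc i then - x m else 0)"
    have T: "T \<in> carrier_mat (Suc m) (Suc m)"
      by (simp add: T_def)
    have "upper_triangular T"
      by (auto simp: T_def)
    then have "det T = prod_list (diag_mat T)"
      using T by (rule det_upper_triangular)
    also have "\<dots> = (\<Prod>i<Suc m. T $$ (i, i))"
      unfolding diag_mat_def prod.list_conv_set_nth using T by (intro prod.cong) (auto simp del: upt_Suc)
    also have "\<dots> = y m ^ m"
      by (simp add: T_def)
    finally have detT: "det T = y m ^ m" .
    define W where "W = T * V"
    have W: "W \<in> carrier_mat (Suc m) (Suc m)"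
      using T V by (simp add: W_def)
    have TV: "W $$ (i, j) = (if i < m then v i j * (x j * y m - x m * y j) else y j ^ m)"
      if ij: "i < Suc m" "j < Suc m" for i j
    proof -
      have "W $$ (i, j) = (\<Sum>k<Suc m. T $$ (i, k) * V $$ (k, j))"
        using ij T V by (simp add: W_def scalar_prod_def atLeast0LessThan)
      also have "\<dots> = (\<Sum>k\<in>(if i < m then {i, Suc i} else {i}). T $$ (i, k) * V $$ (k, j))"
        using ij by (intro sum.mono_neutral_right) (auto simp: T_def)
      also have "\<dots> = (if i < m then v i j * (x j * y m - x m * y j) else y j ^ m)"
        using ij pow[of i j] less_SucE[OF ij(1)]
        by (cases "i = m") (auto simp: T_def V_def v_def algebra_simps)
      finally show ?thesis .
    qed
    have "det W = (\<Sum>i<Suc m. W $$ (i, m) * cofactor W i m)"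
      using W by (intro laplace_expansion_column) auto
    also have "\<dots> = (\<Sum>i\<in>{m}. W $$ (i, m) * cofactor W i m)"
      by (rule sum.mono_neutral_right) (auto simp: TV)
    also have "\<dots> = y m ^ m * det (mat_delete W m m)"
      by (simp add: TV cofactor_def power_add[symmetric] flip: mult_2)
    also have "mat_delete W m m = mat m m (\<lambda>(i, j). v i j * (x j * y m - x m * y j))"
      using W by (intro eq_matI) (auto simp: mat_delete_def TV)
    also have "det \<dots> = det (mat m m (\<lambda>(i, j). v i j)) * (\<Prod>j<m. x j * y m - x m * y j)"
      by (rule det_scale_columns)
    finally have "y m ^ m * det V = y m ^ m * (det (mat m m (\<lambda>(i, j). v i j)) * (\<Prod>j<m. x j * y m - x m * y j))"
      using det_mult[OF T V] by (simp add: detT W_def)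
    \<comment> \<open>The factor \<open>y m ^ m\<close>, the determinant of \<open>T\<close>, is
      cancelled in the domain; hence the separate case \<open>y m = 0\<close>.\<close>
    then show ?thesis
      using False by (simp add: mult.commute)
  qed
  then show ?case
    by (simp add: V_def IH mult.commute)
qed

subsection \<open>Degrees\<close>

text \<open>Among the summands with nonzero coefficient, the one of highest degree is alone in its
  degree, so its leading term cannot cancel.\<close>

lemma degree_sum_distinct:
  fixes f :: "'s \<Rightarrow> 'k::field poly"
  assumes P: "finite P" "inj_on (\<lambda>s. degree (f s)) P" "\<And>s. s \<in> P \<Longrightarrow> f s \<noteq> 0"
    and c: "\<exists>s\<in>P. c s \<noteq> 0"
  shows "\<exists>s\<in>P. c s \<noteq> 0 \<and> (\<Sum>s\<in>P. Polynomial.smult (c s) (f s)) \<noteq> 0 \<and>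
    degree (\<Sum>s\<in>P. Polynomial.smult (c s) (f s)) = degree (f s)"
proof -
  let ?Q = "{s\<in>P. c s \<noteq> 0}" and ?F = "\<Sum>s\<in>P. Polynomial.smult (c s) (f s)"
  have "finite ((\<lambda>s. degree (f s)) ` ?Q)" "(\<lambda>s. degree (f s)) ` ?Q \<noteq> {}"
    using P c by auto
  from Max_in[OF this] obtain s where s: "s \<in> P" "c s \<noteq> 0" "degree (f s) = Max ((\<lambda>s. degree (f s)) ` ?Q)"
    by auto
  have le: "degree (f t) \<le> degree (f s)" if "t \<in> P" "c t \<noteq> 0" for t
    unfolding s(3) using that P by (intro Max_ge) auto
  have "coeff ?F (degree (f s)) = (\<Sum>t\<in>P. c t * coeff (f t) (degree (f s)))"
    by (simp add: coeff_sum)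
  also have "\<dots> = (\<Sum>t\<in>{s}. c t * coeff (f t) (degree (f s)))"
  proof (rule sum.mono_neutral_right)
    show "\<forall>t\<in>P - {s}. c t * coeff (f t) (degree (f s)) = 0"
    proof
      fix t assume t: "t \<in> P - {s}"
      then have "degree (f t) \<noteq> degree (f s)"
        using P(2) s(1) by (auto dest: inj_onD)
      then show "c t * coeff (f t) (degree (f s)) = 0"
        using le[of t] t by (cases "c t = 0") (auto intro: coeff_eq_0)
    qed
  qed (use P s in auto)
  also have "\<dots> \<noteq> 0"
    by (simp add: s(2) P(3)[OF s(1)])
  finally have nz: "coeff ?F (degree (f s)) \<noteq> 0" .
  have "degree ?F \<le> degree (f s)"
    using P le by (intro degree_sum_le) (auto intro: order_trans[OF degree_smult_le])
  then have "degree ?F = degree (f s)"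
    using le_degree[OF nz] by simp
  then show ?thesis
    using s nz by (intro bexI[of _ s]) auto
qed

lemma generates_finsum:
  assumes M: "kmod M" and P: "finite P" and G: "generates M (s ` P)" and x: "x \<in> carrier M"
  shows "\<exists>c. x = finsum M (\<lambda>l. c l \<odot>\<^bsub>M\<^esub> s l) P"
  using G x
proof (rule generates_induct)
  interpret Module.module class_ring M by (rule M)
  have s: "s l \<in> carrier M" if "l \<in> P" for l
    using G that by (auto simp: generates_def)
  note [simp] = s M
  show "\<exists>c. \<zero>\<^bsub>M\<^esub> = (\<Oplus>\<^bsub>M\<^esub>l\<in>P. c l \<odot>\<^bsub>M\<^esub> s l)"
    by (intro exI[of _ "\<lambda>_. 0"]) (simp add: M.add.finprod_one_eqI)
  fix g assume "g \<in> s ` P"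
  then obtain l where l: "l \<in> P" "g = s l" by auto
  have "(\<Oplus>\<^bsub>M\<^esub>k\<in>P. (if k = l then 1 else 0) \<odot>\<^bsub>M\<^esub> s k) = (\<Oplus>\<^bsub>M\<^esub>k\<in>P. if l = k then s k else \<zero>\<^bsub>M\<^esub>)"
    by (rule M.add.finprod_cong') auto
  also have "\<dots> = g"
    using M.add.finprod_singleton[OF l(1) P, of s] l by auto
  finally show "\<exists>c. g = (\<Oplus>\<^bsub>M\<^esub>l\<in>P. c l \<odot>\<^bsub>M\<^esub> s l)"
    by (intro exI[of _ "\<lambda>k. if k = l then 1 else 0"]) simp
next
  interpret Module.module class_ring M by (rule M)
  have s: "s l \<in> carrier M" if "l \<in> P" for l
    using G that by (auto simp: generates_def)
  note [simp] = s M
  show "\<exists>e. x \<oplus>\<^bsub>M\<^esub> y = (\<Oplus>\<^bsub>M\<^esub>l\<in>P. e l \<odot>\<^bsub>M\<^esub> s l)"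
    if xy: "\<exists>c. x = (\<Oplus>\<^bsub>M\<^esub>l\<in>P. c l \<odot>\<^bsub>M\<^esub> s l)" "\<exists>d. y = (\<Oplus>\<^bsub>M\<^esub>l\<in>P. d l \<odot>\<^bsub>M\<^esub> s l)" for x y
  proof -
    from xy obtain c d where cd: "x = (\<Oplus>\<^bsub>M\<^esub>l\<in>P. c l \<odot>\<^bsub>M\<^esub> s l)" "y = (\<Oplus>\<^bsub>M\<^esub>l\<in>P. d l \<odot>\<^bsub>M\<^esub> s l)"
      by auto
    have "x \<oplus>\<^bsub>M\<^esub> y = (\<Oplus>\<^bsub>M\<^esub>l\<in>P. c l \<odot>\<^bsub>M\<^esub> s l \<oplus>\<^bsub>M\<^esub> d l \<odot>\<^bsub>M\<^esub> s l)"
      unfolding cd by (rule M.finsum_addf[symmetric]) auto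
    also have "\<dots> = (\<Oplus>\<^bsub>M\<^esub>l\<in>P. (c l + d l) \<odot>\<^bsub>M\<^esub> s l)"
      by (rule M.add.finprod_cong') (auto simp: kmod_add_smult[OF M])
    finally show ?thesis by (rule exI[of _ "\<lambda>l. c l + d l"])
  qed
  show "\<exists>d. c \<odot>\<^bsub>M\<^esub> x = (\<Oplus>\<^bsub>M\<^esub>l\<in>P. d l \<odot>\<^bsub>M\<^esub> s l)"
    if x: "\<exists>d. x = (\<Oplus>\<^bsub>M\<^esub>l\<in>P. d l \<odot>\<^bsub>M\<^esub> s l)" for c x
  proof -
    from x obtain d where d: "x = (\<Oplus>\<^bsub>M\<^esub>l\<in>P. d l \<odot>\<^bsub>M\<^esub> s l)" by auto
    have "c \<odot>\<^bsub>M\<^esub> x = (\<Oplus>\<^bsub>M\<^esub>l\<in>P. c \<odot>\<^bsub>M\<^esub> (d l \<odot>\<^bsub>M\<^esub> s l))"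
      unfolding d using P by (intro finsum_smult_ldistr) auto
    also have "\<dots> = (\<Oplus>\<^bsub>M\<^esub>l\<in>P. (c * d l) \<odot>\<^bsub>M\<^esub> s l)"
      by (rule M.add.finprod_cong') (auto simp: kmod_smult_assoc[OF M])
    finally show ?thesis by (rule exI[of _ "\<lambda>l. c * d l"])
  qed
qed (rule M)

lemma lin_form_finsum:
  assumes M: "kmod M" and P: "finite P" and s: "\<And>l. l \<in> P \<Longrightarrow> s l \<in> carrier M" and f: "lin_form M f"
  shows "f (finsum M (\<lambda>l. c l \<odot>\<^bsub>M\<^esub> s l) P) = (\<Sum>l\<in>P. Polynomial.smult (c l) (f (s l)))"
proof -
  interpret Module.module class_ring M by (rule M)
  show ?thesis
    using P s
  proof (induction P)
    case (insert l P)
    then have "(\<Oplus>\<^bsub>M\<^esub>l\<in>insert l P. c l \<odot>\<^bsub>M\<^esub> s l) = c l \<odot>\<^bsub>M\<^esub> s l \<oplus>\<^bsub>M\<^esub> (\<Oplus>\<^bsub>M\<^esub>l\<in>P. c l \<odot>\<^bsub>M\<^esub> s l)"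
      using M by (intro M.finsum_insert) auto
    moreover have "(\<Oplus>\<^bsub>M\<^esub>l\<in>P. c l \<odot>\<^bsub>M\<^esub> s l) \<in> carrier M"
      using insert M by (intro M.finsum_closed) auto
    ultimately show ?case
      using insert f M by (simp add: lin_form_add lin_form_smult)
  qed (simp add: lin_form_zero[OF f M])
qed

text \<open>Since values of pairwise different degrees cannot cancel, a single form \<open>f\<close>
  proves the generators independent and reveals all degrees it can take.\<close>

lemma
  assumes M: "kmod M" and P: "finite P" and G: "generates M (s ` P)" and f: "lin_form M f"
    and nz: "\<And>l. l \<in> P \<Longrightarrow> f (s l) \<noteq> 0" and inj: "inj_on (\<lambda>l. degree (f (s l))) P"
    and x: "x \<in> carrier M"
  shows lin_form_degree_inj: "f x = 0 \<Longrightarrow> x = \<zero>\<^bsub>M\<^esub>"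
    and lin_form_degree: "f x \<noteq> 0 \<Longrightarrow> \<exists>l\<in>P. degree (f x) = degree (f (s l))"
proof -
  interpret Module.module class_ring M by (rule M)
  have s: "s l \<in> carrier M" if "l \<in> P" for l
    using G that by (auto simp: generates_def)
  obtain c where c: "x = finsum M (\<lambda>l. c l \<odot>\<^bsub>M\<^esub> s l) P"
    using generates_finsum[OF M P G x] by blast
  have fx: "f x = (\<Sum>l\<in>P. Polynomial.smult (c l) (f (s l)))"
    unfolding c using M P s f by (rule lin_form_finsum)
  show "\<exists>l\<in>P. degree (f x) = degree (f (s l))" if "f x \<noteq> 0"
  proof -
    have "\<exists>l\<in>P. c l \<noteq> 0"
      using that fx by (metis (no_types, lifting) smult_0_left sum.neutral)
    from degree_sum_distinct[OF P inj nz this] show ?thesis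
      using fx by auto
  qed
  show "x = \<zero>\<^bsub>M\<^esub>" if "f x = 0"
  proof -
    have "c l = 0" if "l \<in> P" for l
      using degree_sum_distinct[OF P inj nz, of c] fx \<open>f x = 0\<close> that by metis
    then show ?thesis
      unfolding c using s M by (intro M.add.finprod_one_eqI) auto
  qed
qed

text \<open>Gaussian elimination by degree: a multiple of an element of \<open>N\<close> cancels the
  leading term of \<open>f x\<close>, and the degree drops. This turns an equality of sets of
  degrees into an equality of images.\<close>

lemma echelon:
  assumes M: "kmod M" and f: "lin_form M f" and N: "subsp M N"
    and deg: "\<And>x. \<lbrakk>x \<in> carrier M; f x \<noteq> 0\<rbrakk> \<Longrightarrow> \<exists>y\<in>N. f y \<noteq> 0 \<and> degree (f y) = degree (f x)"
    and x: "x \<in> carrier M"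
  shows "\<exists>y\<in>N. f y = f x"
  using x
\<comment> \<open>The zero polynomial has degree 0 like the nonzero constants, so it gets a smaller
  measure of its own.\<close>
proof (induction "if f x = 0 then 0 else Suc (degree (f x))" arbitrary: x rule: less_induct)
  case less
  show ?case
  proof (cases "f x = 0")
    case True
    then show ?thesis
      using subsp_zero[OF N] lin_form_zero[OF f M] by metis
  next
    case False
    then obtain y where y: "y \<in> N" "f y \<noteq> 0" "degree (f y) = degree (f x)"
      using deg less.prems by blast
    define c where "c = lead_coeff (f x) / lead_coeff (f y)"
    let ?z = "x \<ominus>\<^bsub>M\<^esub> c \<odot>\<^bsub>M\<^esub> y"
    have yM: "y \<in> carrier M"
      using subsp_carrier[OF N y(1)] .
    have fz: "f ?z = f x - Polynomial.smult c (f y)"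
      using f M yM less.prems by (simp add: lin_form_minus lin_form_smult)
    have c0: "coeff (f ?z) (degree (f x)) = 0"
    proof -
      have "coeff (f y) (degree (f x)) \<noteq> 0"
        using y(2) by (simp flip: y(3))
      then show ?thesis
        unfolding fz by (simp add: c_def y(3))
    qed
    have "degree (f ?z) \<le> degree (f x)"
      unfolding fz using y by (intro degree_diff_le) (auto intro: order_trans[OF degree_smult_le])
    then have lt: "f ?z = 0 \<or> degree (f ?z) < degree (f x)"
      using c0 by (metis leading_coeff_0_iff le_neq_implies_less)
    have "\<exists>w\<in>N. f w = f ?z"
      using lt False M yM less.prems by (intro less.hyps) auto
    then obtain w where w: "w \<in> N" "f w = f ?z"
      by blast
    have "f (w \<oplus>\<^bsub>M\<^esub> c \<odot>\<^bsub>M\<^esub> y) = f x"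
      using f M yM subsp_carrier[OF N w(1)] by (simp add: lin_form_add lin_form_smult w fz)
    then show ?thesis
      using subsp_add[OF N w(1) subsp_smult[OF N y(1)]] by blast
  qed
qed

subsection \<open>Evaluation at tuples of linear forms\<close>

definition pform :: "nat \<Rightarrow> (nat \<Rightarrow> 'v \<Rightarrow> 'k::field poly) \<Rightarrow> 'v list \<Rightarrow> 'k poly" where
  "pform m f xs = (\<Prod>i<m. f i (xs ! i))"

text \<open>Rows belong to vectors and columns to forms: equal vectors give equal rows, while the
  Leibniz expansion permutes the forms and leaves the vectors in place.\<close>

definition dform :: "nat \<Rightarrow> (nat \<Rightarrow> 'v \<Rightarrow> 'k::field poly) \<Rightarrow> 'v list \<Rightarrow> 'k poly" where
  "dform m f xs = det (mat m m (\<lambda>(i, j). f j (xs ! i)))"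

lemma multilin_pform:
  assumes f: "\<And>i. i < m \<Longrightarrow> lin_form V (f i)"
  shows "multilin m V (pform m f)"
proof -
  have update: "pform m f (xs[i := x]) = f i x * (\<Prod>j\<in>{..<m} - {i}. f j (xs ! j))"
    if "xs \<in> tuples m V" "i < m" for xs i x
  proof -
    have "pform m f (xs[i := x]) = f i (xs[i := x] ! i) * (\<Prod>j\<in>{..<m} - {i}. f j (xs[i := x] ! j))"
      unfolding pform_def using that by (intro prod.remove) auto
    also have "(\<Prod>j\<in>{..<m} - {i}. f j (xs[i := x] ! j)) = (\<Prod>j\<in>{..<m} - {i}. f j (xs ! j))"
      by (rule prod.cong) auto
    finally show ?thesis
      using that by (simp add: tuples_length)
  qed
  show ?thesis
    by (rule multilinI) (simp_all add: update lin_form_add[OF f] lin_form_smult[OF f] distrib_right)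
qed

lemma multilin_mult: "multilin m V h \<Longrightarrow> multilin m V (\<lambda>xs. p * h xs)"
  unfolding multilin_def by (simp add: distrib_left)

lemma multilin_sum: "(\<And>s. s \<in> A \<Longrightarrow> multilin m V (h s)) \<Longrightarrow> multilin m V (\<lambda>xs. \<Sum>s\<in>A. h s xs)"
  unfolding multilin_def by (simp add: sum.distrib smult_sum_right)

text \<open>The Leibniz expansion exhibits the determinant as a signed sum of products of forms,
  from which multilinearity is inherited.\<close>

lemma dform_eq:
  "dform m f xs = (\<Sum>\<sigma> | \<sigma> permutes {..<m}. signof \<sigma> * pform m (\<lambda>i. f (\<sigma> i)) xs)"
proof -
  have eq: "(\<Prod>i = 0..<m. mat m m (\<lambda>(i, j). f j (xs ! i)) $$ (i, \<sigma> i)) = pform m (\<lambda>i. f (\<sigma> i)) xs"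
    if \<sigma>: "\<sigma> permutes {..<m}" for \<sigma>
  proof -
    have "\<sigma> i < m" if "i < m" for i
      using permutes_in_image[OF \<sigma>, of i] that by simp
    then show ?thesis
      unfolding pform_def atLeast0LessThan by simp
  qed
  have "dform m f xs = (\<Sum>\<sigma> | \<sigma> permutes {..<m}.
      signof \<sigma> * (\<Prod>i = 0..<m. mat m m (\<lambda>(i, j). f j (xs ! i)) $$ (i, \<sigma> i)))"
    unfolding dform_def det_def'[OF mat_carrier] atLeast0LessThan by (rule refl)
  also have "\<dots> = (\<Sum>\<sigma> | \<sigma> permutes {..<m}. signof \<sigma> * pform m (\<lambda>i. f (\<sigma> i)) xs)"
    by (rule sum.cong) (simp_all only: mem_Collect_eq eq)
  finally show ?thesis .
qed

lemma multilin_dform: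
  assumes f: "\<And>i. i < m \<Longrightarrow> lin_form V (f i)"
  shows "multilin m V (dform m f)"
proof -
  have "multilin m V (\<lambda>xs. \<Sum>\<sigma> | \<sigma> permutes {..<m}. signof \<sigma> * pform m (\<lambda>i. f (\<sigma> i)) xs)"
  proof (intro multilin_sum multilin_mult multilin_pform)
    fix \<sigma> i assume "\<sigma> \<in> {\<sigma>. \<sigma> permutes {..<m}}" "i < m"
    then show "lin_form V (f (\<sigma> i))"
      using permutes_in_image[of \<sigma> "{..<m}" i] by (intro f) auto
  qed
  then show ?thesis
    by (simp add: dform_eq[abs_def])
qed

lemma alternating_dform: "alternating m V (dform m f)"
  unfolding alternating_def
proof (intro ballI impI)
  fix xs assume xs: "xs \<in> tuples m V" "\<not> distinct xs"
  then obtain i j where ij: "i < m" "j < m" "i \<noteq> j" "xs ! i = xs ! j"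
    by (auto simp: distinct_conv_nth tuples_length)
  show "dform m f xs = 0"
    unfolding dform_def by (rule det_identical_rows[OF _ ij(3,1,2)]) (use ij in \<open>auto intro!: eq_vecI\<close>)
qed

text \<open>Permuting the vectors amounts to permuting the forms by the inverse, by reindexing the
  product. Invariance of a tensor thus becomes symmetry in the points.\<close>

lemma pform_permute_list:
  assumes \<sigma>: "\<sigma> permutes {..<m}" and xs: "length xs = m"
  shows "pform m f (permute_list \<sigma> xs) = pform m (\<lambda>i. f (inv_into UNIV \<sigma> i)) xs"
proof -
  have "pform m f (permute_list \<sigma> xs) = (\<Prod>i<m. f i (xs ! \<sigma> i))"
    unfolding pform_def using assms by (simp add: permute_list_nth)
  also have "\<dots> = (\<Prod>i<m. f (inv_into UNIV \<sigma> i) (xs ! \<sigma> (inv_into UNIV \<sigma> i)))"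
    using prod.permute[OF permutes_inv[OF \<sigma>], of "\<lambda>i. f i (xs ! \<sigma> i)"] by simp
  finally show ?thesis
    using permutes_inverses[OF \<sigma>] by (simp add: pform_def)
qed

lemma symmetric_pform: "symmetric m V (pform m (\<lambda>_. f))"
  by (simp add: symmetric_def pform_permute_list tuples_length)

text \<open>For a plane, an element of the symmetric power is a binary form of degree
  \<open>n\<close>, and this is its value at the point with coordinates given by
  \<open>\<phi>\<close>.\<close>

definition sym_ev :: "nat \<Rightarrow> ('u \<Rightarrow> 'k::field poly) \<Rightarrow> ('u list \<Rightarrow>\<^sub>0 'k) set set \<Rightarrow> 'k poly" where
  "sym_ev n \<phi> = quot_form (pform n (\<lambda>_. \<phi>))"

definition tens_ev :: "nat \<Rightarrow> (nat \<Rightarrow> 'u \<Rightarrow> 'k::field poly) \<Rightarrow> ('u list \<Rightarrow>\<^sub>0 'k) set \<Rightarrow> 'k poly" where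
  "tens_ev m \<phi> = tens_form (pform m \<phi>)"

definition ext_ev :: "nat \<Rightarrow> (nat \<Rightarrow> 'u \<Rightarrow> 'k::field poly) \<Rightarrow> ('u list \<Rightarrow>\<^sub>0 'k) set set \<Rightarrow> 'k poly" where
  "ext_ev m \<phi> = quot_form (dform m \<phi>)"

lemma
  assumes V: "kmod V" and \<phi>: "lin_form V \<phi>"
  shows lin_form_sym_ev: "lin_form (Sym n V) (sym_ev n \<phi>)"
    and sym_ev_prod: "xs \<in> tuples n V \<Longrightarrow> sym_ev n \<phi> (sym_prod n V xs) = (\<Prod>i<n. \<phi> (xs ! i))"
proof -
  have h: "multilin n V (pform n (\<lambda>_. \<phi>))" "symmetric n V (pform n (\<lambda>_. \<phi>))"
    using \<phi> by (simp_all add: multilin_pform symmetric_pform)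
  show "lin_form (Sym n V) (sym_ev n \<phi>)"
    unfolding sym_ev_def using V h by (rule lin_form_sym)
  show "sym_ev n \<phi> (sym_prod n V xs) = (\<Prod>i<n. \<phi> (xs ! i))" if "xs \<in> tuples n V"
    unfolding sym_ev_def quot_form_prod[OF V h that] by (simp add: pform_def)
qed

lemma
  assumes V: "kmod V" and \<phi>: "\<And>i. i < m \<Longrightarrow> lin_form V (\<phi> i)"
  shows lin_form_tens_ev: "lin_form (tensor_power m V) (tens_ev m \<phi>)"
    and tens_ev_pure: "xs \<in> tuples m V \<Longrightarrow> tens_ev m \<phi> (pure_tensor m V xs) = (\<Prod>i<m. \<phi> i (xs ! i))"
    and lin_form_ext_ev: "lin_form (Ext m V) (ext_ev m \<phi>)"
    and ext_ev_prod: "xs \<in> tuples m V \<Longrightarrow> ext_ev m \<phi> (ext_prod m V xs) = dform m \<phi> xs"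
proof -
  have h: "multilin m V (pform m \<phi>)" "multilin m V (dform m \<phi>)" "alternating m V (dform m \<phi>)"
    using \<phi> by (simp_all add: multilin_pform multilin_dform alternating_dform)
  show "lin_form (tensor_power m V) (tens_ev m \<phi>)" "lin_form (Ext m V) (ext_ev m \<phi>)"
    unfolding tens_ev_def ext_ev_def using V h by (simp_all add: lin_form_tens lin_form_ext)
  show "tens_ev m \<phi> (pure_tensor m V xs) = (\<Prod>i<m. \<phi> i (xs ! i))" if "xs \<in> tuples m V"
    unfolding tens_ev_def tens_form_pure[OF V h(1) that] by (simp add: pform_def)
  show "ext_ev m \<phi> (ext_prod m V xs) = dform m \<phi> xs" if "xs \<in> tuples m V"
    unfolding ext_ev_def ext_form_prod[OF V h(2,3) that] by (rule refl)
qed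

lemma lin_form_tens_ev_Div:
  "\<lbrakk>kmod V; \<And>i. i < m \<Longrightarrow> lin_form V (\<phi> i)\<rbrakk> \<Longrightarrow> lin_form (Div m V) (tens_ev m \<phi>)"
  by (intro lin_form_Div lin_form_tens_ev)

text \<open>The pulled back form is a separate \<open>\<psi>\<close> because in nested uses it is
  itself an evaluation, which agrees with \<open>\<phi>\<close> after \<open>g\<close> only on the
  carrier.\<close>

lemma sym_ev_Sym_map:
  assumes "kmod V" "kmod W" "g \<in> lin_maps V W" "lin_form W \<phi>" "lin_form V \<psi>"
    and "\<And>x. x \<in> carrier V \<Longrightarrow> \<phi> (g x) = \<psi> x" "y \<in> carrier (Sym n V)"
  shows "sym_ev n \<phi> (Sym_map n W g y) = sym_ev n \<psi> y"
  unfolding sym_ev_def using assms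
  by (intro quot_form_Sym_map[OF assms(1-3)] multilin_pform symmetric_pform)
    (auto simp: pform_def tuples_length tuples_nth)

lemma tens_ev_tensor_map:
  assumes "kmod V" "kmod W" "g \<in> lin_maps V W" "\<And>i. i < m \<Longrightarrow> lin_form W (\<phi> i)" "\<And>i. i < m \<Longrightarrow> lin_form V (\<psi> i)"
    and "\<And>i x. \<lbrakk>i < m; x \<in> carrier V\<rbrakk> \<Longrightarrow> \<phi> i (g x) = \<psi> i x" "y \<in> carrier (tensor_power m V)"
  shows "tens_ev m \<phi> (tensor_map m W g y) = tens_ev m \<psi> y"
  unfolding tens_ev_def using assms
  by (intro tens_form_tensor_map[OF assms(1-3)] multilin_pform)
    (auto simp: pform_def tuples_length tuples_nth)

lemma ext_ev_Ext_map:
  assumes "kmod V" "kmod W" "g \<in> lin_maps V W" "\<And>i. i < m \<Longrightarrow> lin_form W (\<phi> i)" "\<And>i. i < m \<Longrightarrow> lin_form V (\<psi> i)"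
    and "\<And>i x. \<lbrakk>i < m; x \<in> carrier V\<rbrakk> \<Longrightarrow> \<phi> i (g x) = \<psi> i x" "y \<in> carrier (Ext m V)"
  shows "ext_ev m \<phi> (Ext_map m W g y) = ext_ev m \<psi> y"
  unfolding ext_ev_def using assms
  by (intro quot_form_Ext_map[OF assms(1-3)] multilin_dform alternating_dform)
    (auto simp: dform_def tuples_length tuples_nth intro!: arg_cong[where f = det] eq_matI)

lemma sym_ev_cong:
  assumes "kmod V" "lin_form V \<phi>" "lin_form V \<psi>" "\<And>x. x \<in> carrier V \<Longrightarrow> \<phi> x = \<psi> x" "y \<in> carrier (Sym n V)"
  shows "sym_ev n \<phi> y = sym_ev n \<psi> y"
  by (rule lin_form_eqI[OF lin_form_sym_ev[OF assms(1,2)] lin_form_sym_ev[OF assms(1,3)]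
        generates_sym_prod_tuples[OF assms(1)] kmod_Sym[OF assms(1)] _ assms(5)])
    (auto simp: sym_ev_prod[OF assms(1,2)] sym_ev_prod[OF assms(1,3)] tuples_nth assms(4))

lemma tens_ev_permute:
  assumes V: "kmod V" and \<phi>: "\<And>i. i < m \<Longrightarrow> lin_form V (\<phi> i)" and \<sigma>: "\<sigma> permutes {..<m}"
    and t: "t \<in> carrier (tensor_power m V)"
  shows "tens_ev m \<phi> (tensor_permute m V \<sigma> t) = tens_ev m (\<lambda>i. \<phi> (inv_into UNIV \<sigma> i)) t"
  unfolding tens_ev_def
proof (rule tens_form_tensor_permute[OF V \<sigma>])
  have "inv_into UNIV \<sigma> i < m" if "i < m" for i
    using permutes_in_image[OF permutes_inv[OF \<sigma>], of i] that by auto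
  then show "multilin m V (pform m (\<lambda>i. \<phi> (inv_into UNIV \<sigma> i)))"
    by (intro multilin_pform \<phi>)
qed (use \<sigma> t \<phi> in \<open>auto simp: pform_permute_list tuples_length intro!: multilin_pform\<close>)

lemma tens_ev_Div_permute:
  assumes V: "kmod V" and \<phi>: "\<And>i. i < m \<Longrightarrow> lin_form V (\<phi> i)" and \<sigma>: "\<sigma> permutes {..<m}"
    and t: "t \<in> carrier (Div m V)"
  shows "tens_ev m (\<lambda>i. \<phi> (\<sigma> i)) t = tens_ev m \<phi> t"
  using tens_ev_permute[OF V \<phi> permutes_inv[OF \<sigma>], where t = t] t permutes_inv[OF \<sigma>] permutes_inv_inv[OF \<sigma>]
  by (simp add: Div_carrier)

subsection \<open>Evaluation at a Kronecker point\<close>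

abbreviation words :: "nat \<Rightarrow> nat \<Rightarrow> nat list set" where
  "words m n \<equiv> {as. length as = m \<and> set as \<subseteq> {..n}}"

lemma finite_words [simp]: "finite (words m n)"
  using finite_lists_length_eq[of "{..n}" m] by (simp add: conj_commute)

lemma permute_words: "\<lbrakk>as \<in> words m n; \<sigma> permutes {..<m}\<rbrakk> \<Longrightarrow> permute_list \<sigma> as \<in> words m n"
  by auto

lemma prod_monom: "finite A \<Longrightarrow> (\<Prod>i\<in>A. monom 1 (g i)) = monom (1::'k::comm_semiring_1) (\<Sum>i\<in>A. g i)"
  by (induction A rule: finite_induct) (simp_all add: mult_monom)

lemma prod_nth: "length xs = n \<Longrightarrow> (\<Prod>i<n. f (xs ! i)) = prod_list (map f xs)"
  by (simp add: prod.list_conv_set_nth atLeast0LessThan)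

lemma image_map_words: "{xs. length xs = m \<and> set xs \<subseteq> v ` {..n}} = map v ` words m n"
proof (intro equalityI subsetI)
  fix xs assume "xs \<in> {xs. length xs = m \<and> set xs \<subseteq> v ` {..n}}"
  then have "xs \<in> lists (v ` {..n})" "length xs = m"
    by auto
  then obtain as where "as \<in> lists {..n}" "xs = map v as"
    unfolding lists_image by blast
  with \<open>length xs = m\<close> show "xs \<in> map v ` words m n"
    by (intro image_eqI[of _ _ as]) auto
qed (auto simp: subset_iff)

lemma words_nth: "\<lbrakk>as \<in> words m n; i < m\<rbrakk> \<Longrightarrow> as ! i \<le> n"
  using nth_mem[of i as] by (auto simp: subset_iff)

text \<open>The generator \<open>v a\<close> becomes the \<open>a\<close>-th power of the variable
  \<open>X ^ (N ^ i)\<close> under \<open>f i\<close>. The bound \<open>n < N\<close> keeps digits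
  from overflowing; \<open>2 \<le> N\<close> keeps the weights distinct also for
  \<open>n = 0\<close>. It is used for a plane, with \<open>n = 1\<close>, and for its symmetric
  powers.\<close>

locale kronecker =
  fixes V :: "('k::field, 'v) module" and v :: "nat \<Rightarrow> 'v" and m n N :: nat and f :: "nat \<Rightarrow> 'v \<Rightarrow> 'k poly"
  assumes V: "kmod V" and gen: "generates V (v ` {..n})" and f: "\<And>i. i < m \<Longrightarrow> lin_form V (f i)"
    and fv: "\<And>i a. \<lbrakk>i < m; a \<le> n\<rbrakk> \<Longrightarrow> f i (v a) = monom 1 (a * N ^ i)"
    and N: "n < N" "2 \<le> N"
begin

lemma v_closed: "a \<le> n \<Longrightarrow> v a \<in> carrier V"
  using gen by (auto simp: generates_def)

lemma words_tuples: "as \<in> words m n \<Longrightarrow> map v as \<in> tuples m V"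
  using v_closed by (auto simp: tuples_iff)

lemma words_inj: "inj_on (digits N) (words m n)"
proof (rule inj_onI)
  fix as bs assume "as \<in> words m n" "bs \<in> words m n" "digits N as = digits N bs"
  then show "as = bs"
    using N(1) by (intro digits_inj[of as bs N]) auto
qed

lemma tens_ev_word:
  assumes as: "as \<in> words m n"
  shows "tens_ev m f (pure_tensor m V (map v as)) = monom 1 (digits N as)"
proof -
  have "as ! i \<le> n" if "i < m" for i
    using words_nth as that by blast
  then have "(\<Prod>i<m. f i (map v as ! i)) = (\<Prod>i<m. monom 1 (as ! i * N ^ i))"
    using as by (intro prod.cong) (auto simp: fv)
  then show ?thesis
    using as by (simp add: tens_ev_pure[OF V f words_tuples[OF as]] prod_monom digits_def)
qed

lemma generates_tensor_words: "generates (tensor_power m V) ((\<lambda>as. pure_tensor m V (map v as)) ` words m n)"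
  using generates_pure_generators[OF V gen, of m] unfolding image_map_words image_image .

text \<open>Distinct words have distinct base \<open>N\<close> values, so the tensors of words go to
  monomials of distinct degrees. This is the injectivity of the Kronecker substitution.\<close>

lemma
  assumes t: "t \<in> carrier (tensor_power m V)"
  shows tens_ev_inj: "tens_ev m f t = 0 \<Longrightarrow> t = \<zero>\<^bsub>tensor_power m V\<^esub>"
    and tens_ev_degree: "tens_ev m f t \<noteq> 0 \<Longrightarrow> \<exists>as\<in>words m n. degree (tens_ev m f t) = digits N as"
proof -
  have nz: "tens_ev m f (pure_tensor m V (map v as)) \<noteq> 0" if "as \<in> words m n" for as
    by (simp add: tens_ev_word[OF that] monom_eq_0_iff)
  have deg: "degree (tens_ev m f (pure_tensor m V (map v as))) = digits N as" if "as \<in> words m n" for as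
    by (simp add: tens_ev_word[OF that] degree_monom_eq)
  have inj: "inj_on (\<lambda>as. degree (tens_ev m f (pure_tensor m V (map v as)))) (words m n)"
    using words_inj by (subst inj_on_cong[OF deg])
  note * = kmod_tensor[OF V] finite_words generates_tensor_words lin_form_tens_ev[OF V f] nz inj t
  show "t = \<zero>\<^bsub>tensor_power m V\<^esub>" if "tens_ev m f t = 0"
    using lin_form_degree_inj[OF *] that by simp
  show "\<exists>as\<in>words m n. degree (tens_ev m f t) = digits N as" if "tens_ev m f t \<noteq> 0"
    using lin_form_degree[OF *] that deg by (metis (no_types, lifting))
qed

lemma tens_ev_eqD:
  assumes "s \<in> carrier (tensor_power m V)" "t \<in> carrier (tensor_power m V)" "tens_ev m f s = tens_ev m f t"
  shows "s = t"
proof -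
  have "tens_ev m f (s \<ominus>\<^bsub>tensor_power m V\<^esub> t) = 0"
    using assms by (simp add: lin_form_minus[OF lin_form_tens_ev[OF V f] kmod_tensor[OF V]])
  then have "s \<ominus>\<^bsub>tensor_power m V\<^esub> t = \<zero>\<^bsub>tensor_power m V\<^esub>"
    using assms kmod_tensor[OF V] by (intro tens_ev_inj) auto
  then show ?thesis
    using kmod_minus_eq_zero[OF kmod_tensor[OF V]] assms by blast
qed

text \<open>Permuting a tensor permutes its monomials. As distinct words stay apart after the
  substitution, each coefficient can be followed individually.\<close>

lemma coeff_tensor_permute:
  assumes \<sigma>: "\<sigma> permutes {..<m}" and as: "as \<in> words m n" and t: "t \<in> carrier (tensor_power m V)"
  shows "coeff (tens_ev m f (tensor_permute m V \<sigma> t)) (digits N (permute_list \<sigma> as)) =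
    coeff (tens_ev m f t) (digits N as)"
  using generates_tensor_words t
proof (rule generates_induct)
  note lin = tensor_permute_lin_maps[OF V \<sigma>] and T = kmod_tensor[OF V, of m] and ev = lin_form_tens_ev[OF V f]
  show "coeff (tens_ev m f (tensor_permute m V \<sigma> t)) (digits N (permute_list \<sigma> as)) =
    coeff (tens_ev m f t) (digits N as)" if t: "t \<in> (\<lambda>as. pure_tensor m V (map v as)) ` words m n" for t
  proof -
    obtain bs where bs: "bs \<in> words m n" "t = pure_tensor m V (map v bs)"
      using t by blast
    have "tensor_permute m V \<sigma> t = pure_tensor m V (map v (permute_list \<sigma> bs))"
      using bs \<sigma> by (simp add: tensor_permute_pure[OF V \<sigma> words_tuples] permute_list_map)
    moreover have "permute_list \<sigma> bs = permute_list \<sigma> as \<longleftrightarrow> bs = as"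
    proof
      assume eq: "permute_list \<sigma> bs = permute_list \<sigma> as"
      have "bs ! i = as ! i" if "i < m" for i
      proof -
        define j where "j = inv_into UNIV \<sigma> i"
        have j: "j < m" "\<sigma> j = i"
          using that permutes_in_image[OF permutes_inv[OF \<sigma>], of i] permutes_inverses[OF \<sigma>] by (auto simp: j_def)
        then show ?thesis
          using arg_cong[OF eq, of "\<lambda>xs. xs ! j"] bs as \<sigma> by (simp add: permute_list_nth)
      qed
      then show "bs = as"
        using bs as by (intro nth_equalityI) auto
    qed simp
    ultimately show ?thesis
      using bs as \<sigma> inj_on_eq_iff[OF words_inj, of bs as]
        inj_on_eq_iff[OF words_inj permute_words[OF bs(1) \<sigma>] permute_words[OF as \<sigma>]]
      by (simp add: tens_ev_word permute_words del: mem_Collect_eq)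
  qed
qed (use kmod_tensor[OF V, of m] in \<open>simp_all add: lin_maps_zero[OF tensor_permute_lin_maps[OF V \<sigma>]]
    lin_maps_add[OF tensor_permute_lin_maps[OF V \<sigma>]] lin_maps_smult[OF tensor_permute_lin_maps[OF V \<sigma>]]
    lin_maps_closed[OF tensor_permute_lin_maps[OF V \<sigma>]]
    lin_form_zero[OF lin_form_tens_ev[OF V f]] lin_form_add[OF lin_form_tens_ev[OF V f]]
    lin_form_smult[OF lin_form_tens_ev[OF V f]]\<close>)

text \<open>If the leading word were not sorted, a swap would give a word of larger value, and
  invariance would put the same nonzero coefficient there, above the degree.\<close>

lemma Div_degree:
  assumes t: "t \<in> carrier (Div m V)" and nz: "tens_ev m f t \<noteq> 0"
  shows "\<exists>as\<in>words m n. sorted as \<and> degree (tens_ev m f t) = digits N as"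
proof -
  have tT: "t \<in> carrier (tensor_power m V)"
    using t by (simp add: Div_carrier)
  obtain as where as: "as \<in> words m n" "degree (tens_ev m f t) = digits N as"
    using tens_ev_degree[OF tT nz] by blast
  have "sorted as"
  proof (rule ccontr)
    assume "\<not> sorted as"
    then obtain i j where ij: "i < j" "j < length as"
      "digits N as < digits N (permute_list (Transposition.transpose i j) as)"
      using N(2) by (rule not_sorted_swap)
    have \<sigma>: "Transposition.transpose i j permutes {..<m}"
      using ij as by (intro permutes_swap_id) auto
    have "coeff (tens_ev m f t) (digits N (permute_list (Transposition.transpose i j) as)) =
        coeff (tens_ev m f t) (degree (tens_ev m f t))"
      using coeff_tensor_permute[OF \<sigma> as(1) tT] t \<sigma> as(2) by (simp add: Div_carrier)
    then show False
      using ij(3) nz as(2) by (metis coeff_eq_0 leading_coeff_0_iff)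
  qed
  then show ?thesis
    using as by blast
qed

text \<open>Polarization of the vanishing on repeated entries: the product with the sum of the two
  vectors in both positions is zero. The exterior power is defined by repetitions, so antisymmetry
  has to be derived, and this derivation holds in characteristic 2 as well.\<close>

lemma ext_prod_swap:
  assumes xs: "xs \<in> tuples m V" and ij: "i < m" "j < m" "i \<noteq> j"
  shows "ext_prod m V (xs[i := xs ! j, j := xs ! i]) = (-1) \<odot>\<^bsub>Ext m V\<^esub> ext_prod m V xs"
proof -
  define E where "E = (\<lambda>a b. ext_prod m V (xs[i := a, j := b]))"
  let ?x = "xs ! i" and ?y = "xs ! j"
  have xy: "?x \<in> carrier V" "?y \<in> carrier V" "?x \<oplus>\<^bsub>V\<^esub> ?y \<in> carrier V"
    using xs ij V by (auto simp: tuples_nth)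
  have EC: "E a b \<in> carrier (Ext m V)" if "a \<in> carrier V" "b \<in> carrier V" for a b
    unfolding E_def using that xs by (intro ext_prod_closed[OF V] tuples_update)
  have same: "E a a = \<zero>\<^bsub>Ext m V\<^esub>" if "a \<in> carrier V" for a
    unfolding E_def
  proof (rule ext_prod_not_distinct[OF V])
    show "xs[i := a, j := a] \<in> tuples m V"
      using that xs by (intro tuples_update)
    have "xs[i := a, j := a] ! i = xs[i := a, j := a] ! j"
      using ij xs by (auto simp: tuples_length nth_list_update)
    then show "\<not> distinct (xs[i := a, j := a])"
      using ij xs by (metis distinct_conv_nth length_list_update tuples_length)
  qed
  have addr: "E a (b \<oplus>\<^bsub>V\<^esub> c) = E a b \<oplus>\<^bsub>Ext m V\<^esub> E a c"
    if "a \<in> carrier V" "b \<in> carrier V" "c \<in> carrier V" for a b c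
    unfolding E_def using that xs ij by (intro ext_prod_add[OF V] tuples_update) auto
  have addl: "E (a \<oplus>\<^bsub>V\<^esub> b) c = E a c \<oplus>\<^bsub>Ext m V\<^esub> E b c"
    if "a \<in> carrier V" "b \<in> carrier V" "c \<in> carrier V" for a b c
    unfolding E_def list_update_swap[OF ij(3)] using that xs ij
    by (intro ext_prod_add[OF V] tuples_update) auto
  note K = kmod_Ext[OF V, of m]
  have "\<zero>\<^bsub>Ext m V\<^esub> = E (?x \<oplus>\<^bsub>V\<^esub> ?y) (?x \<oplus>\<^bsub>V\<^esub> ?y)"
    using same[OF xy(3)] by simp
  also have "\<dots> = E ?x (?x \<oplus>\<^bsub>V\<^esub> ?y) \<oplus>\<^bsub>Ext m V\<^esub> E ?y (?x \<oplus>\<^bsub>V\<^esub> ?y)"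
    using xy by (intro addl)
  also have "\<dots> = E ?x ?y \<oplus>\<^bsub>Ext m V\<^esub> E ?y ?x"
    using xy EC K by (simp add: addr same)
  finally have "(-1) \<odot>\<^bsub>Ext m V\<^esub> E ?x ?y = (-1) \<odot>\<^bsub>Ext m V\<^esub> E ?x ?y \<oplus>\<^bsub>Ext m V\<^esub> (E ?x ?y \<oplus>\<^bsub>Ext m V\<^esub> E ?y ?x)"
    using EC[OF xy(1,2)] K by (metis kmod_add_zero kmod_smult_closed)
  also have "\<dots> = (((-1) + 1) \<odot>\<^bsub>Ext m V\<^esub> E ?x ?y) \<oplus>\<^bsub>Ext m V\<^esub> E ?y ?x"
    using EC xy K by (subst kmod_add_smult) (simp_all add: kmod_add_assoc)
  also have "\<dots> = E ?y ?x"
    using EC xy K by simp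
  finally show ?thesis
    using ij by (simp add: E_def)
qed

text \<open>Words with a repeated letter give zero, and the others can be sorted at the cost of
  signs.\<close>

lemma generates_ext_words:
  "generates (Ext m V) ((\<lambda>as. ext_prod m V (map v as)) ` {as \<in> words m n. sorted as \<and> distinct as})"
proof (rule generates_trans)
  show "generates (Ext m V) ((\<lambda>as. ext_prod m V (map v as)) ` words m n)"
    using generates_ext_prod[OF V gen, of m] unfolding image_map_words image_image .
  show "(\<lambda>as. ext_prod m V (map v as)) ` {as \<in> words m n. sorted as \<and> distinct as} \<subseteq> carrier (Ext m V)"
    using words_tuples ext_prod_closed[OF V] by blast
  fix K
  assume K: "subsp (Ext m V) K"
    and sub: "(\<lambda>as. ext_prod m V (map v as)) ` {as \<in> words m n. sorted as \<and> distinct as} \<subseteq> K"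
  have "ext_prod m V (map v as) \<in> K" if "as \<in> words m n" for as
    using that
  \<comment> \<open>Swapping an inversion raises the value of the word, while the value of the
    sorted word bounds it and does not change. So the difference decreases.\<close>
  proof (induction "digits N (sort as) - digits N as" arbitrary: as rule: less_induct)
    case less
    show ?case
    proof (cases "distinct as \<and> \<not> sorted as")
      case False
      show ?thesis
      proof (cases "distinct as")
        case True
        then show ?thesis
          using False less.prems sub by blast
      next
        case False
        then have "\<not> distinct (map v as)"
          by (simp add: distinct_map)
        then show ?thesis
          using ext_prod_not_distinct[OF V words_tuples[OF less.prems]] subsp_zero[OF K] by simp
      qed
    next
      case True
      then obtain i j where ij: "i < j" "j < length as"
        "digits N as < digits N (permute_list (Transposition.transpose i j) as)"
        using N(2) not_sorted_swap[of as N] by blast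
      define bs where "bs = permute_list (Transposition.transpose i j) as"
      have \<sigma>: "Transposition.transpose i j permutes {..<length as}"
        using ij by (intro permutes_swap_id) auto
      have bs: "bs \<in> words m n" "mset bs = mset as"
        using less.prems \<sigma> by (auto simp: bs_def)
      have "sort bs = sort as"
        using bs(2) by (metis mset_sort properties_for_sort sorted_sort)
      moreover have "digits N bs \<le> digits N (sort as)"
        using N(2) bs(2) by (intro digits_le_sorted) auto
      ultimately have K': "ext_prod m V (map v bs) \<in> K"
        using ij(3) by (intro less.hyps bs) (simp add: bs_def[symmetric])
      have "as = bs[i := bs ! j, j := bs ! i]"
        using ij by (intro nth_equalityI)
          (auto simp: bs_def permute_list_nth[OF \<sigma>] nth_list_update Transposition.transpose_def)
      then have eq: "map v as = (map v bs)[i := map v bs ! j, j := map v bs ! i]"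
        using ij bs less.prems by (metis (no_types, lifting) length_permute_list bs_def map_update nth_map order.strict_trans)
      have "ext_prod m V (map v as) = (-1) \<odot>\<^bsub>Ext m V\<^esub> ext_prod m V (map v bs)"
        unfolding eq using ij less.prems by (intro ext_prod_swap words_tuples bs) auto
      then show ?thesis
        using subsp_smult[OF K K'] by simp
    qed
  qed
  then show "(\<lambda>as. ext_prod m V (map v as)) ` words m n \<subseteq> K"
    by blast
qed

text \<open>In the Leibniz expansion the identity contributes the strictly largest exponent, because
  the word is strictly increasing. Its coefficient is 1 and nothing cancels it.\<close>

lemma ext_ev_word:
  assumes as: "as \<in> words m n" "sorted as" "distinct as"
  shows "ext_ev m f (ext_prod m V (map v as)) \<noteq> 0"
    and "degree (ext_ev m f (ext_prod m V (map v as))) = digits N as"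
proof -
  let ?S = "{\<sigma>. \<sigma> permutes {..<m}}"
  let ?d = "\<lambda>\<sigma>. digits N (permute_list (inv_into UNIV \<sigma>) as)"
  have asN: "set as \<subseteq> {..<N}" and len: "length as = m"
    using as N by auto
  have le: "as ! i \<le> n" if "i < m" for i
    using words_nth as that by blast
  have pform: "pform m (\<lambda>i. f (\<sigma> i)) (map v as) = monom 1 (?d \<sigma>)" if \<sigma>: "\<sigma> permutes {..<m}" for \<sigma>
  proof -
    have "\<sigma> i < m" if "i < m" for i
      using permutes_in_image[OF \<sigma>, of i] that by simp
    then have "pform m (\<lambda>i. f (\<sigma> i)) (map v as) = (\<Prod>i<m. monom 1 (as ! i * N ^ \<sigma> i))"
      unfolding pform_def using len le by (intro prod.cong) (auto simp: fv)
    also have "\<dots> = monom 1 (?d \<sigma>)"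
      using digits_permute[of "inv_into UNIV \<sigma>" as N] permutes_inv[OF \<sigma>] len
      by (simp add: prod_monom permutes_inv_inv[OF \<sigma>])
    finally show ?thesis .
  qed
  have "ext_ev m f (ext_prod m V (map v as)) = dform m f (map v as)"
    using words_tuples[OF as(1)] by (intro ext_ev_prod V f)
  also have "\<dots> = (\<Sum>\<sigma>\<in>?S. signof \<sigma> * monom 1 (?d \<sigma>))"
    unfolding dform_eq by (intro sum.cong) (auto simp: pform)
  finally have ev: "ext_ev m f (ext_prod m V (map v as)) = (\<Sum>\<sigma>\<in>?S. signof \<sigma> * monom 1 (?d \<sigma>))" .
  have less: "?d \<sigma> < digits N as" if "\<sigma> permutes {..<m}" "\<sigma> \<noteq> id" for \<sigma>
  proof (rule digits_permute_less[OF as(2,3) asN N(2)])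
    show "inv_into UNIV \<sigma> permutes {..<length as}"
      using permutes_inv[OF that(1)] len by simp
    show "inv_into UNIV \<sigma> \<noteq> id"
      using that by (metis inv_id permutes_inv_inv)
  qed
  have deg: "degree (signof \<sigma> * monom (1::'k) k) = k" for \<sigma> :: "nat \<Rightarrow> nat" and k
    by (simp add: sign_def degree_monom_eq)
  have "coeff (ext_ev m f (ext_prod m V (map v as))) (digits N as) =
      (\<Sum>\<sigma>\<in>?S. coeff (signof \<sigma> * monom (1::'k) (?d \<sigma>)) (digits N as))"
    by (simp add: ev coeff_sum)
  also have "\<dots> = (\<Sum>\<sigma>\<in>{id}. coeff (signof \<sigma> * monom (1::'k) (?d \<sigma>)) (digits N as))"
  proof (rule sum.mono_neutral_right)
    show "\<forall>\<sigma>\<in>?S - {id}. coeff (signof \<sigma> * monom (1::'k) (?d \<sigma>)) (digits N as) = 0"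
    proof
      fix \<sigma> assume "\<sigma> \<in> ?S - {id}"
      then have "?d \<sigma> < digits N as"
        by (intro less) auto
      then show "coeff (signof \<sigma> * monom (1::'k) (?d \<sigma>)) (digits N as) = 0"
        by (intro coeff_eq_0) (simp only: deg)
    qed
  qed (simp_all add: finite_permutations permutes_id)
  also have "\<dots> = 1"
    by (simp add: sign_id)
  finally have c: "coeff (ext_ev m f (ext_prod m V (map v as))) (digits N as) = 1" .
  then show "ext_ev m f (ext_prod m V (map v as)) \<noteq> 0"
    by auto
  have "?d \<sigma> \<le> digits N as" if "\<sigma> permutes {..<m}" for \<sigma>
    using less[OF that] by (cases "\<sigma> = id") auto
  then have "degree (ext_ev m f (ext_prod m V (map v as))) \<le> digits N as"
    unfolding ev by (intro degree_sum_le) (auto simp: finite_permutations deg)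
  then show "degree (ext_ev m f (ext_prod m V (map v as))) = digits N as"
    using c le_degree[of "ext_ev m f (ext_prod m V (map v as))" "digits N as"] by simp
qed

lemma
  assumes x: "x \<in> carrier (Ext m V)"
  shows ext_ev_inj: "ext_ev m f x = 0 \<Longrightarrow> x = \<zero>\<^bsub>Ext m V\<^esub>"
    and ext_ev_degree: "ext_ev m f x \<noteq> 0 \<Longrightarrow>
      \<exists>as\<in>words m n. sorted as \<and> distinct as \<and> degree (ext_ev m f x) = digits N as"
proof -
  let ?P = "{as \<in> words m n. sorted as \<and> distinct as}"
  have nz: "ext_ev m f (ext_prod m V (map v as)) \<noteq> 0" if "as \<in> ?P" for as
    using that ext_ev_word by blast
  have deg: "degree (ext_ev m f (ext_prod m V (map v as))) = digits N as" if "as \<in> ?P" for as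
    using that ext_ev_word by blast
  have inj: "inj_on (\<lambda>as. degree (ext_ev m f (ext_prod m V (map v as)))) ?P"
    using inj_on_subset[OF words_inj, of ?P] by (subst inj_on_cong[OF deg]) auto
  have fin: "finite ?P"
    by (rule finite_subset[OF _ finite_words[of m n]]) blast
  note * = kmod_Ext[OF V] fin generates_ext_words
    lin_form_ext_ev[OF V f] nz inj x
  show "x = \<zero>\<^bsub>Ext m V\<^esub>" if "ext_ev m f x = 0"
    by (rule lin_form_degree_inj[OF *]) (use that in auto)
  have "\<exists>as\<in>?P. degree (ext_ev m f x) = degree (ext_ev m f (ext_prod m V (map v as)))" if "ext_ev m f x \<noteq> 0"
    by (rule lin_form_degree[OF *]) (use that in auto)
  then show "\<exists>as\<in>words m n. sorted as \<and> distinct as \<and> degree (ext_ev m f x) = digits N as"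
    if "ext_ev m f x \<noteq> 0"
    using that deg by (metis (no_types, lifting) mem_Collect_eq)
qed

text \<open>The orbit sum of \<open>as\<close>, a monomial symmetric function, has these properties.
  Each distinct rearrangement is taken once, without the multiplicities of a sum over permutations,
  so the leading coefficient is 1 in every characteristic.\<close>

lemma Div_exists:
  assumes as: "as \<in> words m n" "sorted as"
  shows "\<exists>t\<in>carrier (Div m V). tens_ev m f t \<noteq> 0 \<and> degree (tens_ev m f t) = digits N as"
proof -
  let ?S = "{bs. mset bs = mset as}" and ?p = "\<lambda>bs. pure_tensor m V (map v bs)"
  have S: "?S \<subseteq> words m n"
    using as by (auto dest: mset_eq_setD mset_eq_length)
  then have fin: "finite ?S"
    using finite_words finite_subset by blast
  note T = kmod_tensor[OF V, of m]
  have ev: "lin_form (tensor_power m V) (tens_ev m f)"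
    using V f by (rule lin_form_tens_ev)
  have p: "?p bs \<in> carrier (tensor_power m V)" if "bs \<in> ?S" for bs
    using that S words_tuples pure_closed[OF V] by blast
  define t where "t = finsum (tensor_power m V) (\<lambda>bs. 1 \<odot>\<^bsub>tensor_power m V\<^esub> ?p bs) ?S"
  interpret T: Module.module class_ring "tensor_power m V" by (rule T)
  have t: "t \<in> carrier (tensor_power m V)"
    unfolding t_def using p T by (intro T.M.finsum_closed) auto
  have "tens_ev m f t = (\<Sum>bs\<in>?S. Polynomial.smult 1 (tens_ev m f (?p bs)))"
    unfolding t_def using T fin p ev by (rule lin_form_finsum)
  also have "\<dots> = (\<Sum>bs\<in>?S. monom 1 (digits N bs))"
  proof (rule sum.cong)
    fix bs assume "bs \<in> ?S"
    then show "Polynomial.smult 1 (tens_ev m f (?p bs)) = monom 1 (digits N bs)"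
      using tens_ev_word[of bs] S by auto
  qed simp
  finally have ev_t: "tens_ev m f t = (\<Sum>bs\<in>?S. monom 1 (digits N bs))" .
  have "tensor_permute m V \<sigma> t = t" if \<sigma>: "\<sigma> permutes {..<m}" for \<sigma>
  \<comment> \<open>Invariance may be tested at the Kronecker point, where a permutation only
    reorders a sum over all rearrangements.\<close>
  proof (rule tens_ev_eqD[OF _ t])
    note lin = tensor_permute_lin_maps[OF V \<sigma>]
    show "tensor_permute m V \<sigma> t \<in> carrier (tensor_power m V)"
      using lin t by (rule lin_maps_closed)
    have len: "length bs = m" if "bs \<in> ?S" for bs
      using that S by blast
    have perm: "tens_ev m f (tensor_permute m V \<sigma> (?p bs)) = monom 1 (digits N (permute_list \<sigma> bs))"
      if bs: "bs \<in> ?S" for bs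
    proof -
      have "bs \<in> words m n"
        using bs S by blast
      then show ?thesis
        using \<sigma> tens_ev_word[OF permute_words] by (simp add: tensor_permute_pure[OF V \<sigma> words_tuples] permute_list_map)
    qed
    have "tens_ev m f (tensor_permute m V \<sigma> t) =
        (\<Sum>bs\<in>?S. Polynomial.smult 1 (tens_ev m f (tensor_permute m V \<sigma> (?p bs))))"
      unfolding t_def using T fin p lin_form_comp[OF ev lin] by (rule lin_form_finsum)
    also have "\<dots> = (\<Sum>bs\<in>?S. monom 1 (digits N (permute_list \<sigma> bs)))"
      by (rule sum.cong) (simp_all only: perm smult_1_left)
    also have "\<dots> = (\<Sum>bs\<in>?S. monom 1 (digits N bs))"
    proof (rule sum.reindex_bij_witness[where i = "permute_list (inv_into UNIV \<sigma>)" and j = "permute_list \<sigma>"])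
      fix bs assume "bs \<in> ?S"
      then show "permute_list (inv_into UNIV \<sigma>) (permute_list \<sigma> bs) = bs"
        "permute_list \<sigma> (permute_list (inv_into UNIV \<sigma>) bs) = bs"
        "permute_list \<sigma> bs \<in> ?S" "permute_list (inv_into UNIV \<sigma>) bs \<in> ?S"
        using \<sigma> permutes_inv[OF \<sigma>] len[of bs] permutes_inv_o[OF \<sigma>]
        by (simp_all flip: permute_list_compose)
    qed simp
    finally show "tens_ev m f (tensor_permute m V \<sigma> t) = tens_ev m f t"
      by (simp add: ev_t)
  qed
  then have "t \<in> carrier (Div m V)"
    using t by (simp add: Div_carrier)
  moreover have "coeff (tens_ev m f t) (digits N as) = (\<Sum>bs\<in>?S. if bs = as then 1 else 0)"
    unfolding ev_t coeff_sum
  proof (rule sum.cong)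
    fix bs assume "bs \<in> ?S"
    then have "digits N bs = digits N as \<longleftrightarrow> bs = as"
      using S as by (intro inj_on_eq_iff[OF words_inj]) blast+
    then show "coeff (monom (1::'k) (digits N bs)) (digits N as) = (if bs = as then 1 else 0)"
      by simp
  qed simp
  then have c: "coeff (tens_ev m f t) (digits N as) = 1"
    using fin by simp
  moreover have "degree (tens_ev m f t) \<le> digits N as"
    unfolding ev_t using fin digits_le_sorted[OF as(2) _ N(2)]
    by (intro degree_sum_le) (auto simp: degree_monom_eq)
  moreover have "digits N as \<le> degree (tens_ev m f t)"
    using c by (intro le_degree) simp
  ultimately show ?thesis
    by (intro bexI[of _ t]) auto
qed

end

subsection \<open>Planes with a basis\<close>

text \<open>A final segment is known from its size. For a sorted word the positions above a
  threshold form such a segment, so that counting them recovers the word.\<close>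

lemma upward_closed_eq:
  assumes S: "S \<subseteq> {..<m}" and up: "\<And>p q. \<lbrakk>p \<in> S; p \<le> q; q < m\<rbrakk> \<Longrightarrow> q \<in> S"
  shows "S = {m - card S..<m}"
proof (cases "S = {}")
  case False
  have fin: "finite S"
    using S finite_subset by blast
  have "S = {Min S..<m}"
  proof (intro equalityI subsetI)
    show "q \<in> {Min S..<m}" if "q \<in> S" for q
      using that S fin by auto
    show "q \<in> S" if "q \<in> {Min S..<m}" for q
      using that up[OF Min_in[OF fin False]] by auto
  qed
  moreover have "Min S < m"
    using S Min_in[OF fin False] by auto
  ultimately have "S = {Min S..<m}" "card S = m - Min S" "Min S < m"
    by (metis card_atLeastLessThan)+
  then show ?thesis
    by simp
qed simp

lemma digits_map_upt: "digits N (map h [0..<m]) = (\<Sum>p<m. h p * N ^ p)"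
  by (simp add: digits_def)

text \<open>The leading exponent of the \<open>j\<close>-th elementary symmetric polynomial in \<open>m\<close> variables.\<close>

definition ones :: "nat \<Rightarrow> nat \<Rightarrow> nat list" where
  "ones m j = map (\<lambda>p. if m \<le> p + j then 1 else 0) [0..<m]"

lemma ones_words: "ones m j \<in> words m 1" and sorted_ones: "sorted (ones m j)"
  by (auto simp: ones_def sorted_iff_nth_mono)

lemma sorted_binary_word:
  assumes as: "as \<in> words m 1" "sorted as"
  shows "\<exists>j\<le>m. as = ones m j"
proof -
  let ?S = "{p. p < m \<and> as ! p = 1}"
  have S: "?S = {m - card ?S..<m}"
  proof (rule upward_closed_eq)
    fix p q assume p: "p \<in> ?S" and q: "p \<le> q" "q < m"
    then have "as ! p \<le> as ! q"
      using as by (intro sorted_nth_mono) auto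
    then show "q \<in> ?S"
      using p q words_nth[OF as(1) q(2)] by auto
  qed auto
  have "card ?S \<le> card {..<m}"
    by (intro card_mono) auto
  moreover have "as ! p = ones m (card ?S) ! p" if p: "p < m" for p
  proof -
    have "as ! p = 1 \<longleftrightarrow> p \<in> ?S"
      using p by simp
    also have "\<dots> \<longleftrightarrow> m \<le> p + card ?S"
      by (subst S) (use p in auto)
    finally show ?thesis
      using words_nth[OF as(1) p] p by (auto simp: ones_def)
  qed
  ultimately show ?thesis
    using as by (intro exI[of _ "card ?S"]) (auto intro!: nth_equalityI simp: ones_def)
qed

text \<open>The assumption \<open>forms\<close> encodes the linear independence of \<open>e1\<close>
  and \<open>e2\<close> as the existence of forms with prescribed polynomial values, which is how
  points are produced.\<close>

locale based_plane =
  fixes U :: "('k::field, 'u) module" and e1 e2 :: 'u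
  assumes U: "kmod U" and gen: "generates U {e1, e2}"
    and forms: "\<And>a b. \<exists>\<phi>. lin_form U \<phi> \<and> \<phi> e1 = a \<and> \<phi> e2 = b"
begin

definition bas :: "nat \<Rightarrow> 'u" where
  "bas a = (if a = 0 then e1 else e2)"

definition sym_bas :: "nat \<Rightarrow> nat \<Rightarrow> ('u list \<Rightarrow>\<^sub>0 'k) set set" where
  "sym_bas n a = sym_prod n U (replicate (n - a) e1 @ replicate a e2)"

text \<open>The Kronecker point: in the affine coordinate \<open>e2 / e1\<close> the \<open>i\<close>-th variable becomes \<open>X ^ (N ^ i)\<close>.\<close>

definition kpt :: "nat \<Rightarrow> nat \<Rightarrow> 'u \<Rightarrow> 'k poly" where
  "kpt N i = (SOME \<phi>. lin_form U \<phi> \<and> \<phi> e1 = 1 \<and> \<phi> e2 = monom 1 (N ^ i))"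

lemma kpt: "lin_form U (kpt N i)" "kpt N i e1 = 1" "kpt N i e2 = monom 1 (N ^ i)"
  using someI_ex[OF forms[of 1 "monom 1 (N ^ i)"]] by (simp_all add: kpt_def)

lemma e_closed: "e1 \<in> carrier U" "e2 \<in> carrier U"
  using gen by (auto simp: generates_def)

lemma bas_image: "bas ` {..1} = {e1, e2}"
  by (auto simp: bas_def image_def intro!: bexI[of _ 0] bexI[of _ 1])

lemma kronecker_bas:
  assumes "2 \<le> N"
  shows "kronecker U bas m 1 N (kpt N)"
proof (rule kronecker.intro)
  show "generates U (bas ` {..1})"
    unfolding bas_image by (rule gen)
  show "kpt N i (bas a) = monom 1 (a * N ^ i)" if "a \<le> 1" for i a
    using that by (cases a) (auto simp: bas_def kpt)
qed (use assms U kpt in auto)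

lemma generates_sym_bas: "generates (Sym n U) (sym_bas n ` {..n})"
proof (rule generates_trans[OF generates_sym_prod[OF U gen, of n]])
  show "sym_bas n ` {..n} \<subseteq> carrier (Sym n U)"
    using e_closed by (auto simp: sym_bas_def tuples_iff intro!: sym_prod_closed[OF U])
  fix K assume K: "sym_bas n ` {..n} \<subseteq> K"
  show "sym_prod n U ` {xs. length xs = n \<and> set xs \<subseteq> {e1, e2}} \<subseteq> K"
  proof (intro image_subsetI)
    fix xs assume "xs \<in> {xs. length xs = n \<and> set xs \<subseteq> {e1, e2}}"
    then have xs: "length xs = n" "set xs \<subseteq> {e1, e2}"
      by auto
    \<comment> \<open>All copies of \<open>e2\<close> are moved to the end; the symmetric product
      does not depend on the order.\<close>
    define ys where "ys = filter (\<lambda>x. x \<noteq> e2) xs @ filter (\<lambda>x. x = e2) xs"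
    define a where "a = length (filter (\<lambda>x. x = e2) xs)"
    have a: "a \<le> n" "length (filter (\<lambda>x. x \<noteq> e2) xs) = n - a"
      using sum_length_filter_compl[of "\<lambda>x. x = e2" xs] xs by (auto simp: a_def)
    have rep: "zs = replicate (length zs) z" if "set zs \<subseteq> {z}" for zs :: "'u list" and z
      using that by (induction zs) auto
    have "filter (\<lambda>x. x \<noteq> e2) xs = replicate (n - a) e1"
      using rep[of "filter (\<lambda>x. x \<noteq> e2) xs" e1] xs a by auto
    moreover have "filter (\<lambda>x. x = e2) xs = replicate a e2"
      using rep[of "filter (\<lambda>x. x = e2) xs" e2] by (auto simp: a_def)
    ultimately have ys: "sym_prod n U ys = sym_bas n a"
      by (simp add: ys_def sym_bas_def)
    have "mset ys = mset xs"
      unfolding ys_def by (simp add: union_commute flip: multiset_partition)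
    then obtain \<sigma> where "\<sigma> permutes {..<length xs}" "permute_list \<sigma> xs = ys"
      by (rule mset_eq_permutation)
    then have "sym_prod n U xs = sym_prod n U ys"
      using sym_prod_permute[OF U, of xs n \<sigma>] xs e_closed by (auto simp: tuples_iff)
    then show "sym_prod n U xs \<in> K"
      using K a(1) by (auto simp: ys)
  qed
qed

lemma sym_ev_bas:
  assumes "lin_form U \<phi>" "a \<le> n"
  shows "sym_ev n \<phi> (sym_bas n a) = \<phi> e1 ^ (n - a) * \<phi> e2 ^ a"
proof -
  let ?xs = "replicate (n - a) e1 @ replicate a e2"
  have "?xs \<in> tuples n U"
    using assms(2) e_closed by (auto simp: tuples_iff)
  then show ?thesis
    using assms(2) by (simp add: sym_bas_def sym_ev_prod[OF U assms(1)] prod_nth[of ?xs n \<phi>] prod_list_replicate)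
qed

lemma kronecker_sym_bas:
  assumes "n < N" "2 \<le> N"
  shows "kronecker (Sym n U) (sym_bas n) m n N (\<lambda>i. sym_ev n (kpt N i))"
proof (rule kronecker.intro)
  show "sym_ev n (kpt N i) (sym_bas n a) = monom 1 (a * N ^ i)" if "a \<le> n" for i a
    using that by (simp add: sym_ev_bas kpt monom_power mult.commute)
qed (use assms kmod_Sym[OF U] generates_sym_bas lin_form_sym_ev[OF U kpt(1)] in auto)

text \<open>A stand-in for the \<open>j\<close>-th elementary symmetric polynomial. Only its degree
  at the Kronecker point is prescribed, so it may differ by a nonzero scalar and by terms of lower
  degree.\<close>

definition div_bas :: "nat \<Rightarrow> nat \<Rightarrow> nat \<Rightarrow> ('u list \<Rightarrow>\<^sub>0 'k) set" where
  "div_bas m N j = (SOME t. t \<in> carrier (Div m U) \<and> tens_ev m (kpt N) t \<noteq> 0 \<and>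
     degree (tens_ev m (kpt N) t) = digits N (ones m j))"

context
  fixes m N :: nat
  assumes N: "2 \<le> N"
begin

interpretation kronecker U bas m 1 N "kpt N"
  by (rule kronecker_bas[OF N])

lemma div_bas: "div_bas m N j \<in> carrier (Div m U)" "tens_ev m (kpt N) (div_bas m N j) \<noteq> 0"
    "degree (tens_ev m (kpt N) (div_bas m N j)) = digits N (ones m j)"
  using someI_ex[OF Div_exists[OF ones_words sorted_ones, unfolded Bex_def], of j] by (simp_all add: div_bas_def)

lemma lin_form_kpt_Div: "lin_form (Div m U) (tens_ev m (kpt N))"
  using U kpt(1) by (rule lin_form_tens_ev_Div)

text \<open>Degrees on the divided power come from sorted words in the letters 0 and 1, hence from
  some \<open>ones m j\<close> with \<open>j \<le> m\<close>. Elimination of leading terms then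
  writes every element through the chosen ones.\<close>

lemma generates_div_bas: "generates (Div m U) (div_bas m N ` {..m})"
  unfolding generates_def
proof (intro conjI allI impI subsetI)
  fix K x assume K: "subsp (Div m U) K" "div_bas m N ` {..m} \<subseteq> K" and x: "x \<in> carrier (Div m U)"
  have "\<exists>y\<in>K. tens_ev m (kpt N) y = tens_ev m (kpt N) x"
  proof (rule echelon[OF kmod_Div[OF U] lin_form_kpt_Div K(1) _ x])
    fix z assume "z \<in> carrier (Div m U)" "tens_ev m (kpt N) z \<noteq> 0"
    then obtain as where as: "as \<in> words m 1" "sorted as" "degree (tens_ev m (kpt N) z) = digits N as"
      using Div_degree by blast
    then obtain j where "j \<le> m" "as = ones m j"
      using sorted_binary_word by blast
    then show "\<exists>y\<in>K. tens_ev m (kpt N) y \<noteq> 0 \<and> degree (tens_ev m (kpt N) y) = degree (tens_ev m (kpt N) z)"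
      using K(2) as(3) div_bas[of j] by (intro bexI[of _ "div_bas m N j"]) auto
  qed
  then obtain y where y: "y \<in> K" "tens_ev m (kpt N) y = tens_ev m (kpt N) x"
    by blast
  have "y = x"
    using x y(2) subsp_carrier[OF K(1) y(1)] by (intro tens_ev_eqD) (auto simp: Div_carrier)
  then show "x \<in> K"
    using y(1) by simp
qed (use div_bas in auto)

section \<open>Degrees of products of elementary symmetric polynomials\<close>

abbreviation sym_div_bas :: "nat \<Rightarrow> nat list \<Rightarrow> (('u list \<Rightarrow>\<^sub>0 'k) set list \<Rightarrow>\<^sub>0 'k) set set" where
  "sym_div_bas d bs \<equiv> sym_prod d (Div m U) (map (div_bas m N) bs)"

abbreviation sym_div_kpt :: "nat \<Rightarrow> (('u list \<Rightarrow>\<^sub>0 'k) set list \<Rightarrow>\<^sub>0 'k) set set \<Rightarrow> 'k poly" where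
  "sym_div_kpt d \<equiv> sym_ev d (tens_ev m (kpt N))"

lemma sym_div_bas_tuples: "bs \<in> words d m \<Longrightarrow> map (div_bas m N) bs \<in> tuples d (Div m U)"
  using div_bas by (auto simp: tuples_iff)

text \<open>Degrees add in a product, and the digit at position \<open>p\<close> counts the factors
  whose leading monomial contains the variable \<open>p\<close>. The digits form the conjugate of
  the partition \<open>bs\<close>, in increasing order; none of them exceeds
  \<open>d\<close>.\<close>

lemma
  assumes bs: "bs \<in> words d m"
  shows sym_div_ev_nonzero: "sym_div_kpt d (sym_div_bas d bs) \<noteq> 0"
    and sym_div_ev_degree: "degree (sym_div_kpt d (sym_div_bas d bs)) =
      digits N (map (\<lambda>p. card {k. k < d \<and> m \<le> p + bs ! k}) [0..<m])"
proof -
  have ev: "sym_div_kpt d (sym_div_bas d bs) =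
      (\<Prod>k<d. tens_ev m (kpt N) (div_bas m N (bs ! k)))"
    using bs by (simp add: sym_ev_prod[OF kmod_Div[OF U] lin_form_kpt_Div sym_div_bas_tuples[OF bs]])
  then show "sym_div_kpt d (sym_div_bas d bs) \<noteq> 0"
    using div_bas by simp
  have "degree (\<Prod>k<d. tens_ev m (kpt N) (div_bas m N (bs ! k))) = (\<Sum>k<d. digits N (ones m (bs ! k)))"
    using div_bas by (subst degree_prod_eq_sum_degree) auto
  also have "\<dots> = (\<Sum>k<d. \<Sum>p<m. (if m \<le> p + bs ! k then 1 else 0) * N ^ p)"
    by (simp add: ones_def digits_map_upt)
  also have "\<dots> = (\<Sum>p<m. \<Sum>k<d. (if m \<le> p + bs ! k then 1 else 0) * N ^ p)"
    by (rule sum.swap)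
  also have "\<dots> = (\<Sum>p<m. card {k. k < d \<and> m \<le> p + bs ! k} * N ^ p)"
  proof (rule sum.cong)
    fix p
    have "card {k. k < d \<and> m \<le> p + bs ! k} = (\<Sum>k<d. if m \<le> p + bs ! k then 1 else 0)"
      by (subst sum.inter_filter[symmetric]) (auto intro: arg_cong[where f = card])
    then show "(\<Sum>k<d. (if m \<le> p + bs ! k then 1 else 0) * N ^ p) = card {k. k < d \<and> m \<le> p + bs ! k} * N ^ p"
      by (simp add: sum_distrib_right)
  qed simp
  finally show "degree (sym_div_kpt d (sym_div_bas d bs)) =
      digits N (map (\<lambda>p. card {k. k < d \<and> m \<le> p + bs ! k}) [0..<m])"
    by (simp only: ev digits_map_upt)
qed

text \<open>A partition is recovered from its conjugate. The counts are at most
  \<open>d < N\<close>, so they can be read off as digits, and each count determines a final segment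
  of positions \<open>k\<close>.\<close>

lemma counts_inj:
  assumes bs: "bs \<in> words d m" "sorted bs" and cs: "cs \<in> words d m" "sorted cs" and d: "d < N"
    and eq: "digits N (map (\<lambda>p. card {k. k < d \<and> m \<le> p + bs ! k}) [0..<m]) =
      digits N (map (\<lambda>p. card {k. k < d \<and> m \<le> p + cs ! k}) [0..<m])"
  shows "bs = cs"
proof -
  have card_le: "card {k. k < d \<and> P k} < N" for P
    using card_mono[of "{..<d}" "{k. k < d \<and> P k}"] d by (simp add: subset_iff)
  have "map (\<lambda>p. card {k. k < d \<and> m \<le> p + bs ! k}) [0..<m] = map (\<lambda>p. card {k. k < d \<and> m \<le> p + cs ! k}) [0..<m]"
    by (rule digits_inj[OF _ _ _ eq]) (auto simp: card_le)
  then have card: "card {k. k < d \<and> m \<le> p + bs ! k} = card {k. k < d \<and> m \<le> p + cs ! k}" if "p < m" for p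
    using that by simp
  have iff: "m \<le> p + bs ! k \<longleftrightarrow> m \<le> p + cs ! k" if "p < m" "k < d" for p k
  proof -
    have up: "{k. k < d \<and> m \<le> p + as ! k} = {d - card {k. k < d \<and> m \<le> p + as ! k}..<d}"
      if "as \<in> words d m" "sorted as" for as
    proof (rule upward_closed_eq)
      fix i j assume "i \<in> {k. k < d \<and> m \<le> p + as ! k}" "i \<le> j" "j < d"
      then show "j \<in> {k. k < d \<and> m \<le> p + as ! k}"
        using that sorted_nth_mono[of as i j] by auto
    qed auto
    have "{k. k < d \<and> m \<le> p + bs ! k} = {k. k < d \<and> m \<le> p + cs ! k}"
      using up[OF bs] up[OF cs] card[OF \<open>p < m\<close>] by simp
    then show ?thesis
      using \<open>k < d\<close> by blast
  qed
  have "bs ! k = cs ! k" if k: "k < d" for k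
  proof -
    have "bs ! k \<le> m" "cs ! k \<le> m"
      using words_nth bs cs k by blast+
    then show ?thesis
      \<comment> \<open>The position \<open>m - bs ! k\<close> is below \<open>m\<close> only if the
        entry is positive, hence the split at 0. The two choices of position give the two
        inequalities between the entries.\<close>
      using iff[OF _ k, of "m - bs ! k"] iff[OF _ k, of "m - cs ! k"]
      by (cases "bs ! k = 0"; cases "cs ! k = 0") auto
  qed
  then show ?thesis
    using bs cs by (intro nth_equalityI) auto
qed

lemma generates_sym_div:
  "generates (Sym d (Div m U)) (sym_div_bas d ` {bs \<in> words d m. sorted bs})"
proof (rule generates_trans)
  show "generates (Sym d (Div m U)) (sym_div_bas d ` words d m)"
    using generates_sym_prod[OF kmod_Div[OF U] generates_div_bas, of d] unfolding image_map_words image_image .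
  show "sym_div_bas d ` {bs \<in> words d m. sorted bs} \<subseteq> carrier (Sym d (Div m U))"
    using sym_div_bas_tuples sym_prod_closed[OF kmod_Div[OF U]] by blast
  fix K assume K: "sym_div_bas d ` {bs \<in> words d m. sorted bs} \<subseteq> K"
  show "sym_div_bas d ` words d m \<subseteq> K"
  proof (intro image_subsetI)
    fix bs assume bs: "bs \<in> words d m"
    obtain \<sigma> where \<sigma>: "\<sigma> permutes {..<length bs}" "permute_list \<sigma> bs = sort bs"
      using mset_eq_permutation[of "sort bs" bs] by auto
    have "sym_div_bas d (sort bs) = sym_div_bas d bs"
      using sym_prod_permute[OF kmod_Div[OF U] sym_div_bas_tuples[OF bs], of \<sigma>] \<sigma> bs
      by (simp add: permute_list_map)
    moreover have "sort bs \<in> {bs \<in> words d m. sorted bs}"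
      using bs by auto
    ultimately show "sym_div_bas d bs \<in> K"
      using K by (metis (no_types, lifting) image_subset_iff)
  qed
qed

text \<open>The algebraic independence of the elementary symmetric polynomials, for products of
  \<open>d\<close> of them: different multisets of factors have different leading monomials.\<close>

lemma sym_div_ev_inj:
  assumes d: "d < N" and z: "z \<in> carrier (Sym d (Div m U))" "sym_div_kpt d z = 0"
  shows "z = \<zero>\<^bsub>Sym d (Div m U)\<^esub>"
proof (rule lin_form_degree_inj[OF kmod_Sym[OF kmod_Div[OF U]] _ generates_sym_div
      lin_form_sym_ev[OF kmod_Div[OF U] lin_form_kpt_Div] _ _ z])
  show "finite {bs \<in> words d m. sorted bs}"
    by (rule finite_subset[OF _ finite_words[of d m]]) blast
  show "sym_div_kpt d (sym_div_bas d bs) \<noteq> 0"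
    if "bs \<in> {bs \<in> words d m. sorted bs}" for bs
    using that by (intro sym_div_ev_nonzero) blast
  show "inj_on (\<lambda>bs. degree (sym_div_kpt d (sym_div_bas d bs)))
      {bs \<in> words d m. sorted bs}"
  proof (rule inj_onI)
    fix bs cs assume bs: "bs \<in> {bs \<in> words d m. sorted bs}" and cs: "cs \<in> {bs \<in> words d m. sorted bs}"
      and eq: "degree (sym_div_kpt d (sym_div_bas d bs)) =
        degree (sym_div_kpt d (sym_div_bas d cs))"
    have "bs \<in> words d m" "cs \<in> words d m" "sorted bs" "sorted cs"
      using bs cs by blast+
    moreover from this eq have "digits N (map (\<lambda>p. card {k. k < d \<and> m \<le> p + bs ! k}) [0..<m]) =
        digits N (map (\<lambda>p. card {k. k < d \<and> m \<le> p + cs ! k}) [0..<m])"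
      by (simp only: sym_div_ev_degree)
    ultimately show "bs = cs"
      using d counts_inj by blast
  qed
qed

text \<open>The construction from the fundamental theorem on symmetric polynomials: a product of
  elementary ones with a prescribed leading monomial. It works because conjugating a partition twice
  gives it back.\<close>

lemma sym_div_exists:
  assumes as: "as \<in> words m d" "sorted as"
  shows "\<exists>z\<in>carrier (Sym d (Div m U)). sym_div_kpt d z \<noteq> 0 \<and>
    degree (sym_div_kpt d z) = digits N as"
proof -
  \<comment> \<open>the conjugate partition of \<open>as\<close>\<close>
  define bs where "bs = map (\<lambda>k. card {p. p < m \<and> k < as ! p}) [0..<d]"
  have "card {p. p < m \<and> k < as ! p} \<le> m" for k
    using card_mono[of "{..<m}" "{p. p < m \<and> k < as ! p}"] by auto
  then have bs: "bs \<in> words d m"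
    by (auto simp: bs_def)
  have iff: "m \<le> p + bs ! k \<longleftrightarrow> k < as ! p" if pk: "p < m" "k < d" for p k
  proof -
    have "{p. p < m \<and> k < as ! p} = {m - card {p. p < m \<and> k < as ! p}..<m}"
    proof (rule upward_closed_eq)
      fix i j assume "i \<in> {p. p < m \<and> k < as ! p}" "i \<le> j" "j < m"
      then show "j \<in> {p. p < m \<and> k < as ! p}"
        using as sorted_nth_mono[of as i j] by auto
    qed auto
    then have "p \<in> {p. p < m \<and> k < as ! p} \<longleftrightarrow> p \<in> {m - card {p. p < m \<and> k < as ! p}..<m}"
      by simp
    then show ?thesis
      using pk by (auto simp: bs_def)
  qed
  have "card {k. k < d \<and> m \<le> p + bs ! k} = as ! p" if p: "p < m" for p
  proof -
    have "{k. k < d \<and> m \<le> p + bs ! k} = {..<as ! p}"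
      using iff[OF p] words_nth[OF as(1) p] by auto
    then show ?thesis
      by simp
  qed
  then have "map (\<lambda>p. card {k. k < d \<and> m \<le> p + bs ! k}) [0..<m] = as"
    using as by (intro nth_equalityI) auto
  then show ?thesis
    using sym_div_ev_nonzero[OF bs] sym_div_ev_degree[OF bs] sym_div_bas_tuples[OF bs]
    by (intro bexI[of _ "sym_div_bas d bs"])
      (auto intro!: sym_prod_closed[OF kmod_Div[OF U]])
qed

end

end

subsection \<open>Comparing the images\<close>

abbreviation points :: "('k::field, 'u) module \<Rightarrow> (nat \<Rightarrow> 'u \<Rightarrow> 'k poly) \<Rightarrow> bool" where
  "points U \<phi> \<equiv> \<forall>i. lin_form U (\<phi> i)"

definition wedge_ev :: "('u \<Rightarrow> 'k::field poly) \<Rightarrow> ('u \<Rightarrow> 'k poly) \<Rightarrow> ('u list \<Rightarrow>\<^sub>0 'k) set set \<Rightarrow> 'k poly" where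
  "wedge_ev \<phi> \<psi> = ext_ev 2 (\<lambda>j. if j = 0 then \<phi> else \<psi>)"

definition vol_ev :: "nat \<Rightarrow> ('u list \<Rightarrow>\<^sub>0 'k) set set \<Rightarrow> (nat \<Rightarrow> 'u \<Rightarrow> 'k::field poly) \<Rightarrow> 'k poly" where
  "vol_ev m \<omega> \<phi> = (\<Prod>j<m. \<Prod>i<j. wedge_ev (\<phi> i) (\<phi> j) \<omega>)"

abbreviation div_sym_ev ::
  "nat \<Rightarrow> nat \<Rightarrow> (nat \<Rightarrow> 'u \<Rightarrow> 'k::field poly) \<Rightarrow> (('u list \<Rightarrow>\<^sub>0 'k) set set list \<Rightarrow>\<^sub>0 'k) set \<Rightarrow> 'k poly" where
  "div_sym_ev m d \<phi> \<equiv> tens_ev m (\<lambda>i. sym_ev d (\<phi> i))"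

abbreviation ext_sym_ev ::
  "nat \<Rightarrow> nat \<Rightarrow> (nat \<Rightarrow> 'u \<Rightarrow> 'k::field poly) \<Rightarrow> (('u list \<Rightarrow>\<^sub>0 'k) set set list \<Rightarrow>\<^sub>0 'k) set set \<Rightarrow> 'k poly" where
  "ext_sym_ev m n \<phi> \<equiv> ext_ev m (\<lambda>i. sym_ev n (\<phi> i))"

abbreviation sym_div_ev ::
  "nat \<Rightarrow> nat \<Rightarrow> (nat \<Rightarrow> 'u \<Rightarrow> 'k::field poly) \<Rightarrow> (('u list \<Rightarrow>\<^sub>0 'k) set list \<Rightarrow>\<^sub>0 'k) set set \<Rightarrow> 'k poly" where
  "sym_div_ev d m \<phi> \<equiv> sym_ev d (tens_ev m \<phi>)"

lemma
  assumes "kmod U" "points U \<phi>"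
  shows lin_form_div_sym_ev: "lin_form (tensor_power m (Sym d U)) (div_sym_ev m d \<phi>)"
    and lin_form_ext_sym_ev: "lin_form (Ext m (Sym n U)) (ext_sym_ev m n \<phi>)"
    and lin_form_sym_div_ev: "lin_form (Sym d (Div m U)) (sym_div_ev d m \<phi>)"
  using assms
  by (simp_all add: lin_form_tens_ev lin_form_ext_ev lin_form_sym_ev lin_form_tens_ev_Div kmod_Sym kmod_Div)

text \<open>Says that a function of the point is a polynomial function of the kind that
  \<open>M\<close> parametrizes. Only existence is asked, so the property can be checked on
  generators and closed under sums.\<close>

definition realizes ::
  "('k::field, 'u) module \<Rightarrow> ('k, 'v) module \<Rightarrow> ((nat \<Rightarrow> 'u \<Rightarrow> 'k poly) \<Rightarrow> 'v \<Rightarrow> 'k poly) \<Rightarrow>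
    ((nat \<Rightarrow> 'u \<Rightarrow> 'k poly) \<Rightarrow> 'k poly) \<Rightarrow> bool" where
  "realizes U M ev F \<longleftrightarrow> (\<exists>t\<in>carrier M. \<forall>\<phi>. points U \<phi> \<longrightarrow> ev \<phi> t = F \<phi>)"

lemma realizes_generates:
  assumes M: "kmod M" "\<And>\<phi>. points U \<phi> \<Longrightarrow> lin_form M (ev \<phi>)"
    and M': "kmod M'" "generates M' G" "\<And>\<phi>. points U \<phi> \<Longrightarrow> lin_form M' (F \<phi>)"
    and G: "\<And>y. y \<in> G \<Longrightarrow> realizes U M ev (\<lambda>\<phi>. F \<phi> y)"
    and y: "y \<in> carrier M'"
  shows "realizes U M ev (\<lambda>\<phi>. F \<phi> y)"
  using M'(2) y
proof (rule generates_induct)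
  show "realizes U M ev (\<lambda>\<phi>. F \<phi> \<zero>\<^bsub>M'\<^esub>)"
    unfolding realizes_def
    by (intro bexI[of _ "\<zero>\<^bsub>M\<^esub>"]) (auto simp: lin_form_zero[OF M(2) M(1)] lin_form_zero[OF M'(3) M'(1)] M(1))
next
  fix x y assume xy: "x \<in> carrier M'" "y \<in> carrier M'"
    "realizes U M ev (\<lambda>\<phi>. F \<phi> x)" "realizes U M ev (\<lambda>\<phi>. F \<phi> y)"
  then obtain s t where "s \<in> carrier M" "t \<in> carrier M" "\<forall>\<phi>. points U \<phi> \<longrightarrow> ev \<phi> s = F \<phi> x"
    "\<forall>\<phi>. points U \<phi> \<longrightarrow> ev \<phi> t = F \<phi> y"
    unfolding realizes_def by blast
  then show "realizes U M ev (\<lambda>\<phi>. F \<phi> (x \<oplus>\<^bsub>M'\<^esub> y))"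
    unfolding realizes_def using xy
    by (intro bexI[of _ "s \<oplus>\<^bsub>M\<^esub> t"]) (auto simp: lin_form_add[OF M(2)] lin_form_add[OF M'(3)] M(1))
next
  fix c x assume x: "x \<in> carrier M'" "realizes U M ev (\<lambda>\<phi>. F \<phi> x)"
  then obtain s where "s \<in> carrier M" "\<forall>\<phi>. points U \<phi> \<longrightarrow> ev \<phi> s = F \<phi> x"
    unfolding realizes_def by blast
  then show "realizes U M ev (\<lambda>\<phi>. F \<phi> (c \<odot>\<^bsub>M'\<^esub> x))"
    unfolding realizes_def using x
    by (intro bexI[of _ "c \<odot>\<^bsub>M\<^esub> s"]) (auto simp: lin_form_smult[OF M(2)] lin_form_smult[OF M'(3)] M(1))
qed (use G M'(1) in auto)

lemma lin_form_mult_left: "lin_form M f \<Longrightarrow> lin_form M (\<lambda>x. p * f x)"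
  unfolding lin_form_def by (simp add: distrib_left)

lemma lin_form_mult_right: "lin_form M f \<Longrightarrow> lin_form M (\<lambda>x. f x * p)"
  unfolding lin_form_def by (simp add: distrib_right)

lemma lin_form_sum: "(\<And>s. s \<in> A \<Longrightarrow> lin_form M (f s)) \<Longrightarrow> lin_form M (\<lambda>x. \<Sum>s\<in>A. f s x)"
  unfolding lin_form_def by (simp add: sum.distrib smult_sum_right)

section \<open>Multiplying evaluations\<close>

context based_plane
begin

lemma sym_bas_closed: "a \<le> n \<Longrightarrow> sym_bas n a \<in> carrier (Sym n U)"
  using generates_sym_bas[of n] by (auto simp: generates_def)

lemma sym_bas_tuples: "as \<in> words m n \<Longrightarrow> map (sym_bas n) as \<in> tuples m (Sym n U)"
  by (auto simp: tuples_iff intro!: sym_bas_closed)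

lemma bas_tuples: "map bas as \<in> tuples (length as) U"
  using e_closed by (auto simp: tuples_iff bas_def)

lemma generates_bas_words: "generates (tensor_power m U) ((\<lambda>as. pure_tensor m U (map bas as)) ` words m 1)"
  using kronecker.generates_tensor_words[OF kronecker_bas[of 2]] by simp

lemma generates_sym_bas_words:
  "generates (tensor_power m (Sym d U)) ((\<lambda>as. pure_tensor m (Sym d U) (map (sym_bas d) as)) ` words m d)"
  by (rule kronecker.generates_tensor_words[OF kronecker_sym_bas[of d "d + 2"]]) auto

lemma div_sym_ev_word:
  assumes as: "as \<in> words m d" and \<phi>: "points U \<phi>"
  shows "div_sym_ev m d \<phi> (pure_tensor m (Sym d U) (map (sym_bas d) as)) =
    (\<Prod>i<m. \<phi> i e1 ^ (d - as ! i) * \<phi> i e2 ^ (as ! i))"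
proof -
  have \<phi>': "lin_form (Sym d U) (sym_ev d (\<phi> i))" for i
    using U \<phi> by (simp add: lin_form_sym_ev)
  have "div_sym_ev m d \<phi> (pure_tensor m (Sym d U) (map (sym_bas d) as)) =
      (\<Prod>i<m. sym_ev d (\<phi> i) (map (sym_bas d) as ! i))"
    using kmod_Sym[OF U] \<phi>' sym_bas_tuples[OF as] by (rule tens_ev_pure)
  also have "\<dots> = (\<Prod>i<m. \<phi> i e1 ^ (d - as ! i) * \<phi> i e2 ^ (as ! i))"
    using as words_nth[OF as] \<phi> by (intro prod.cong) (simp_all add: sym_ev_bas)
  finally show ?thesis .
qed

text \<open>Exponents add: a monomial of degree 1 in each pair of coordinates times one of degree
  \<open>d\<close> has degree \<open>Suc d\<close> in each.\<close>

lemma realizes_mult_word: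
  assumes as: "as \<in> words m 1" and bs: "bs \<in> words m d"
  shows "realizes U (tensor_power m (Sym (Suc d) U)) (div_sym_ev m (Suc d))
    (\<lambda>\<phi>. tens_ev m \<phi> (pure_tensor m U (map bas as)) *
      div_sym_ev m d \<phi> (pure_tensor m (Sym d U) (map (sym_bas d) bs)))"
proof -
  define cs where "cs = map (\<lambda>i. as ! i + bs ! i) [0..<m]"
  have le: "as ! i \<le> 1" "bs ! i \<le> d" if "i < m" for i
    using words_nth as bs that by blast+
  have cs: "cs \<in> words m (Suc d)"
    using add_mono[OF le] by (auto simp: cs_def)
  have "div_sym_ev m (Suc d) \<phi> (pure_tensor m (Sym (Suc d) U) (map (sym_bas (Suc d)) cs)) =
      tens_ev m \<phi> (pure_tensor m U (map bas as)) *
      div_sym_ev m d \<phi> (pure_tensor m (Sym d U) (map (sym_bas d) bs))" if \<phi>: "points U \<phi>" for \<phi>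
  proof -
    have "tens_ev m \<phi> (pure_tensor m U (map bas as)) = (\<Prod>i<m. \<phi> i (map bas as ! i))"
      using as \<phi> bas_tuples[of as] by (intro tens_ev_pure U) auto
    also have "\<dots> = (\<Prod>i<m. \<phi> i (bas (as ! i)))"
      using as by (intro prod.cong) auto
    finally have u: "tens_ev m \<phi> (pure_tensor m U (map bas as)) = (\<Prod>i<m. \<phi> i (bas (as ! i)))" .
    have "\<phi> i e1 ^ (Suc d - cs ! i) * \<phi> i e2 ^ (cs ! i) =
        \<phi> i (bas (as ! i)) * (\<phi> i e1 ^ (d - bs ! i) * \<phi> i e2 ^ (bs ! i))" if i: "i < m" for i
    proof (cases "as ! i = 0")
      case True
      then show ?thesis
        using le[OF i] i by (simp add: cs_def bas_def Suc_diff_le mult_ac)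
    next
      case False
      then have "as ! i = 1"
        using le[OF i] by simp
      then show ?thesis
        using i by (simp add: cs_def bas_def mult_ac)
    qed
    then show ?thesis
      unfolding div_sym_ev_word[OF bs \<phi>] div_sym_ev_word[OF cs \<phi>] u prod.distrib[symmetric]
      by (intro prod.cong) auto
  qed
  moreover have "pure_tensor m (Sym (Suc d) U) (map (sym_bas (Suc d)) cs) \<in> carrier (tensor_power m (Sym (Suc d) U))"
    by (intro pure_closed kmod_Sym U sym_bas_tuples cs)
  ultimately show ?thesis
    unfolding realizes_def by blast
qed

lemma realizes_mult:
  assumes u: "u \<in> carrier (tensor_power m U)" and t: "t \<in> carrier (tensor_power m (Sym d U))"
  shows "realizes U (tensor_power m (Sym (Suc d) U)) (div_sym_ev m (Suc d))
    (\<lambda>\<phi>. tens_ev m \<phi> u * div_sym_ev m d \<phi> t)"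
proof (rule realizes_generates[where F = "\<lambda>\<phi> u. tens_ev m \<phi> u * div_sym_ev m d \<phi> t", OF _ _ _ generates_bas_words _ _ u])
  fix u assume "u \<in> (\<lambda>as. pure_tensor m U (map bas as)) ` words m 1"
  then obtain as where as: "as \<in> words m 1" "u = pure_tensor m U (map bas as)"
    by blast
  show "realizes U (tensor_power m (Sym (Suc d) U)) (div_sym_ev m (Suc d))
    (\<lambda>\<phi>. tens_ev m \<phi> u * div_sym_ev m d \<phi> t)"
  proof (rule realizes_generates[where F = "\<lambda>\<phi> t. tens_ev m \<phi> u * div_sym_ev m d \<phi> t", OF _ _ _ generates_sym_bas_words _ _ t])
    fix t assume "t \<in> (\<lambda>as. pure_tensor m (Sym d U) (map (sym_bas d) as)) ` words m d"
    then obtain bs where bs: "bs \<in> words m d" "t = pure_tensor m (Sym d U) (map (sym_bas d) bs)"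
      by blast
    show "realizes U (tensor_power m (Sym (Suc d) U)) (div_sym_ev m (Suc d))
      (\<lambda>\<phi>. tens_ev m \<phi> u * div_sym_ev m d \<phi> t)"
      unfolding as(2) bs(2) using as(1) bs(1) by (rule realizes_mult_word)
  qed (use U in \<open>simp_all add: kmod_tensor kmod_Sym lin_form_div_sym_ev lin_form_mult_left\<close>)
qed (use U in \<open>simp_all add: kmod_tensor kmod_Sym lin_form_div_sym_ev lin_form_mult_right lin_form_tens_ev\<close>)

lemma realizes_prod:
  "set ts \<subseteq> carrier (tensor_power m U) \<Longrightarrow>
    realizes U (tensor_power m (Sym (length ts) U)) (div_sym_ev m (length ts)) (\<lambda>\<phi>. prod_list (map (tens_ev m \<phi>) ts))"
proof (induction ts)
  case Nil
  \<comment> \<open>The empty product is represented by the word of zero exponents, whose evaluation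
    is 1.\<close>
  have w: "replicate m 0 \<in> words m 0"
    by auto
  have "pure_tensor m (Sym 0 U) (map (sym_bas 0) (replicate m 0)) \<in> carrier (tensor_power m (Sym 0 U))"
    by (intro pure_closed kmod_Sym U sym_bas_tuples w)
  then show ?case
    unfolding realizes_def using div_sym_ev_word[OF w] by (intro bexI) auto
next
  case (Cons u ts)
  then obtain t where t: "t \<in> carrier (tensor_power m (Sym (length ts) U))"
    "\<forall>\<phi>. points U \<phi> \<longrightarrow> div_sym_ev m (length ts) \<phi> t = prod_list (map (tens_ev m \<phi>) ts)"
    unfolding realizes_def by auto
  have "u \<in> carrier (tensor_power m U)"
    using Cons.prems by simp
  from realizes_mult[OF this t(1)] show ?case
    using t(2) unfolding realizes_def by auto
qed

lemma sym_div_ev_permute: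
  assumes "points U \<phi>" "\<sigma> permutes {..<m}" "z \<in> carrier (Sym d (Div m U))"
  shows "sym_div_ev d m (\<lambda>i. \<phi> (\<sigma> i)) z = sym_div_ev d m \<phi> z"
  using assms U
  by (intro sym_ev_cong[where V = "Div m U"])
    (simp_all add: kmod_Div lin_form_tens_ev_Div tens_ev_Div_permute)

text \<open>A product of \<open>d\<close> symmetric polynomials of degree at most 1 in each variable
  is symmetric and of degree at most \<open>d\<close> in each. The product is first found among all
  tensors, and its invariance follows afterwards from the symmetry of its values.\<close>

lemma sym_div_image:
  assumes z: "z \<in> carrier (Sym d (Div m U))"
  shows "\<exists>t\<in>carrier (Div m (Sym d U)). \<forall>\<phi>. points U \<phi> \<longrightarrow> div_sym_ev m d \<phi> t = sym_div_ev d m \<phi> z"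
proof -
  have "realizes U (tensor_power m (Sym d U)) (div_sym_ev m d) (\<lambda>\<phi>. sym_div_ev d m \<phi> z)"
  proof (rule realizes_generates[where F = "sym_div_ev d m", OF _ _ _ generates_sym_prod_tuples[OF kmod_Div[OF U]] _ _ z])
    fix z assume "z \<in> sym_prod d (Div m U) ` tuples d (Div m U)"
    then obtain ts where ts: "ts \<in> tuples d (Div m U)" "z = sym_prod d (Div m U) ts"
      by blast
    then have "set ts \<subseteq> carrier (tensor_power m U)" "length ts = d"
      by (auto simp: tuples_iff Div_carrier)
    then have "realizes U (tensor_power m (Sym d U)) (div_sym_ev m d) (\<lambda>\<phi>. prod_list (map (tens_ev m \<phi>) ts))"
      using realizes_prod[of ts m] by simp
    moreover have "sym_div_ev d m \<phi> z = prod_list (map (tens_ev m \<phi>) ts)" if "points U \<phi>" for \<phi>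
    proof -
      have "lin_form (Div m U) (tens_ev m \<phi>)"
        using U that by (simp add: lin_form_tens_ev_Div)
      then show ?thesis
        using ts \<open>length ts = d\<close> by (simp add: sym_ev_prod kmod_Div U prod_nth)
    qed
    ultimately show "realizes U (tensor_power m (Sym d U)) (div_sym_ev m d) (\<lambda>\<phi>. sym_div_ev d m \<phi> z)"
      unfolding realizes_def by simp
  qed (use U in \<open>simp_all add: kmod_tensor kmod_Sym kmod_Div lin_form_div_sym_ev lin_form_sym_div_ev\<close>)
  then obtain t where t: "t \<in> carrier (tensor_power m (Sym d U))"
    "\<And>\<phi>. points U \<phi> \<Longrightarrow> div_sym_ev m d \<phi> t = sym_div_ev d m \<phi> z"
    unfolding realizes_def by blast
  interpret kronecker "Sym d U" "sym_bas d" m d "d + 2" "\<lambda>i. sym_ev d (kpt (d + 2) i)"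
    by (rule kronecker_sym_bas) auto
  have "tensor_permute m (Sym d U) \<sigma> t = t" if \<sigma>: "\<sigma> permutes {..<m}" for \<sigma>
  proof (rule tens_ev_eqD[OF _ t(1)])
    show "tensor_permute m (Sym d U) \<sigma> t \<in> carrier (tensor_power m (Sym d U))"
      using tensor_permute_lin_maps[OF V \<sigma>] t(1) by (rule lin_maps_closed)
    let ?\<kappa> = "kpt (d + 2)"
    have "div_sym_ev m d ?\<kappa> (tensor_permute m (Sym d U) \<sigma> t) = div_sym_ev m d (\<lambda>i. ?\<kappa> (inv_into UNIV \<sigma> i)) t"
      using V f \<sigma> t(1) by (rule tens_ev_permute)
    also have "\<dots> = sym_div_ev d m (\<lambda>i. ?\<kappa> (inv_into UNIV \<sigma> i)) z"
      by (rule t(2)) (simp add: kpt)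
    also have "\<dots> = sym_div_ev d m ?\<kappa> z"
      by (rule sym_div_ev_permute) (simp_all add: kpt permutes_inv \<sigma> z)
    also have "\<dots> = div_sym_ev m d ?\<kappa> t"
      by (rule t(2)[symmetric]) (simp add: kpt)
    finally show "div_sym_ev m d ?\<kappa> (tensor_permute m (Sym d U) \<sigma> t) = div_sym_ev m d ?\<kappa> t" .
  qed
  then show ?thesis
    using t by (intro bexI[of _ t]) (auto simp: Div_carrier)
qed

abbreviation vandermonde :: "nat \<Rightarrow> (nat \<Rightarrow> 'u \<Rightarrow> 'k poly) \<Rightarrow> 'k poly" where
  "vandermonde m \<phi> \<equiv> (\<Prod>j<m. \<Prod>i<j. \<phi> i e1 * \<phi> j e2 - \<phi> j e1 * \<phi> i e2)"

lemma vandermonde_eq: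
  "vandermonde m \<phi> = (\<Sum>\<sigma> | \<sigma> permutes {..<m}. signof \<sigma> * (\<Prod>i<m. \<phi> (\<sigma> i) e1 ^ (m - 1 - i) * \<phi> (\<sigma> i) e2 ^ i))"
proof -
  have "vandermonde m \<phi> = dform m (\<lambda>j i. \<phi> j e1 ^ (m - 1 - i) * \<phi> j e2 ^ i) [0..<m]"
    unfolding det_vandermonde[symmetric] dform_def by (intro arg_cong[where f = det] eq_matI) auto
  also have "\<dots> = (\<Sum>\<sigma> | \<sigma> permutes {..<m}. signof \<sigma> * (\<Prod>i<m. \<phi> (\<sigma> i) e1 ^ (m - 1 - i) * \<phi> (\<sigma> i) e2 ^ i))"
    unfolding dform_eq pform_def by simp
  finally show ?thesis .
qed

lemma wedge_ev_bas:
  assumes "lin_form U \<phi>" "lin_form U \<psi>"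
  shows "wedge_ev \<phi> \<psi> (ext_prod 2 U [e1, e2]) = \<phi> e1 * \<psi> e2 - \<psi> e1 * \<phi> e2"
proof -
  let ?f = "\<lambda>j::nat. if j = 0 then \<phi> else \<psi>"
  have "wedge_ev \<phi> \<psi> (ext_prod 2 U [e1, e2]) = dform 2 ?f [e1, e2]"
    unfolding wedge_ev_def using assms e_closed by (intro ext_ev_prod U) (auto simp: tuples_iff)
  also have "\<dots> = det (mat 2 2 (\<lambda>(i, j). ?f j e1 ^ (2 - 1 - i) * ?f j e2 ^ i))"
    unfolding dform_def by (intro arg_cong[where f = det] eq_matI) (auto simp: less_Suc_eq numeral_2_eq_2)
  also have "\<dots> = \<phi> e1 * \<psi> e2 - \<psi> e1 * \<phi> e2"
    unfolding det_vandermonde by (simp add: numeral_2_eq_2)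
  finally show ?thesis .
qed

lemma vol_ev_bas: "points U \<phi> \<Longrightarrow> vol_ev m (ext_prod 2 U [e1, e2]) \<phi> = vandermonde m \<phi>"
  by (simp add: vol_ev_def wedge_ev_bas)

lemma realizes_ext:
  assumes t: "t \<in> carrier (tensor_power m (Sym d U))" and dn: "d + m = n + 1"
  shows "realizes U (Ext m (Sym n U)) (ext_sym_ev m n) (\<lambda>\<phi>. \<Sum>\<sigma> | \<sigma> permutes {..<m}.
    signof \<sigma> * (\<Prod>i<m. \<phi> (\<sigma> i) e1 ^ (m - 1 - i) * \<phi> (\<sigma> i) e2 ^ i) * div_sym_ev m d (\<lambda>i. \<phi> (\<sigma> i)) t)"
    (is "realizes U ?M ?ev (\<lambda>\<phi>. ?F \<phi> t)")
proof (rule realizes_generates[where F = ?F, OF _ _ _ generates_sym_bas_words _ _ t])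
  fix t assume "t \<in> (\<lambda>as. pure_tensor m (Sym d U) (map (sym_bas d) as)) ` words m d"
  then obtain as where as: "as \<in> words m d" "t = pure_tensor m (Sym d U) (map (sym_bas d) as)"
    by blast
  define bs where "bs = map (\<lambda>i. as ! i + i) [0..<m]"
  have bs: "bs \<in> words m n"
    using words_nth[OF as(1)] dn by (force simp: bs_def)
  have "ext_sym_ev m n \<phi> (ext_prod m (Sym n U) (map (sym_bas n) bs)) = ?F \<phi> t" if \<phi>: "points U \<phi>" for \<phi>
  proof -
    have "ext_sym_ev m n \<phi> (ext_prod m (Sym n U) (map (sym_bas n) bs)) =
        dform m (\<lambda>i. sym_ev n (\<phi> i)) (map (sym_bas n) bs)"
      using U \<phi> by (intro ext_ev_prod kmod_Sym sym_bas_tuples bs) (auto simp: lin_form_sym_ev)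
    also have "\<dots> = ?F \<phi> t"
      unfolding dform_eq
    proof (rule sum.cong)
      fix \<sigma> :: "nat \<Rightarrow> nat"
      have \<phi>\<sigma>: "points U (\<lambda>i. \<phi> (\<sigma> i))"
        using \<phi> by simp
      have "pform m (\<lambda>i. sym_ev n (\<phi> (\<sigma> i))) (map (sym_bas n) bs) =
          (\<Prod>i<m. (\<phi> (\<sigma> i) e1 ^ (m - 1 - i) * \<phi> (\<sigma> i) e2 ^ i) *
            (\<phi> (\<sigma> i) e1 ^ (d - as ! i) * \<phi> (\<sigma> i) e2 ^ (as ! i)))"
        unfolding pform_def
      proof (rule prod.cong)
        fix i assume "i \<in> {..<m}"
        then have i: "i < m" "as ! i \<le> d" "n - (as ! i + i) = (m - 1 - i) + (d - as ! i)" "as ! i + i \<le> n"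
          using words_nth[OF as(1), of i] dn by auto
        have "sym_ev n (\<phi> (\<sigma> i)) (map (sym_bas n) bs ! i) =
            \<phi> (\<sigma> i) e1 ^ (n - (as ! i + i)) * \<phi> (\<sigma> i) e2 ^ (as ! i + i)"
          using \<phi> i by (simp add: bs_def sym_ev_bas)
        then show "sym_ev n (\<phi> (\<sigma> i)) (map (sym_bas n) bs ! i) =
            (\<phi> (\<sigma> i) e1 ^ (m - 1 - i) * \<phi> (\<sigma> i) e2 ^ i) * (\<phi> (\<sigma> i) e1 ^ (d - as ! i) * \<phi> (\<sigma> i) e2 ^ (as ! i))"
          by (simp only: i(3) power_add mult_ac)
      qed simp
      also have "\<dots> = (\<Prod>i<m. \<phi> (\<sigma> i) e1 ^ (m - 1 - i) * \<phi> (\<sigma> i) e2 ^ i) * div_sym_ev m d (\<lambda>i. \<phi> (\<sigma> i)) t"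
        unfolding as(2) div_sym_ev_word[OF as(1) \<phi>\<sigma>] by (rule prod.distrib)
      finally show "signof \<sigma> * pform m (\<lambda>i. sym_ev n (\<phi> (\<sigma> i))) (map (sym_bas n) bs) =
          signof \<sigma> * (\<Prod>i<m. \<phi> (\<sigma> i) e1 ^ (m - 1 - i) * \<phi> (\<sigma> i) e2 ^ i) * div_sym_ev m d (\<lambda>i. \<phi> (\<sigma> i)) t"
        by (simp add: mult.assoc)
    qed simp
    finally show ?thesis .
  qed
  moreover have "ext_prod m (Sym n U) (map (sym_bas n) bs) \<in> carrier (Ext m (Sym n U))"
    by (intro ext_prod_closed kmod_Sym U sym_bas_tuples bs)
  ultimately show "realizes U ?M ?ev (\<lambda>\<phi>. ?F \<phi> t)"
    unfolding realizes_def by blast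
qed (use U in \<open>simp_all add: kmod_tensor kmod_Sym kmod_Ext lin_form_ext_sym_ev lin_form_div_sym_ev
       lin_form_sum lin_form_mult_left\<close>)

lemma ext_image:
  assumes z: "z \<in> carrier (Sym d (Div m U))" and dn: "d + m = n + 1"
  shows "\<exists>x\<in>carrier (Ext m (Sym n U)). \<forall>\<phi>. points U \<phi> \<longrightarrow>
    ext_sym_ev m n \<phi> x = sym_div_ev d m \<phi> z * vandermonde m \<phi>"
proof -
  obtain t where t: "t \<in> carrier (Div m (Sym d U))"
    "\<And>\<phi>. points U \<phi> \<Longrightarrow> div_sym_ev m d \<phi> t = sym_div_ev d m \<phi> z"
    using sym_div_image[OF z] by blast
  have "t \<in> carrier (tensor_power m (Sym d U))"
    using t(1) by (simp add: Div_carrier)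
  from realizes_ext[OF this dn] obtain x where x: "x \<in> carrier (Ext m (Sym n U))"
    "\<And>\<phi>. points U \<phi> \<Longrightarrow> ext_sym_ev m n \<phi> x = (\<Sum>\<sigma> | \<sigma> permutes {..<m}.
      signof \<sigma> * (\<Prod>i<m. \<phi> (\<sigma> i) e1 ^ (m - 1 - i) * \<phi> (\<sigma> i) e2 ^ i) * div_sym_ev m d (\<lambda>i. \<phi> (\<sigma> i)) t)"
    unfolding realizes_def by blast
  have "ext_sym_ev m n \<phi> x = sym_div_ev d m \<phi> z * vandermonde m \<phi>" if \<phi>: "points U \<phi>" for \<phi>
  proof -
    have "div_sym_ev m d (\<lambda>i. \<phi> (\<sigma> i)) t = sym_div_ev d m \<phi> z" if "\<sigma> permutes {..<m}" for \<sigma>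
      using t(2)[of "\<lambda>i. \<phi> (\<sigma> i)"] sym_div_ev_permute[OF \<phi> that z] \<phi> by simp
    then have "ext_sym_ev m n \<phi> x = (\<Sum>\<sigma> | \<sigma> permutes {..<m}.
      signof \<sigma> * (\<Prod>i<m. \<phi> (\<sigma> i) e1 ^ (m - 1 - i) * \<phi> (\<sigma> i) e2 ^ i) * sym_div_ev d m \<phi> z)"
      unfolding x(2)[OF \<phi>] by (intro sum.cong) auto
    then show ?thesis
      unfolding vandermonde_eq sum_distrib_left by (simp only: mult_ac)
  qed
  then show ?thesis
    using x(1) by blast
qed

end

subsection \<open>Comparing two spaces by their evaluations\<close>

locale evaluation =
  fixes M :: "('k::field, 'a) module" and Z :: "('k, 'b) module" and pts :: "'p \<Rightarrow> bool"
    and F :: "'p \<Rightarrow> 'a \<Rightarrow> 'k poly" and G :: "'p \<Rightarrow> 'b \<Rightarrow> 'k poly" and D :: "'p \<Rightarrow> 'k poly" and \<kappa> :: 'p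
  assumes M: "kmod M" and Z: "kmod Z"
    and F: "\<And>p. pts p \<Longrightarrow> lin_form M (F p)" and G: "\<And>p. pts p \<Longrightarrow> lin_form Z (G p)"
    and \<kappa>: "pts \<kappa>" "D \<kappa> \<noteq> 0"
    and F_inj: "\<And>x. \<lbrakk>x \<in> carrier M; F \<kappa> x = 0\<rbrakk> \<Longrightarrow> x = \<zero>\<^bsub>M\<^esub>"
    and G_inj: "\<And>z. \<lbrakk>z \<in> carrier Z; G \<kappa> z = 0\<rbrakk> \<Longrightarrow> z = \<zero>\<^bsub>Z\<^esub>"
    and incl: "\<And>z. z \<in> carrier Z \<Longrightarrow> \<exists>x\<in>carrier M. \<forall>p. pts p \<longrightarrow> F p x = G p z * D p"
    and deg: "\<And>x. \<lbrakk>x \<in> carrier M; F \<kappa> x \<noteq> 0\<rbrakk> \<Longrightarrow>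
      \<exists>z\<in>carrier Z. G \<kappa> z \<noteq> 0 \<and> degree (G \<kappa> z) + degree (D \<kappa>) = degree (F \<kappa> x)"
begin

definition related :: "'a \<Rightarrow> 'b \<Rightarrow> bool" where
  "related x z \<longleftrightarrow> z \<in> carrier Z \<and> (\<forall>p. pts p \<longrightarrow> G p z * D p = F p x)"

lemma form_eqD:
  assumes "lin_form A f" "kmod A" "\<And>x. \<lbrakk>x \<in> carrier A; f x = 0\<rbrakk> \<Longrightarrow> x = \<zero>\<^bsub>A\<^esub>"
    "x \<in> carrier A" "y \<in> carrier A" "f x = f y"
  shows "x = y"
proof -
  have "x \<ominus>\<^bsub>A\<^esub> y = \<zero>\<^bsub>A\<^esub>"
    using assms by (simp add: lin_form_minus)
  then show ?thesis
    using assms by (simp add: kmod_minus_eq_zero)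
qed

lemma related_unique: "\<lbrakk>related x z; related x z'\<rbrakk> \<Longrightarrow> z = z'"
  using form_eqD[OF G[OF \<kappa>(1)] Z G_inj] \<kappa> unfolding related_def by (metis mult_right_cancel)

lemma related_inj:
  assumes "related x z" "related x' z" "x \<in> carrier M" "x' \<in> carrier M"
  shows "x = x'"
proof (rule form_eqD[OF F[OF \<kappa>(1)] M F_inj assms(3,4)])
  have "F \<kappa> x = G \<kappa> z * D \<kappa>" "F \<kappa> x' = G \<kappa> z * D \<kappa>"
    using assms(1,2) \<kappa>(1) by (simp_all add: related_def)
  then show "F \<kappa> x = F \<kappa> x'"
    by simp
qed

lemma related_exists:
  assumes x: "x \<in> carrier M"
  shows "\<exists>z. related x z"
proof -
  let ?N = "{x \<in> carrier M. \<exists>z. related x z}"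
  have N: "subsp M ?N"
  proof (rule subspI)
    show "\<zero>\<^bsub>M\<^esub> \<in> ?N"
      using M Z lin_form_zero[OF F M] lin_form_zero[OF G Z]
      by (auto simp: related_def intro!: exI[of _ "\<zero>\<^bsub>Z\<^esub>"])
    show "x \<oplus>\<^bsub>M\<^esub> y \<in> ?N" if xy: "x \<in> ?N" "y \<in> ?N" for x y
    proof -
      obtain z w where zw: "related x z" "related y w"
        using xy by blast
      then have "related (x \<oplus>\<^bsub>M\<^esub> y) (z \<oplus>\<^bsub>Z\<^esub> w)"
        using xy Z by (simp add: related_def lin_form_add[OF F] lin_form_add[OF G] distrib_right)
      then show ?thesis
        using xy M by auto
    qed
    show "c \<odot>\<^bsub>M\<^esub> x \<in> ?N" if x: "x \<in> ?N" for c x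
    proof -
      obtain z where "related x z"
        using x by blast
      then have "related (c \<odot>\<^bsub>M\<^esub> x) (c \<odot>\<^bsub>Z\<^esub> z)"
        using x Z by (simp add: related_def lin_form_smult[OF F] lin_form_smult[OF G])
      then show ?thesis
        using x M by auto
    qed
  qed blast
  have "\<exists>y\<in>?N. F \<kappa> y = F \<kappa> x"
  proof (rule echelon[OF M F[OF \<kappa>(1)] N _ x])
    fix x assume "x \<in> carrier M" "F \<kappa> x \<noteq> 0"
    then obtain z where z: "z \<in> carrier Z" "G \<kappa> z \<noteq> 0" "degree (G \<kappa> z) + degree (D \<kappa>) = degree (F \<kappa> x)"
      using deg by blast
    then obtain y where y: "y \<in> carrier M" "\<And>p. pts p \<Longrightarrow> F p y = G p z * D p"
      using incl by blast
    then have "related y z"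
      using z by (simp add: related_def)
    then show "\<exists>y\<in>?N. F \<kappa> y \<noteq> 0 \<and> degree (F \<kappa> y) = degree (F \<kappa> x)"
      using y z \<kappa> by (intro bexI[of _ y]) (auto simp: degree_mult_eq)
  qed
  then obtain y where "y \<in> ?N" "F \<kappa> y = F \<kappa> x"
    by blast
  moreover from this have "y = x"
    using form_eqD[OF F[OF \<kappa>(1)] M F_inj _ x] by blast
  ultimately show ?thesis
    by blast
qed

lemma The_related: "x \<in> carrier M \<Longrightarrow> related x (The (related x))"
  using related_exists related_unique by (metis theI)

lemma The_related_eq: "related x z \<Longrightarrow> The (related x) = z"
  using related_unique by blast

lemma The_related_iso: "(\<lambda>x. The (related x)) \<in> lin_isos M Z"
proof -
  have "(\<lambda>x. The (related x)) \<in> lin_maps M Z"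
  proof (rule lin_mapsI)
    show "The (related x) \<in> carrier Z" if "x \<in> carrier M" for x
      using The_related[OF that] by (simp add: related_def)
    show "The (related (x \<oplus>\<^bsub>M\<^esub> y)) = The (related x) \<oplus>\<^bsub>Z\<^esub> The (related y)"
      if "x \<in> carrier M" "y \<in> carrier M" for x y
      using The_related[OF that(1)] The_related[OF that(2)] that Z
      by (intro The_related_eq) (simp add: related_def lin_form_add[OF F] lin_form_add[OF G] distrib_right)
    show "The (related (c \<odot>\<^bsub>M\<^esub> x)) = c \<odot>\<^bsub>Z\<^esub> The (related x)" if "x \<in> carrier M" for c x
      using The_related[OF that] that Z
      by (intro The_related_eq) (simp add: related_def lin_form_smult[OF F] lin_form_smult[OF G])
  qed
  moreover have "bij_betw (\<lambda>x. The (related x)) (carrier M) (carrier Z)"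
  proof (rule bij_betw_imageI)
    show "inj_on (\<lambda>x. The (related x)) (carrier M)"
      using The_related related_inj by (metis (no_types, lifting) inj_onI)
    show "(\<lambda>x. The (related x)) ` carrier M = carrier Z"
    proof (intro equalityI subsetI)
      show "z \<in> carrier Z" if "z \<in> (\<lambda>x. The (related x)) ` carrier M" for z
        using that The_related by (auto simp: related_def)
      fix z assume z: "z \<in> carrier Z"
      then obtain x where x: "x \<in> carrier M" "\<And>p. pts p \<Longrightarrow> F p x = G p z * D p"
        using incl by blast
      then have "The (related x) = z"
        using z by (intro The_related_eq) (simp add: related_def)
      then show "z \<in> (\<lambda>x. The (related x)) ` carrier M"
        using x(1) by blast
    qed
  qed
  ultimately show ?thesis
    by (simp add: lin_isos_def)
qed

end

context based_plane
begin

lemma vandermonde_degree: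
  assumes N: "m < N" "2 \<le> N"
  shows "vandermonde m (kpt N) \<noteq> 0" and "degree (vandermonde m (kpt N)) = (\<Sum>j<m. j * N ^ j)"
proof -
  have fac: "kpt N i e1 * kpt N j e2 - kpt N j e1 * kpt N i e2 \<noteq> 0"
    "degree (kpt N i e1 * kpt N j e2 - kpt N j e1 * kpt N i e2) = N ^ j" if "i < j" for i j
  proof -
    have less: "N ^ i < N ^ j"
      using that N by (intro power_strict_increasing) auto
    have eq: "kpt N i e1 * kpt N j e2 - kpt N j e1 * kpt N i e2 = monom 1 (N ^ j) + (- monom 1 (N ^ i))"
      by (simp add: kpt)
    have "degree (monom (1::'k) (N ^ j) + (- monom 1 (N ^ i))) = N ^ j"
      using less by (subst degree_add_eq_left) (simp_all add: degree_monom_eq)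
    then show "degree (kpt N i e1 * kpt N j e2 - kpt N j e1 * kpt N i e2) = N ^ j"
      by (simp only: eq)
    then show "kpt N i e1 * kpt N j e2 - kpt N j e1 * kpt N i e2 \<noteq> 0"
      using less N by auto
  qed
  then have nz: "(\<Prod>i<j. kpt N i e1 * kpt N j e2 - kpt N j e1 * kpt N i e2) \<noteq> 0" for j
    by auto
  then show "vandermonde m (kpt N) \<noteq> 0"
    by auto
  have "degree (vandermonde m (kpt N)) = (\<Sum>j<m. degree (\<Prod>i<j. kpt N i e1 * kpt N j e2 - kpt N j e1 * kpt N i e2))"
    using nz by (intro degree_prod_eq_sum_degree) auto
  also have "\<dots> = (\<Sum>j<m. j * N ^ j)"
  proof (rule sum.cong)
    fix j
    have "degree (\<Prod>i<j. kpt N i e1 * kpt N j e2 - kpt N j e1 * kpt N i e2) =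
        (\<Sum>i<j. degree (kpt N i e1 * kpt N j e2 - kpt N j e1 * kpt N i e2))"
      using fac by (intro degree_prod_eq_sum_degree) auto
    also have "\<dots> = j * N ^ j"
      using fac by simp
    finally show "degree (\<Prod>i<j. kpt N i e1 * kpt N j e2 - kpt N j e1 * kpt N i e2) = j * N ^ j" .
  qed simp
  finally show "degree (vandermonde m (kpt N)) = (\<Sum>j<m. j * N ^ j)" .
qed

lemma evaluation_div_sym:
  "evaluation (Div m (Sym d U)) (Sym d (Div m U)) (points U) (div_sym_ev m d) (sym_div_ev d m) (\<lambda>_. 1) (kpt (d + 2))"
proof -
  interpret kronecker "Sym d U" "sym_bas d" m d "d + 2" "\<lambda>i. sym_ev d (kpt (d + 2) i)"
    by (rule kronecker_sym_bas) auto
  show ?thesis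
  proof (rule evaluation.intro)
    show "\<exists>x\<in>carrier (Div m (Sym d U)). \<forall>p. points U p \<longrightarrow> div_sym_ev m d p x = sym_div_ev d m p z * 1"
      if "z \<in> carrier (Sym d (Div m U))" for z
      using sym_div_image[OF that] by simp
    show "\<exists>z\<in>carrier (Sym d (Div m U)). sym_div_ev d m (kpt (d + 2)) z \<noteq> 0 \<and>
        degree (sym_div_ev d m (kpt (d + 2)) z) + degree (1 :: 'k poly) = degree (div_sym_ev m d (kpt (d + 2)) x)"
      if x: "x \<in> carrier (Div m (Sym d U))" "div_sym_ev m d (kpt (d + 2)) x \<noteq> 0" for x
    proof -
      obtain as where "as \<in> words m d" "sorted as" "degree (div_sym_ev m d (kpt (d + 2)) x) = digits (d + 2) as"
        using Div_degree[OF x] by blast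
      then show ?thesis
        using sym_div_exists[of "d + 2" as m d] by auto
    qed
    show "x = \<zero>\<^bsub>Div m (Sym d U)\<^esub>" if "x \<in> carrier (Div m (Sym d U))" "div_sym_ev m d (kpt (d + 2)) x = 0" for x
      using that tens_ev_inj by (simp add: Div_carrier)
    show "z = \<zero>\<^bsub>Sym d (Div m U)\<^esub>"
      if "z \<in> carrier (Sym d (Div m U))" "sym_div_ev d m (kpt (d + 2)) z = 0" for z
      using that by (intro sym_div_ev_inj[of "d + 2"]) auto
  qed (use U in \<open>simp_all add: kmod_Div kmod_Sym kpt lin_form_Div lin_form_div_sym_ev lin_form_sym_div_ev\<close>)
qed

lemma strict_word_minus:
  assumes as: "as \<in> words m n" "sorted as" "distinct as" and dn: "d + m = n + 1"
  defines "bs \<equiv> map (\<lambda>i. as ! i - i) [0..<m]"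
  shows "bs \<in> words m d" "sorted bs" "digits N bs + (\<Sum>j<m. j * N ^ j) = digits N as"
proof -
  have len: "length as = m"
    using as by simp
  have strict: "as ! i < as ! Suc i" if "Suc i < m" for i
    using that as(2,3) len sorted_nth_mono[of as i "Suc i"] nth_eq_iff_index_eq[of as i "Suc i"] by force
  have ge: "i \<le> as ! i" if "i < m" for i
    using that by (induction i) (use strict in \<open>auto simp: Suc_le_eq intro: le_less_trans\<close>)
  have mono: "as ! i - i \<le> as ! Suc i - Suc i" if "Suc i < m" for i
    using strict[OF that] ge[of i] that by linarith
  have mono': "as ! i - i \<le> as ! j - j" if "i \<le> j" "j < m" for i j
    using that by (induction j rule: dec_induct) (use mono in \<open>auto intro: order_trans\<close>)
  show "sorted bs"
    by (auto simp: bs_def sorted_iff_nth_mono mono')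
  have "as ! i - i \<le> d" if "i < m" for i
  proof -
    have "i \<le> m - 1" "m - 1 < m"
      using that by auto
    then show ?thesis
      using mono'[of i "m - 1"] words_nth[OF as(1), of "m - 1"] dn by linarith
  qed
  then show "bs \<in> words m d"
    by (auto simp: bs_def)
  show "digits N bs + (\<Sum>j<m. j * N ^ j) = digits N as"
  proof -
    have "digits N bs + (\<Sum>j<m. j * N ^ j) = (\<Sum>i<m. (as ! i - i) * N ^ i + i * N ^ i)"
      unfolding bs_def digits_map_upt by (rule sum.distrib[symmetric])
    also have "\<dots> = digits N as"
      unfolding digits_def len using ge by (intro sum.cong) (simp_all flip: add_mult_distrib)
    finally show ?thesis .
  qed
qed

lemma evaluation_ext:
  assumes dn: "d + m = n + 1"
  shows "evaluation (Ext m (Sym n U)) (Sym d (Div m U)) (points U) (ext_sym_ev m n) (sym_div_ev d m)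
    (vol_ev m (ext_prod 2 U [e1, e2])) (kpt (n + 2))"
proof -
  interpret kronecker "Sym n U" "sym_bas n" m n "n + 2" "\<lambda>i. sym_ev n (kpt (n + 2) i)"
    by (rule kronecker_sym_bas) auto
  have pt: "points U (kpt (n + 2))"
    by (simp add: kpt)
  show ?thesis
  proof (rule evaluation.intro)
    show "\<exists>x\<in>carrier (Ext m (Sym n U)). \<forall>p. points U p \<longrightarrow>
        ext_sym_ev m n p x = sym_div_ev d m p z * vol_ev m (ext_prod 2 U [e1, e2]) p"
      if "z \<in> carrier (Sym d (Div m U))" for z
      using ext_image[OF that dn] by (simp add: vol_ev_bas)
    show "vol_ev m (ext_prod 2 U [e1, e2]) (kpt (n + 2)) \<noteq> 0"
      unfolding vol_ev_bas[OF pt] using dn by (intro vandermonde_degree) auto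
    show "\<exists>z\<in>carrier (Sym d (Div m U)). sym_div_ev d m (kpt (n + 2)) z \<noteq> 0 \<and>
        degree (sym_div_ev d m (kpt (n + 2)) z) + degree (vol_ev m (ext_prod 2 U [e1, e2]) (kpt (n + 2))) =
        degree (ext_sym_ev m n (kpt (n + 2)) x)"
      if x: "x \<in> carrier (Ext m (Sym n U))" "ext_sym_ev m n (kpt (n + 2)) x \<noteq> 0" for x
    proof -
      obtain as where as: "as \<in> words m n" "sorted as" "distinct as"
        "degree (ext_sym_ev m n (kpt (n + 2)) x) = digits (n + 2) as"
        using ext_ev_degree[OF x] by blast
      note bs = strict_word_minus[OF as(1-3) dn]
      obtain z where "z \<in> carrier (Sym d (Div m U))" "sym_div_ev d m (kpt (n + 2)) z \<noteq> 0"
        "degree (sym_div_ev d m (kpt (n + 2)) z) = digits (n + 2) (map (\<lambda>i. as ! i - i) [0..<m])"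
        using sym_div_exists[OF _ bs(1,2), of "n + 2"] by auto
      moreover have "degree (vol_ev m (ext_prod 2 U [e1, e2]) (kpt (n + 2))) = (\<Sum>j<m. j * (n + 2) ^ j)"
        unfolding vol_ev_bas[OF pt] using dn by (intro vandermonde_degree) auto
      ultimately show ?thesis
        using bs(3)[of "n + 2"] as(4) by auto
    qed
    show "x = \<zero>\<^bsub>Ext m (Sym n U)\<^esub>" if "x \<in> carrier (Ext m (Sym n U))" "ext_sym_ev m n (kpt (n + 2)) x = 0" for x
      using that by (rule ext_ev_inj)
    show "z = \<zero>\<^bsub>Sym d (Div m U)\<^esub>"
      if "z \<in> carrier (Sym d (Div m U))" "sym_div_ev d m (kpt (n + 2)) z = 0" for z
      using that dn by (intro sym_div_ev_inj[of "n + 2"]) auto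
  qed (use U pt in \<open>simp_all add: kmod_Ext kmod_Sym kmod_Div lin_form_ext_sym_ev lin_form_sym_div_ev\<close>)
qed

end

subsection \<open>Bases adapted to a volume element\<close>

lemma plane_kmod: "plane U \<Longrightarrow> kmod U"
  by (simp add: plane_def vectorspace_def)

lemma plane_based:
  fixes U :: "('k::field, 'u) module" (structure)
  assumes "plane U"
  obtains e1 e2 where "based_plane U e1 e2"
proof -
  have U: "kmod U"
    using assms by (rule plane_kmod)
  interpret vectorspace class_ring U
    using assms by (simp add: plane_def)
  obtain A where A: "finite A" "basis A"
    using finite_basis_exists assms by (auto simp: plane_def)
  then have "card A = 2"
    using dim_basis assms by (auto simp: plane_def)
  then obtain e1 e2 where e: "A = {e1, e2}" "e1 \<noteq> e2"
    by (auto simp: card_2_iff)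
  have AU: "A \<subseteq> carrier U" and span: "mspan U A = carrier U" and li: "\<not> lin_dep A"
    using A by (auto simp: basis_def)
  have gen: "generates U {e1, e2}"
    unfolding generates_def using mspan_least[OF U AU] AU span e by auto
  have eU: "e1 \<in> carrier U" "e2 \<in> carrier U"
    using AU e by auto
  have indep: "a = 0 \<and> b = 0" if "a \<odot> e1 \<oplus> b \<odot> e2 = \<zero>" for a b
  proof (rule ccontr)
    assume nz: "\<not> (a = 0 \<and> b = 0)"
    define c where "c = (\<lambda>x. if x = e1 then a else b)"
    have "lincomb c A = \<zero>"
      unfolding lincomb_def e(1) using that eU e(2) U by (simp add: c_def)
    moreover have "\<exists>x\<in>A. c x \<noteq> 0"
      using nz e by (auto simp: c_def)
    ultimately have "lin_dep A"
      unfolding lin_dep_def using A(1) by auto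
    then show False
      using li by simp
  qed
  have coord: "\<exists>a b. u = a \<odot> e1 \<oplus> b \<odot> e2" if "u \<in> carrier U" for u
    using gen that
  proof (rule generates_induct)
    show "\<exists>a b. g = a \<odot> e1 \<oplus> b \<odot> e2" if "g \<in> {e1, e2}" for g
    proof -
      have "e1 = 1 \<odot> e1 \<oplus> 0 \<odot> e2" "e2 = 0 \<odot> e1 \<oplus> 1 \<odot> e2"
        using eU U by simp_all
      then show ?thesis
        using that by blast
    qed
    have "\<zero> = 0 \<odot> e1 \<oplus> 0 \<odot> e2"
      using eU U by simp
    then show "\<exists>a b. \<zero> = a \<odot> e1 \<oplus> b \<odot> e2"
      by blast
  next
    fix x y
    assume "\<exists>a b. x = a \<odot> e1 \<oplus> b \<odot> e2" "\<exists>a b. y = a \<odot> e1 \<oplus> b \<odot> e2"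
    then obtain a b c d where "x = a \<odot> e1 \<oplus> b \<odot> e2" "y = c \<odot> e1 \<oplus> d \<odot> e2"
      by blast
    then have "x \<oplus> y = (a + c) \<odot> e1 \<oplus> (b + d) \<odot> e2"
      using eU U M.add.m_ac by (simp add: kmod_add_smult[OF U])
    then show "\<exists>a b. x \<oplus> y = a \<odot> e1 \<oplus> b \<odot> e2"
      by blast
  next
    fix c x
    assume "\<exists>a b. x = a \<odot> e1 \<oplus> b \<odot> e2"
    then obtain a b where "x = a \<odot> e1 \<oplus> b \<odot> e2"
      by blast
    then have "c \<odot> x = (c * a) \<odot> e1 \<oplus> (c * b) \<odot> e2"
      using eU U by (simp add: kmod_smult_add[OF U] kmod_smult_assoc[OF U])
    then show "\<exists>a b. c \<odot> x = a \<odot> e1 \<oplus> b \<odot> e2"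
      by blast
  qed (rule U)
  have uniq: "a = c \<and> b = d"
    if eq: "a \<odot> e1 \<oplus> b \<odot> e2 = c \<odot> e1 \<oplus> d \<odot> e2" for a b c d
  proof -
    have "(a - c) \<odot> e1 \<oplus> (b - d) \<odot> e2 =
        (a \<odot> e1 \<oplus> b \<odot> e2) \<oplus> (-1) \<odot> (c \<odot> e1 \<oplus> d \<odot> e2)"
      using eU U M.add.m_ac kmod_add_smult[OF U eU(1), of a "-c"] kmod_add_smult[OF U eU(2), of b "-d"]
        kmod_smult_assoc[OF U eU(1), of "-1" c] kmod_smult_assoc[OF U eU(2), of "-1" d]
      by (simp add: kmod_smult_add[OF U])
    also have "\<dots> = \<zero>"
      unfolding eq using eU U kmod_minus_eq[OF U] by (metis kmod_add_closed kmod_minus_self kmod_smult_closed)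
    finally show ?thesis
      using indep by fastforce
  qed
  have forms: "\<exists>\<phi>. lin_form U \<phi> \<and> \<phi> e1 = p \<and> \<phi> e2 = q" for p q
  proof -
    define \<phi> where "\<phi> u = (THE r. \<exists>a b. u = a \<odot> e1 \<oplus> b \<odot> e2 \<and>
      r = Polynomial.smult a p + Polynomial.smult b q)" for u
    have \<phi>: "\<phi> (a \<odot> e1 \<oplus> b \<odot> e2) = Polynomial.smult a p + Polynomial.smult b q" for a b
      unfolding \<phi>_def by (rule the_equality) (use uniq in blast)+
    have "lin_form U \<phi>"
    proof (rule lin_formI)
      fix x y assume "x \<in> carrier U" "y \<in> carrier U"
      then obtain a b c d where xy: "x = a \<odot> e1 \<oplus> b \<odot> e2" "y = c \<odot> e1 \<oplus> d \<odot> e2"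
        using coord by meson
      then have "x \<oplus> y = (a + c) \<odot> e1 \<oplus> (b + d) \<odot> e2"
        using eU U M.add.m_ac by (simp add: kmod_add_smult[OF U])
      then show "\<phi> (x \<oplus> y) = \<phi> x + \<phi> y"
        by (simp only: \<phi> xy) (simp add: smult_add_left)
    next
      fix c x assume "x \<in> carrier U"
      then obtain a b where x: "x = a \<odot> e1 \<oplus> b \<odot> e2"
        using coord by meson
      then have "c \<odot> x = (c * a) \<odot> e1 \<oplus> (c * b) \<odot> e2"
        using eU U by (simp add: kmod_smult_add[OF U] kmod_smult_assoc[OF U])
      then show "\<phi> (c \<odot> x) = Polynomial.smult c (\<phi> x)"
        by (simp only: \<phi> x) (simp add: smult_add_right)
    qed
    moreover have "\<phi> e1 = p" "\<phi> e2 = q"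
      using \<phi>[of 1 0] \<phi>[of 0 1] eU U by simp_all
    ultimately show ?thesis
      by blast
  qed
  show ?thesis
    by (rule that, rule based_plane.intro) (fact U gen forms)+
qed

lemma (in based_plane) generates_wedge: "generates (Ext 2 U) {ext_prod 2 U [e1, e2]}"
proof -
  have "{as \<in> words 2 1. sorted as \<and> distinct as} = {[0, 1]}"
  proof (intro equalityI subsetI)
    fix as assume as: "as \<in> {as \<in> words 2 1. sorted as \<and> distinct as}"
    then obtain a b where "as = [a, b]"
      by (auto simp: length_Suc_conv numeral_2_eq_2)
    then show "as \<in> {[0, 1]}"
      using as by auto
  qed auto
  then show ?thesis
    using kronecker.generates_ext_words[OF kronecker_bas[of 2], of 2] by (simp add: bas_def)
qed

lemma generates_singleton:
  fixes M :: "('k::field, 'v) module" (structure)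
  assumes M: "kmod M" and w: "generates M {w}" and x: "x \<in> carrier M"
  shows "\<exists>c. x = c \<odot> w"
  using w x
proof (rule generates_induct)
  have wM: "w \<in> carrier M"
    using w by (simp add: generates_def)
  show "\<exists>c. g = c \<odot> w" if "g \<in> {w}" for g
    using that wM M by (intro exI[of _ 1]) simp
  show "\<exists>c. \<zero> = c \<odot> w"
    using wM M by (intro exI[of _ 0]) simp
  show "\<exists>c. x \<oplus> y = c \<odot> w" if "\<exists>c. x = c \<odot> w" "\<exists>c. y = c \<odot> w" for x y
    using that wM M by (metis kmod_add_smult)
  show "\<exists>d. c \<odot> x = d \<odot> w" if "\<exists>c. x = c \<odot> w" for c x
    using that wM M by (metis kmod_smult_assoc)
qed (rule M)

lemma (in based_plane) based_plane_scale:
  assumes c: "c \<noteq> 0"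
  shows "based_plane U (c \<odot>\<^bsub>U\<^esub> e1) e2"
proof (rule based_plane.intro)
  show "generates U {c \<odot>\<^bsub>U\<^esub> e1, e2}"
  proof (rule generates_trans[OF gen])
    fix N assume N: "subsp U N" "{c \<odot>\<^bsub>U\<^esub> e1, e2} \<subseteq> N"
    then have "inverse c \<odot>\<^bsub>U\<^esub> (c \<odot>\<^bsub>U\<^esub> e1) \<in> N"
      using subsp_smult[OF N(1)] by blast
    moreover have "inverse c \<odot>\<^bsub>U\<^esub> (c \<odot>\<^bsub>U\<^esub> e1) = e1"
      using kmod_smult_assoc[OF U e_closed(1), of "inverse c" c] c U e_closed by simp
    ultimately show "{e1, e2} \<subseteq> N"
      using N by auto
  qed (use U e_closed in auto)
  show "\<exists>\<phi>. lin_form U \<phi> \<and> \<phi> (c \<odot>\<^bsub>U\<^esub> e1) = a \<and> \<phi> e2 = b" for a b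
  proof -
    obtain \<phi> where "lin_form U \<phi>" "\<phi> e1 = Polynomial.smult (inverse c) a" "\<phi> e2 = b"
      using forms by blast
    then show ?thesis
      using c e_closed by (intro exI[of _ \<phi>]) (simp add: lin_form_smult)
  qed
qed (rule U)

lemma volume_basis:
  assumes pl: "plane U" and \<omega>: "\<omega> \<in> volumes U"
  obtains e1 e2 where "based_plane U e1 e2" "\<omega> = ext_prod 2 U [e1, e2]"
proof -
  obtain e1 e2 where "based_plane U e1 e2"
    using pl by (rule plane_based)
  then interpret based_plane U e1 e2 .
  have w: "[e1, e2] \<in> tuples 2 U"
    using e_closed by (simp add: tuples_iff)
  obtain c where c: "\<omega> = c \<odot>\<^bsub>Ext 2 U\<^esub> ext_prod 2 U [e1, e2]"
    using generates_singleton[OF kmod_Ext[OF U] generates_wedge] \<omega> by (auto simp: volumes_def)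
  have "c \<noteq> 0"
    using \<omega> c kmod_zero_smult[OF kmod_Ext[OF U] ext_prod_closed[OF U w]]
    by (auto simp: volumes_def)
  then have "based_plane U (c \<odot>\<^bsub>U\<^esub> e1) e2"
    by (rule based_plane_scale)
  moreover have "\<omega> = ext_prod 2 U [c \<odot>\<^bsub>U\<^esub> e1, e2]"
    using ext_prod_smult[OF U w, of 0 e1 c] e_closed by (simp add: c)
  ultimately show ?thesis
    by (rule that)
qed

lemma SL_volume:
  assumes U: "plane U" and \<omega>: "\<omega> \<in> volumes U" and g: "g \<in> SL U"
  shows "Ext_map 2 U g \<omega> = \<omega>"
proof -
  obtain e1 e2 where b: "based_plane U e1 e2" and \<omega>e: "\<omega> = ext_prod 2 U [e1, e2]"
    using U \<omega> by (rule volume_basis)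
  have gen: "generates (Ext 2 U) {\<omega>}"
    unfolding \<omega>e using b by (rule based_plane.generates_wedge)
  note E = kmod_Ext[OF plane_kmod[OF U], of 2]
  have \<omega>E: "\<omega> \<in> carrier (Ext 2 U)" "\<omega> \<noteq> \<zero>\<^bsub>Ext 2 U\<^esub>"
    using \<omega> by (auto simp: volumes_def)
  have lin: "Ext_map 2 U g \<in> lin_maps (Ext 2 U) (Ext 2 U)"
    using g by (intro Ext_map_lin_maps plane_kmod U) (simp add: SL_def)
  obtain c where c: "Ext_map 2 U g \<omega> = c \<odot>\<^bsub>Ext 2 U\<^esub> \<omega>"
    using generates_singleton[OF E gen lin_maps_closed[OF lin \<omega>E(1)]] by blast
  have all: "\<forall>w\<in>carrier (Ext 2 U). Ext_map 2 U g w = c \<odot>\<^bsub>Ext 2 U\<^esub> w"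
  proof
    fix w assume "w \<in> carrier (Ext 2 U)"
    then obtain d where "w = d \<odot>\<^bsub>Ext 2 U\<^esub> \<omega>"
      using generates_singleton[OF E gen] by blast
    then show "Ext_map 2 U g w = c \<odot>\<^bsub>Ext 2 U\<^esub> w"
      using \<omega>E(1) c kmod_smult_assoc[OF E \<omega>E(1), of c d] kmod_smult_assoc[OF E \<omega>E(1), of d c]
      by (simp add: lin_maps_smult[OF lin] mult.commute)
  qed
  have "(THE c. \<forall>w\<in>carrier (Ext 2 U). Ext_map 2 U g w = c \<odot>\<^bsub>Ext 2 U\<^esub> w) = c"
  proof (rule the_equality)
    show "\<forall>w\<in>carrier (Ext 2 U). Ext_map 2 U g w = c \<odot>\<^bsub>Ext 2 U\<^esub> w"
      by (rule all)
    fix d assume "\<forall>w\<in>carrier (Ext 2 U). Ext_map 2 U g w = d \<odot>\<^bsub>Ext 2 U\<^esub> w"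
    then have eq: "d \<odot>\<^bsub>Ext 2 U\<^esub> \<omega> = c \<odot>\<^bsub>Ext 2 U\<^esub> \<omega>"
      using \<omega>E(1) c by auto
    have "(d - c) \<odot>\<^bsub>Ext 2 U\<^esub> \<omega> = d \<odot>\<^bsub>Ext 2 U\<^esub> \<omega> \<oplus>\<^bsub>Ext 2 U\<^esub> (-1) \<odot>\<^bsub>Ext 2 U\<^esub> (c \<odot>\<^bsub>Ext 2 U\<^esub> \<omega>)"
      using kmod_add_smult[OF E \<omega>E(1), of d "-c"] kmod_smult_assoc[OF E \<omega>E(1), of "-1" c] by simp
    also have "\<dots> = \<zero>\<^bsub>Ext 2 U\<^esub>"
      unfolding eq using \<omega>E(1) E kmod_minus_eq[OF E] by (metis kmod_minus_self kmod_smult_closed)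
    finally have zero: "(d - c) \<odot>\<^bsub>Ext 2 U\<^esub> \<omega> = \<zero>\<^bsub>Ext 2 U\<^esub>" .
    show "d = c"
    proof (rule ccontr)
      assume "d \<noteq> c"
      then have "\<omega> = inverse (d - c) \<odot>\<^bsub>Ext 2 U\<^esub> ((d - c) \<odot>\<^bsub>Ext 2 U\<^esub> \<omega>)"
        using kmod_smult_assoc[OF E \<omega>E(1), of "inverse (d - c)" "d - c"] E \<omega>E(1) by simp
      then show False
        using \<omega>E(2) E by (simp add: zero)
    qed
  qed
  then have "c = 1"
    using g U by (simp add: SL_def lin_det_def plane_def)
  then show ?thesis
    using c \<omega>E(1) E by simp
qed

subsection \<open>Naturality\<close>

lemma points_comp: "\<lbrakk>points U' \<phi>; g \<in> lin_maps U U'\<rbrakk> \<Longrightarrow> points U (\<lambda>i x. \<phi> i (g x))"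
  by (auto intro: lin_form_comp)

lemma
  assumes U: "kmod U" and U': "kmod U'" and g: "g \<in> lin_maps U U'" and \<phi>: "points U' \<phi>"
  shows sym_div_ev_natural: "z \<in> carrier (Sym d (Div m U)) \<Longrightarrow>
      sym_div_ev d m \<phi> (Sym_map d (Div m U') (Div_map m U' g) z) = sym_div_ev d m (\<lambda>i x. \<phi> i (g x)) z"
    and div_sym_ev_natural: "t \<in> carrier (Div m (Sym d U)) \<Longrightarrow>
      div_sym_ev m d \<phi> (Div_map m (Sym d U') (Sym_map d U' g) t) = div_sym_ev m d (\<lambda>i x. \<phi> i (g x)) t"
    and ext_sym_ev_natural: "x \<in> carrier (Ext m (Sym n U)) \<Longrightarrow>
      ext_sym_ev m n \<phi> (Ext_map m (Sym n U') (Sym_map n U' g) x) = ext_sym_ev m n (\<lambda>i x. \<phi> i (g x)) x"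
    and wedge_ev_natural: "w \<in> carrier (Ext 2 U) \<Longrightarrow>
      wedge_ev (\<phi> i) (\<phi> j) (Ext_map 2 U' g w) = wedge_ev (\<lambda>x. \<phi> i (g x)) (\<lambda>x. \<phi> j (g x)) w"
proof -
  note \<phi>g = points_comp[OF \<phi> g]
  have sym: "sym_ev d (\<phi> i) (Sym_map d U' g y) = sym_ev d (\<lambda>x. \<phi> i (g x)) y" if "y \<in> carrier (Sym d U)" for d i y
    using \<phi> \<phi>g that by (intro sym_ev_Sym_map[OF U U' g]) auto
  show "sym_div_ev d m \<phi> (Sym_map d (Div m U') (Div_map m U' g) z) = sym_div_ev d m (\<lambda>i x. \<phi> i (g x)) z"
    if "z \<in> carrier (Sym d (Div m U))"
  proof (rule sym_ev_Sym_map[OF kmod_Div[OF U] kmod_Div[OF U'] Div_map_lin_maps[OF U U' g] _ _ _ that])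
    show "lin_form (Div m U') (tens_ev m \<phi>)" "lin_form (Div m U) (tens_ev m (\<lambda>i x. \<phi> i (g x)))"
      using U U' \<phi> \<phi>g by (simp_all add: lin_form_tens_ev_Div)
    show "tens_ev m \<phi> (Div_map m U' g t) = tens_ev m (\<lambda>i x. \<phi> i (g x)) t" if "t \<in> carrier (Div m U)" for t
      using that \<phi> \<phi>g by (intro tens_ev_tensor_map[OF U U' g]) (auto simp: Div_carrier)
  qed
  show "div_sym_ev m d \<phi> (Div_map m (Sym d U') (Sym_map d U' g) t) = div_sym_ev m d (\<lambda>i x. \<phi> i (g x)) t"
    if "t \<in> carrier (Div m (Sym d U))"
    using that U U' \<phi> \<phi>g sym
    by (intro tens_ev_tensor_map[OF kmod_Sym[OF U] kmod_Sym[OF U'] Sym_map_lin_maps[OF U U' g]])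
      (auto simp: Div_carrier lin_form_sym_ev)
  show "ext_sym_ev m n \<phi> (Ext_map m (Sym n U') (Sym_map n U' g) x) = ext_sym_ev m n (\<lambda>i x. \<phi> i (g x)) x"
    if "x \<in> carrier (Ext m (Sym n U))"
    using that U U' \<phi> \<phi>g sym
    by (intro ext_ev_Ext_map[OF kmod_Sym[OF U] kmod_Sym[OF U'] Sym_map_lin_maps[OF U U' g]])
      (auto simp: lin_form_sym_ev)
  show "wedge_ev (\<phi> i) (\<phi> j) (Ext_map 2 U' g w) = wedge_ev (\<lambda>x. \<phi> i (g x)) (\<lambda>x. \<phi> j (g x)) w"
    if "w \<in> carrier (Ext 2 U)"
    unfolding wedge_ev_def using that \<phi> \<phi>g by (intro ext_ev_Ext_map[OF U U' g]) auto
qed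

lemma natural_SL_isosI:
  assumes iso: "\<And>U \<omega>. \<lbrakk>plane U; \<omega> \<in> volumes U\<rbrakk> \<Longrightarrow> \<Phi> U \<omega> \<in> lin_isos (F U) (G U)"
    and nat: "\<And>U \<omega> U' \<omega>' g x. \<lbrakk>plane U; \<omega> \<in> volumes U; plane U'; \<omega>' \<in> volumes U'; g \<in> lin_maps U U';
        Ext_map 2 U' g \<omega> = \<omega>'; x \<in> carrier (F U)\<rbrakk> \<Longrightarrow> \<Phi> U' \<omega>' (F_map U' g x) = G_map U' g (\<Phi> U \<omega> x)"
  shows "natural_SL_isos F F_map G G_map \<Phi>"
  unfolding natural_SL_isos_def
proof (intro conjI allI impI ballI)
  fix U \<omega> g x assume "plane U \<and> \<omega> \<in> volumes U" and g: "g \<in> SL U" and x: "x \<in> carrier (F U)"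
  then show "\<Phi> U \<omega> (F_map U g x) = G_map U g (\<Phi> U \<omega> x)"
    using SL_volume[OF _ _ g] by (intro nat) (auto simp: SL_def)
qed (use assms in blast)+

lemma natural_evaluation:
  fixes F :: "('k::field, 'u) module \<Rightarrow> ('k, 'a) module" and G :: "('k, 'u) module \<Rightarrow> ('k, 'b) module"
  assumes ev: "\<And>U \<omega>. \<lbrakk>plane U; \<omega> \<in> volumes U\<rbrakk> \<Longrightarrow> \<exists>\<kappa>. evaluation (F U) (G U) (points U) f h (D \<omega>) \<kappa>"
    and G: "\<And>U U' g. \<lbrakk>kmod U; kmod U'; g \<in> lin_maps U U'\<rbrakk> \<Longrightarrow> G_map U' g \<in> lin_maps (G U) (G U')"
    and nat: "\<And>U U' g \<phi> x. \<lbrakk>kmod U; kmod U'; g \<in> lin_maps U U'; points U' \<phi>; x \<in> carrier (F U)\<rbrakk> \<Longrightarrow>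
        f \<phi> (F_map U' g x) = f (\<lambda>i x. \<phi> i (g x)) x"
      "\<And>U U' g \<phi> z. \<lbrakk>kmod U; kmod U'; g \<in> lin_maps U U'; points U' \<phi>; z \<in> carrier (G U)\<rbrakk> \<Longrightarrow>
        h \<phi> (G_map U' g z) = h (\<lambda>i x. \<phi> i (g x)) z"
      "\<And>U U' g \<phi> \<omega>. \<lbrakk>kmod U; kmod U'; g \<in> lin_maps U U'; points U' \<phi>; \<omega> \<in> carrier (Ext 2 U)\<rbrakk> \<Longrightarrow>
        D (Ext_map 2 U' g \<omega>) \<phi> = D \<omega> (\<lambda>i x. \<phi> i (g x))"
  shows "natural_SL_isos F F_map G G_map (\<lambda>U \<omega> x. The (evaluation.related (G U) (points U) f h (D \<omega>) x))"
    (is "natural_SL_isos F F_map G G_map (\<lambda>U \<omega> x. The (?rel U \<omega> x))")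
proof (rule natural_SL_isosI)
  fix U :: "('k, 'u) module" and \<omega> assume U: "plane U" "\<omega> \<in> volumes U"
  obtain \<kappa> where e: "evaluation (F U) (G U) (points U) f h (D \<omega>) \<kappa>"
    using ev[OF U] ..
  then show "(\<lambda>x. The (?rel U \<omega> x)) \<in> lin_isos (F U) (G U)"
    by (rule evaluation.The_related_iso)
  fix U' :: "('k, 'u) module" and \<omega>' g x
  assume U': "plane U'" "\<omega>' \<in> volumes U'" and g: "g \<in> lin_maps U U'"
    and \<omega>': "Ext_map 2 U' g \<omega> = \<omega>'" and x: "x \<in> carrier (F U)"
  note k = plane_kmod[OF U(1)] plane_kmod[OF U'(1)] g
  obtain \<kappa>' where e': "evaluation (F U') (G U') (points U') f h (D \<omega>') \<kappa>'"
    using ev[OF U'] ..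
  define z where "z = The (?rel U \<omega> x)"
  have z: "z \<in> carrier (G U)" "\<And>\<phi>. points U \<phi> \<Longrightarrow> h \<phi> z * D \<omega> \<phi> = f \<phi> x"
    using evaluation.The_related[OF e x] unfolding z_def evaluation.related_def[OF e] by blast+
  have "h \<phi> (G_map U' g z) * D \<omega>' \<phi> = f \<phi> (F_map U' g x)" if \<phi>: "points U' \<phi>" for \<phi>
    using z(2)[OF points_comp[OF \<phi> g]] U(2) unfolding \<omega>'[symmetric]
    by (simp add: nat(1)[OF k \<phi> x] nat(2)[OF k \<phi> z(1)] nat(3)[OF k \<phi>] volumes_def)
  then have "?rel U' \<omega>' (F_map U' g x) (G_map U' g z)"
    unfolding evaluation.related_def[OF e'] using lin_maps_closed[OF G[OF k] z(1)] by blast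
  then show "The (?rel U' \<omega>' (F_map U' g x)) = G_map U' g (The (?rel U \<omega> x))"
    unfolding z_def[symmetric] by (rule evaluation.The_related_eq[OF e'])
qed

lemma Sym_Div_map_lin_maps:
  "\<lbrakk>kmod U; kmod U'; g \<in> lin_maps U U'\<rbrakk> \<Longrightarrow>
    Sym_map d (Div m U') (Div_map m U' g) \<in> lin_maps (Sym d (Div m U)) (Sym d (Div m U'))"
  by (intro Sym_map_lin_maps kmod_Div Div_map_lin_maps)

lemma natural_ext_sym:
  fixes m n d :: nat
  assumes dn: "d + m = n + 1"
  shows "\<exists>\<Phi> :: ('k::field, 'u) module \<Rightarrow> _. natural_SL_isos
    (\<lambda>U. Ext m (Sym n U)) (\<lambda>U g. Ext_map m (Sym n U) (Sym_map n U g))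
    (\<lambda>U. Sym d (Div m U)) (\<lambda>U g. Sym_map d (Div m U) (Div_map m U g)) \<Phi>"
proof (rule exI, rule natural_evaluation)
  show "\<exists>\<kappa>. evaluation (Ext m (Sym n U)) (Sym d (Div m U)) (points U) (ext_sym_ev m n) (sym_div_ev d m) (vol_ev m \<omega>) \<kappa>"
    if "plane U" "\<omega> \<in> volumes U" for U :: "('k, 'u) module" and \<omega>
    using volume_basis[OF that] based_plane.evaluation_ext[OF _ dn] by metis
  show "vol_ev m (Ext_map 2 U' g \<omega>) \<phi> = vol_ev m \<omega> (\<lambda>i x. \<phi> i (g x))"
    if "kmod U" "kmod U'" "g \<in> lin_maps U U'" "points U' \<phi>" "\<omega> \<in> carrier (Ext 2 U)"
    for U U' :: "('k, 'u) module" and g \<phi> \<omega>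
    using that by (simp add: vol_ev_def wedge_ev_natural)
qed (rule Sym_Div_map_lin_maps ext_sym_ev_natural sym_div_ev_natural; assumption)+

lemma natural_div_sym:
  fixes m d :: nat
  shows "\<exists>\<Psi> :: ('k::field, 'u) module \<Rightarrow> _. natural_SL_isos
    (\<lambda>U. Div m (Sym d U)) (\<lambda>U g. Div_map m (Sym d U) (Sym_map d U g))
    (\<lambda>U. Sym d (Div m U)) (\<lambda>U g. Sym_map d (Div m U) (Div_map m U g)) \<Psi>"
proof (rule exI, rule natural_evaluation)
  show "\<exists>\<kappa>. evaluation (Div m (Sym d U)) (Sym d (Div m U)) (points U) (div_sym_ev m d) (sym_div_ev d m) ((\<lambda>_ _. 1) \<omega>) \<kappa>"
    if "plane U" for U :: "('k, 'u) module" and \<omega> :: "('u list \<Rightarrow>\<^sub>0 'k) set set"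
    using plane_based[OF that] based_plane.evaluation_div_sym by metis
qed (rule Sym_Div_map_lin_maps div_sym_ev_natural sym_div_ev_natural refl; assumption?)+

theorem theorem2p1:
  fixes m n :: nat
  shows
    "(m \<le> n + 1 \<longrightarrow>
      (\<exists>\<Phi> :: ('k::field, 'u) module \<Rightarrow> _. natural_SL_isos
        (\<lambda>U. Ext m (Sym n U)) (\<lambda>U g. Ext_map m (Sym n U) (Sym_map n U g))
        (\<lambda>U. Sym (n + 1 - m) (Div m U)) (\<lambda>U g. Sym_map (n + 1 - m) (Div m U) (Div_map m U g))
        \<Phi>)) \<and>
     (m \<le> n \<longrightarrow>
      (\<exists>\<Psi> :: ('k::field, 'u) module \<Rightarrow> _. natural_SL_isos
        (\<lambda>U. Div m (Sym (n - m) U)) (\<lambda>U g. Div_map m (Sym (n - m) U) (Sym_map (n - m) U g))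
        (\<lambda>U. Sym (n - m) (Div m U)) (\<lambda>U g. Sym_map (n - m) (Div m U) (Div_map m U g))
        \<Psi>))"
proof (intro conjI impI natural_div_sym)
  assume "m \<le> n + 1"
  then have "n + 1 - m + m = n + 1"
    by simp
  then show "\<exists>\<Phi> :: ('k, 'u) module \<Rightarrow> _. natural_SL_isos
        (\<lambda>U. Ext m (Sym n U)) (\<lambda>U g. Ext_map m (Sym n U) (Sym_map n U g))
        (\<lambda>U. Sym (n + 1 - m) (Div m U)) (\<lambda>U g. Sym_map (n + 1 - m) (Div m U) (Div_map m U g)) \<Phi>"
    by (rule natural_ext_sym)
qed

end
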